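(* Let $M_j=(X_j,d_j,T_j)$ be $n$-dimensional integral current spaces for $j\in\mathbb{N}\cup\{\infty\}$, and for $j\in\mathbb{N}$ let $x_j\in V_j\subset X_j$ be such that $M_j\llcorner V_j$ is an $n$-dimensional integral current space. Assume the following: (1) There are an integral current space $N_\infty$, a point $x_\infty\in\overline{\operatorname{set}(N_\infty)}$, and a separable complete metric space $W$ together with metric-isometric embeddings into $W$, such that $(M_j\llcorner V_j,x_j)\xrightarrow[W]{\mathrm{F}}(N_\infty,x_\infty)$. (2) There exists $\delta>0$ such that the metric ball $B(x_j,\delta)\subset X_j$ is entirely contained in $V_j$ for all large $j$. Then for any choice of a separable complete metric space $Z$ and metric-isometric embeddings $\varphi_j:X_j\to Z$ ($j\in\mathbb{N}\cup\{\infty\}$) such that $M_j\xrightarrow[Z]{\mathrm{F}}M_\infty$, there exist a subsequence $x_{j_k}$ and a point $x'_\infty\in\overline{X}_\infty$ such that $$(M_{j_k},x_{j_k})\xrightarrow[Z]{\mathrm{F}}(M_\infty,x'_\infty).$$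
   Context: An $n$-dimensional integral current space $M=(X,d,T)$ (Sormani--Wenger) consists of a metric space $(X,d)$ and an $n$-dimensional Ambrosio--Kirchheim integral current $T$ on the completion $\overline X$ with $\operatorname{set}(T)=X$, where $\operatorname{set}(T)=\{p:\liminf_{r\to0}\|T\|(B(p,r))/r^n>0\}$ and $\|T\|$ is the mass measure of $T$; the zero space $\mathbf 0$ is also allowed. Write $\operatorname{set}(M)=X$, with $\overline{\operatorname{set}(M)}$ its metric completion. $B(p,r)$ denotes the closed ball. A metric-isometric embedding is a distance-preserving map; it extends to the metric completion. Given a separable complete metric space $Z$ and metric-isometric embeddings $\varphi_j:X_j\to Z$, $j\in\mathbb{N}\cup\{\infty\}$, the notation $M_j\xrightarrow[Z]{\mathrm F}M_\infty$ means that ${\varphi_j}_\#(T_j)\to{\varphi_\infty}_\#(T_\infty)$ in the flat sense in $Z$, i.e. with respect to the flat distance $d_F^Z(S_1,S_2)=\inf\{\mathbf M(U)+\mathbf M(V): S_1-S_2=U+\partial V\}$, where $U$, $V$ range over integral currents in $Z$ of dimensions $n$ and $n+1$, and $\mathbf M$ is mass. The choice of embeddings is part of the data indicated by $Z$. For $x_j\in X_j$ ($j\in\mathbb{N}$) and $x_\infty\in\overline X_\infty$, $(M_j,x_j)\xrightarrow[Z]{\mathrm F}(M_\infty,x_\infty)$ means that $M_j\xrightarrow[Z]{\mathrm F}M_\infty$ and $\varphi_j(x_j)\to\varphi_\infty(x_\infty)$ in $Z$. For subsequences the same embeddings are used. For $V\subset X$, $M\llcorner V:=(\operatorname{set}(T\llcorner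 V),d,T\llcorner V)$, where $T\llcorner V$ is the restriction of the current $T$ to $V$ and the metric is the restriction of $d$. *)

theory Defs
  imports "HOL-Analysis.Analysis"
begin

section \<open>Lipschitz functions on a metric space\<close>

definition lip :: "'a metric \<Rightarrow> ('a \<Rightarrow> real) set" where
  "lip E = {f. Lipschitz_continuous_map E euclidean_metric f}"

definition lip_b :: "'a metric \<Rightarrow> ('a \<Rightarrow> real) set" where
  "lip_b E = {f \<in> lip E. bounded (f ` mspace E)}"

definition lip_const :: "'a metric \<Rightarrow> ('a \<Rightarrow> real) \<Rightarrow> real" where
  "lip_const E f =
     Inf {L. 0 \<le> L \<and> (\<forall>x\<in>mspace E. \<forall>y\<in>mspace E. \<bar>f x - f y\<bar> \<le> L * mdist E x y)}"

definition lip_tuples :: "nat \<Rightarrow> 'a metric \<Rightarrow> ('a \<Rightarrow> real) list set" where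
  "lip_tuples k E = {\<pi>. length \<pi> = k \<and> set \<pi> \<subseteq> lip E}"

definition metric_borel :: "'a metric \<Rightarrow> 'a measure" where
  "metric_borel E = sigma (mspace E) {U. openin (mtopology_of E) U}"


section \<open>Metric currents (Ambrosio--Kirchheim)\<close>

text \<open>A \<open>k\<close>-dimensional metric functional \<open>T(f, \<pi>\<^sub>1, \<dots>, \<pi>\<^sub>k)\<close> is represented as \<open>T f \<pi>\<close>, where
  \<open>\<pi>\<close> is the list of the \<open>\<pi>\<^sub>i\<close>. Only the values of \<open>T\<close> at \<open>f \<in> lip_b E\<close> and
  \<open>\<pi> \<in> lip_tuples k E\<close> are meaningful, so equality of currents is \<open>current_eq\<close> below rather
  than equality of HOL functions.\<close>

type_synonym 'a functional = "('a \<Rightarrow> real) \<Rightarrow> ('a \<Rightarrow> real) list \<Rightarrow> real"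

definition current_eq :: "nat \<Rightarrow> 'a metric \<Rightarrow> 'a functional \<Rightarrow> 'a functional \<Rightarrow> bool" where
  "current_eq k E S T \<longleftrightarrow> (\<forall>f\<in>lip_b E. \<forall>\<pi>\<in>lip_tuples k E. S f \<pi> = T f \<pi>)"

definition multilinear_functional :: "nat \<Rightarrow> 'a metric \<Rightarrow> 'a functional \<Rightarrow> bool" where
  "multilinear_functional k E T \<longleftrightarrow>
     (\<forall>f\<in>lip_b E. \<forall>g\<in>lip_b E. \<forall>\<pi>\<in>lip_tuples k E. \<forall>a b.
        T (\<lambda>x. a * f x + b * g x) \<pi> = a * T f \<pi> + b * T g \<pi>) \<and>
     (\<forall>f\<in>lip_b E. \<forall>\<pi>\<in>lip_tuples k E. \<forall>i<k. \<forall>p\<in>lip E. \<forall>q\<in>lip E. \<forall>a b.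
        T f (\<pi>[i := \<lambda>x. a * p x + b * q x]) = a * T f (\<pi>[i := p]) + b * T f (\<pi>[i := q]))"

definition continuous_functional :: "nat \<Rightarrow> 'a metric \<Rightarrow> 'a functional \<Rightarrow> bool" where
  "continuous_functional k E T \<longleftrightarrow>
     (\<forall>f\<in>lip_b E. \<forall>\<pi>\<in>lip_tuples k E. \<forall>\<rho>. \<forall>C::real.
        (\<forall>m::nat. \<rho> m \<in> lip_tuples k E) \<and>
        (\<forall>m. \<forall>i<k. lip_const E (\<rho> m ! i) \<le> C) \<and>
        (\<forall>i<k. \<forall>x\<in>mspace E. (\<lambda>m. (\<rho> m ! i) x) \<longlonglongrightarrow> (\<pi> ! i) x)
        \<longrightarrow> (\<lambda>m. T f (\<rho> m)) \<longlonglongrightarrow> T f \<pi>)"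

definition local_functional :: "nat \<Rightarrow> 'a metric \<Rightarrow> 'a functional \<Rightarrow> bool" where
  "local_functional k E T \<longleftrightarrow>
     (\<forall>f\<in>lip_b E. \<forall>\<pi>\<in>lip_tuples k E.
        (\<exists>i<k. \<exists>U c. openin (mtopology_of E) U \<and> {x \<in> mspace E. f x \<noteq> 0} \<subseteq> U \<and>
                 (\<forall>x\<in>U. (\<pi> ! i) x = c))
        \<longrightarrow> T f \<pi> = 0)"

definition mass_bound :: "nat \<Rightarrow> 'a metric \<Rightarrow> 'a functional \<Rightarrow> 'a measure \<Rightarrow> bool" where
  "mass_bound k E T \<mu> \<longleftrightarrow>
     sets \<mu> = sets (metric_borel E) \<and> finite_measure \<mu> \<and>
     (\<forall>f\<in>lip_b E. \<forall>\<pi>\<in>lip_tuples k E.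
        \<bar>T f \<pi>\<bar> \<le> prod_list (map (lip_const E) \<pi>) * (\<integral>x. \<bar>f x\<bar> \<partial>\<mu>))"

text \<open>\<open>\<parallel>T\<parallel>\<close> is the least of the measures bounding \<open>T\<close>; it exists for functionals of finite mass.\<close>

definition mass_measure :: "nat \<Rightarrow> 'a metric \<Rightarrow> 'a functional \<Rightarrow> 'a measure" where
  "mass_measure k E T =
     (THE \<mu>. mass_bound k E T \<mu> \<and>
        (\<forall>\<nu>. mass_bound k E T \<nu> \<longrightarrow> (\<forall>A\<in>sets (metric_borel E). emeasure \<mu> A \<le> emeasure \<nu> A)))"

definition mass :: "nat \<Rightarrow> 'a metric \<Rightarrow> 'a functional \<Rightarrow> ennreal" where
  "mass k E T = emeasure (mass_measure k E T) (mspace E)"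

definition metric_current :: "nat \<Rightarrow> 'a metric \<Rightarrow> 'a functional \<Rightarrow> bool" where
  "metric_current k E T \<longleftrightarrow>
     multilinear_functional k E T \<and> continuous_functional k E T \<and> local_functional k E T \<and>
     (\<exists>\<mu>. mass_bound k E T \<mu>)"

definition boundary :: "'a functional \<Rightarrow> 'a functional" where
  "boundary T = (\<lambda>f \<pi>. T (\<lambda>_. 1) (f # \<pi>))"

definition pushforward :: "('a \<Rightarrow> 'b) \<Rightarrow> 'a functional \<Rightarrow> 'b functional" where
  "pushforward \<phi> T = (\<lambda>f \<pi>. T (f \<circ> \<phi>) (map (\<lambda>p. p \<circ> \<phi>) \<pi>))"

text \<open>The extension of \<open>T\<close> to bounded Borel functions \<open>g\<close> in the first argument, by density of
  the bounded Lipschitz functions in \<open>L\<^sup>1(\<parallel>T\<parallel>)\<close>.\<close>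

definition borel_extension ::
  "nat \<Rightarrow> 'a metric \<Rightarrow> 'a functional \<Rightarrow> ('a \<Rightarrow> real) \<Rightarrow> ('a \<Rightarrow> real) list \<Rightarrow> real" where
  "borel_extension k E T g \<pi> =
     (THE c. \<forall>h. (\<forall>m::nat. h m \<in> lip_b E) \<and>
                 (\<lambda>m. \<integral>\<^sup>+x. ennreal \<bar>h m x - g x\<bar> \<partial>mass_measure k E T) \<longlonglongrightarrow> 0
             \<longrightarrow> (\<lambda>m. T (h m) \<pi>) \<longlonglongrightarrow> c)"

text \<open>\<open>T \<llcorner> A\<close> for a Borel set \<open>A\<close>.\<close>

definition restrict_current ::
  "nat \<Rightarrow> 'a metric \<Rightarrow> 'a functional \<Rightarrow> 'a set \<Rightarrow> 'a functional" where
  "restrict_current k E T A = (\<lambda>f \<pi>. borel_extension k E T (\<lambda>x. indicator A x * f x) \<pi>)"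


section \<open>Euclidean space and Hausdorff measure\<close>

text \<open>\<open>\<real>\<^sup>k\<close> for a natural number \<open>k\<close>, carried by the space of \<open>Pi\<^sub>M {..<k} (\<lambda>_. lborel)\<close>.\<close>

definition euclid :: "nat \<Rightarrow> (nat \<Rightarrow> real) metric" where
  "euclid k = metric ({..<k} \<rightarrow>\<^sub>E UNIV, \<lambda>x y. L2_set (\<lambda>i. x i - y i) {..<k})"

lemma Metric_space_euclid:
  fixes k :: nat
  shows "Metric_space ({..<k} \<rightarrow>\<^sub>E (UNIV :: real set)) (\<lambda>x y. L2_set (\<lambda>i. x i - y i) {..<k})"
proof
  show "0 \<le> L2_set (\<lambda>i. x i - y i) {..<k}" for x y :: "nat \<Rightarrow> real"
    by simp
  show "L2_set (\<lambda>i. x i - y i) {..<k} = L2_set (\<lambda>i. y i - x i) {..<k}" for x y :: "nat \<Rightarrow> real"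
    unfolding L2_set_def by (simp add: power2_commute)
  show "L2_set (\<lambda>i. x i - y i) {..<k} = 0 \<longleftrightarrow> x = y"
    if "x \<in> {..<k} \<rightarrow>\<^sub>E UNIV" "y \<in> {..<k} \<rightarrow>\<^sub>E UNIV" for x y :: "nat \<Rightarrow> real"
    using that by (auto simp: L2_set_eq_0_iff intro: PiE_ext)
  show "L2_set (\<lambda>i. x i - z i) {..<k} \<le>
      L2_set (\<lambda>i. x i - y i) {..<k} + L2_set (\<lambda>i. y i - z i) {..<k}" for x y z :: "nat \<Rightarrow> real"
    using L2_set_triangle_ineq[of "\<lambda>i. x i - y i" "\<lambda>i. y i - z i" "{..<k}"] by simp
qed

lemma mspace_euclid: "mspace (euclid k) = {..<k} \<rightarrow>\<^sub>E UNIV"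
  by (simp add: euclid_def Metric_space.mspace_metric[OF Metric_space_euclid])

lemma mdist_euclid: "mdist (euclid k) = (\<lambda>x y. L2_set (\<lambda>i. x i - y i) {..<k})"
  by (simp add: euclid_def Metric_space.mdist_metric[OF Metric_space_euclid])

definition lebesgue_euclid :: "nat \<Rightarrow> (nat \<Rightarrow> real) measure" where
  "lebesgue_euclid k = completion (Pi\<^sub>M {..<k} (\<lambda>_. lborel))"

definition ediam :: "'a metric \<Rightarrow> 'a set \<Rightarrow> ennreal" where
  "ediam E A = (SUP x\<in>A. SUP y\<in>A. ennreal (mdist E x y))"

definition hausdorff_pre :: "nat \<Rightarrow> 'a metric \<Rightarrow> real \<Rightarrow> 'a set \<Rightarrow> ennreal" where
  "hausdorff_pre k E \<delta> A =
     Inf {(\<Sum>i. if C i = {} then 0 else ennreal (unit_ball_vol (real k)) * (ediam E (C i) / 2) ^ k) | C.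
            (\<forall>i::nat. C i \<subseteq> mspace E \<and> ediam E (C i) \<le> ennreal \<delta>) \<and> A \<subseteq> (\<Union>i. C i)}"

definition hausdorff_measure :: "nat \<Rightarrow> 'a metric \<Rightarrow> 'a set \<Rightarrow> ennreal" where
  "hausdorff_measure k E A = (SUP \<delta>\<in>{0<..}. hausdorff_pre k E \<delta> A)"

definition hausdorff_measurable :: "nat \<Rightarrow> 'a metric \<Rightarrow> 'a set \<Rightarrow> bool" where
  "hausdorff_measurable k E S \<longleftrightarrow> S \<subseteq> mspace E \<and>
     (\<forall>A\<subseteq>mspace E. hausdorff_measure k E A =
        hausdorff_measure k E (A \<inter> S) + hausdorff_measure k E (A - S))"

definition countably_rectifiable :: "nat \<Rightarrow> 'a metric \<Rightarrow> 'a set \<Rightarrow> bool" where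
  "countably_rectifiable k E S \<longleftrightarrow> hausdorff_measurable k E S \<and>
     (\<exists>A f. (\<forall>i::nat. A i \<subseteq> mspace (euclid k) \<and>
                Lipschitz_continuous_map (submetric (euclid k) (A i)) E (f i)) \<and>
            hausdorff_measure k E (S - (\<Union>i. f i ` A i)) = 0)"


section \<open>Integral currents\<close>

text \<open>The matrix of partial derivatives is defined almost everywhere, by Rademacher's theorem;
  its determinant is written out by the Leibniz formula since the size \<open>k\<close> is not a type.\<close>

definition jacobian :: "nat \<Rightarrow> ((nat \<Rightarrow> real) \<Rightarrow> real) list \<Rightarrow> (nat \<Rightarrow> real) \<Rightarrow> real" where
  "jacobian k \<pi> x =
     (\<Sum>p | p permutes {..<k}.
        of_int (sign p) * (\<Prod>i<k. deriv (\<lambda>t. (\<pi> ! i) (x(p i := t))) (x (p i))))"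

text \<open>The current \<open>\<lbrakk>\<theta>\<rbrakk>(f, \<pi>) = \<integral> \<theta> f det(\<nabla>\<pi>)\<close> on \<open>\<real>\<^sup>k\<close>.\<close>

definition euclid_current :: "nat \<Rightarrow> ((nat \<Rightarrow> real) \<Rightarrow> real) \<Rightarrow> (nat \<Rightarrow> real) functional" where
  "euclid_current k \<theta> = (\<lambda>f \<pi>. \<integral>x. \<theta> x * f x * jacobian k \<pi> x \<partial>lebesgue_euclid k)"

definition integer_rectifiable :: "nat \<Rightarrow> 'a metric \<Rightarrow> 'a functional \<Rightarrow> bool" where
  "integer_rectifiable k E T \<longleftrightarrow> metric_current k E T \<and>
     (if k = 0 then
        (\<exists>S (\<theta> :: 'a \<Rightarrow> int). countable S \<and> S \<subseteq> mspace E \<and>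
           (\<lambda>x. real_of_int (\<theta> x)) summable_on S \<and>
           (\<forall>f\<in>lip_b E. T f [] = (\<Sum>\<^sub>\<infinity>x\<in>S. real_of_int (\<theta> x) * f x)))
      else
        (\<exists>S. countably_rectifiable k E S \<and>
           (\<exists>N\<in>null_sets (mass_measure k E T). mspace E - S \<subseteq> N)) \<and>
        (\<forall>B\<in>sets (metric_borel E). hausdorff_measure k E B = 0 \<longrightarrow>
           emeasure (mass_measure k E T) B = 0) \<and>
        (\<forall>\<phi> A. Lipschitz_continuous_map E (euclid k) \<phi> \<and> openin (mtopology_of E) A \<longrightarrow>
           (\<exists>\<theta> :: (nat \<Rightarrow> real) \<Rightarrow> int.
              integrable (lebesgue_euclid k) (\<lambda>x. real_of_int (\<theta> x)) \<and>
              current_eq k (euclid k) (pushforward \<phi> (restrict_current k E T A))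
                (euclid_current k (\<lambda>x. real_of_int (\<theta> x))))))"

definition normal_current :: "nat \<Rightarrow> 'a metric \<Rightarrow> 'a functional \<Rightarrow> bool" where
  "normal_current k E T \<longleftrightarrow>
     metric_current k E T \<and> (k > 0 \<longrightarrow> metric_current (k - 1) E (boundary T))"

definition integral_current :: "nat \<Rightarrow> 'a metric \<Rightarrow> 'a functional \<Rightarrow> bool" where
  "integral_current k E T \<longleftrightarrow> integer_rectifiable k E T \<and> normal_current k E T"

definition flat_dist :: "nat \<Rightarrow> 'a metric \<Rightarrow> 'a functional \<Rightarrow> 'a functional \<Rightarrow> ennreal" where
  "flat_dist n Z S\<^sub>1 S\<^sub>2 =
     Inf {mass n Z U + mass (n + 1) Z V | U V.
            integral_current n Z U \<and> integral_current (n + 1) Z V \<and>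
            current_eq n Z (\<lambda>f \<pi>. S\<^sub>1 f \<pi> - S\<^sub>2 f \<pi>) (\<lambda>f \<pi>. U f \<pi> + boundary V f \<pi>)}"


section \<open>Integral current spaces (Sormani--Wenger)\<close>

text \<open>The set \<open>{p. liminf\<^sub>r\<^sub>\<rightarrow>\<^sub>0 \<parallel>T\<parallel>(B(p,r)) / r\<^sup>n > 0}\<close>.\<close>

definition current_set :: "nat \<Rightarrow> 'a metric \<Rightarrow> 'a functional \<Rightarrow> 'a set" where
  "current_set n E T =
     {p \<in> mspace E.
        0 < Liminf (at_right 0) (\<lambda>r. emeasure (mass_measure n E T) (mcball_of E p r) / ennreal (r ^ n))}"

text \<open>A space \<open>(X, d, T)\<close> is given by the set \<open>X\<close>, the completion of \<open>(X, d)\<close> (a complete metric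
  space containing \<open>X\<close> as a dense subset, from which \<open>d\<close> is the restriction), and the current
  \<open>T\<close> on the completion. The zero space is the case of the empty set.\<close>

record 'a current_space =
  cs_set :: "'a set"
  cs_completion :: "'a metric"
  cs_current :: "'a functional"

definition integral_current_space :: "nat \<Rightarrow> 'a current_space \<Rightarrow> bool" where
  "integral_current_space n M \<longleftrightarrow>
     mcomplete_of (cs_completion M) \<and>
     cs_set M \<subseteq> mspace (cs_completion M) \<and>
     mtopology_of (cs_completion M) closure_of cs_set M = mspace (cs_completion M) \<and>
     integral_current n (cs_completion M) (cs_current M) \<and>
     current_set n (cs_completion M) (cs_current M) = cs_set M"

text \<open>\<open>is_restriction_space n M V R\<close> says that \<open>R\<close> is \<open>M \<llcorner> V = (set(T \<llcorner> V), d, T \<llcorner> V)\<close>. The completion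
  of \<open>set(T \<llcorner> V)\<close> is its closure in the completion of \<open>M\<close>, and viewing \<open>T \<llcorner> V\<close> as a current on
  this closure means giving the current there whose pushforward under the inclusion is
  \<open>T \<llcorner> V\<close>; it is unique, because Lipschitz functions extend from the closure.
  The set \<open>V\<close> has to be Borel for \<open>T \<llcorner> V\<close> to be defined.\<close>

definition is_restriction_space ::
  "nat \<Rightarrow> 'a current_space \<Rightarrow> 'a set \<Rightarrow> 'a current_space \<Rightarrow> bool" where
  "is_restriction_space n M V R \<longleftrightarrow>
     (let E = cs_completion M; TV = restrict_current n E (cs_current M) V in
      V \<in> sets (metric_borel E) \<and>
      cs_set R = current_set n E TV \<and>
      cs_completion R = submetric E (mtopology_of E closure_of cs_set R) \<and>
      current_eq n E (pushforward (\<lambda>x. x) (cs_current R)) TV)"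

definition metric_isometric_embedding ::
  "'a current_space \<Rightarrow> 'z metric \<Rightarrow> ('a \<Rightarrow> 'z) \<Rightarrow> bool" where
  "metric_isometric_embedding M Z \<phi> \<longleftrightarrow>
     \<phi> \<in> cs_set M \<rightarrow> mspace Z \<and>
     (\<forall>x\<in>cs_set M. \<forall>y\<in>cs_set M. mdist Z (\<phi> x) (\<phi> y) = mdist (cs_completion M) x y)"

text \<open>The extension of an embedding of \<open>X\<close> into a complete space to the completion of \<open>X\<close>.\<close>

definition completion_extension ::
  "'a current_space \<Rightarrow> 'z metric \<Rightarrow> ('a \<Rightarrow> 'z) \<Rightarrow> 'a \<Rightarrow> 'z" where
  "completion_extension M Z \<phi> p =
     (THE z. \<forall>\<sigma>. range \<sigma> \<subseteq> cs_set M \<and>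
               limitin (mtopology_of (cs_completion M)) \<sigma> p sequentially
           \<longrightarrow> limitin (mtopology_of Z) (\<lambda>i. \<phi> (\<sigma> i)) z sequentially)"

definition embedded_current ::
  "'a current_space \<Rightarrow> 'z metric \<Rightarrow> ('a \<Rightarrow> 'z) \<Rightarrow> 'z functional" where
  "embedded_current M Z \<phi> = pushforward (completion_extension M Z \<phi>) (cs_current M)"

definition flat_converges ::
  "nat \<Rightarrow> 'z metric \<Rightarrow> (nat \<Rightarrow> 'a current_space) \<Rightarrow> (nat \<Rightarrow> 'a \<Rightarrow> 'z) \<Rightarrow>
    'b current_space \<Rightarrow> ('b \<Rightarrow> 'z) \<Rightarrow> bool" where
  "flat_converges n Z M \<phi> M_inf \<phi>_inf \<longleftrightarrow>
     (\<forall>j. metric_isometric_embedding (M j) Z (\<phi> j)) \<and>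
     metric_isometric_embedding M_inf Z \<phi>_inf \<and>
     (\<lambda>j. flat_dist n Z (embedded_current (M j) Z (\<phi> j)) (embedded_current M_inf Z \<phi>_inf)) \<longlonglongrightarrow> 0"

definition pointed_flat_converges ::
  "nat \<Rightarrow> 'z metric \<Rightarrow> (nat \<Rightarrow> 'a current_space) \<Rightarrow> (nat \<Rightarrow> 'a \<Rightarrow> 'z) \<Rightarrow> (nat \<Rightarrow> 'a) \<Rightarrow>
    'b current_space \<Rightarrow> ('b \<Rightarrow> 'z) \<Rightarrow> 'b \<Rightarrow> bool" where
  "pointed_flat_converges n Z M \<phi> x M_inf \<phi>_inf x_inf \<longleftrightarrow>
     flat_converges n Z M \<phi> M_inf \<phi>_inf \<and>
     (\<forall>j. x j \<in> cs_set (M j)) \<and> x_inf \<in> mspace (cs_completion M_inf) \<and>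
     limitin (mtopology_of Z) (\<lambda>j. \<phi> j (x j)) (completion_extension M_inf Z \<phi>_inf x_inf) sequentially"

definition separable_complete :: "'z metric \<Rightarrow> bool" where
  "separable_complete Z \<longleftrightarrow> separable_space (mtopology_of Z) \<and> mcomplete_of Z"

end

theory Submission
  imports Defs
begin

text \<open>
  The theorem is true because the mass of the limit current cannot avoid the points
  \<open>\<phi> j (x j)\<close>: for every \<open>\<epsilon> > 0\<close> there is a \<open>c > 0\<close> such that, for all large \<open>j\<close>, the embedded
  \<open>M_inf\<close> carries mass at least \<open>c\<close> in the \<open>\<epsilon>\<close>-ball around \<open>\<phi> j (x j)\<close> in \<open>Z\<close>
  (\<open>limit_mass_near_points\<close>). Its total mass is finite, so only boundedly many of these balls
  are pairwise disjoint, and the points \<open>\<phi> j (x j)\<close> form a totally bounded set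
  (\<open>definite_mass_imp_finite_net\<close>). Some subsequence converges in the complete space \<open>Z\<close>. The
  balls contain points of the image of the completion of \<open>M_inf\<close>, which is closed as an isometric
  image of a complete space; hence the limit is the image of a point \<open>x'\<close>.

  The lower bound compares two ambient spaces \<open>W\<close> and \<open>Z\<close> that share only the intrinsic geometry of
  \<open>M j\<close>. The comparison goes through test functions. If two currents are close in the flat
  distance, then their values are close, uniformly over all tuples \<open>(f, \<pi>)\<close> with given bounds on
  \<open>f\<close> and on all Lipschitz constants (\<open>flat_dist_bound\<close>). By McShane's theorem such tuples extend along
  isometric embeddings with the same kind of bounds, and with supports that grow only a little
  (\<open>transplant_test\<close>). Since \<open>x_inf\<close> lies in the closure of the set of \<open>N_inf\<close>, there is a test
  supported near \<open>x_inf\<close> on which the current of \<open>N_inf\<close> does not vanish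
  (\<open>exists_localized_test\<close>). It is extended to \<open>W\<close>, where the restricted currents have almost the same
  value, pulled back to \<open>R j\<close>, and extended to \<open>Z\<close> with support near \<open>\<phi> j (x j)\<close>. Because \<open>V j\<close>
  contains a ball of fixed radius around \<open>x j\<close>, this support does not notice the difference
  between \<open>M j\<close> and its restriction, so the current of \<open>M j\<close> has the same value there, bounded away
  from zero. Flat convergence in \<open>Z\<close> passes the bound on to \<open>M_inf\<close>, where it bounds the mass near
  \<open>\<phi> j (x j)\<close> from below.

  Two facts from the theory of currents support this. First, the mass measure exists: among the measures
  bounding a current there is a least one (\<open>least_mass_bound_exists\<close>). Second, an integral
  current is concentrated on its set (\<open>integral_current_concentrated\<close>); this is used because
  \<open>V j\<close> contains only those points of the ball that belong to the set of \<open>M j\<close>, not all points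
  of the ball in the completion. Its proof covers the points of lower density zero on a
  rectifiable set by images of dyadic cubes.
\<close>

section \<open>Lipschitz functions on metric spaces\<close>

lemma mdist_refl: "x \<in> mspace E \<Longrightarrow> mdist E x x = 0"
  by simp


text \<open>Explicit upper bounds are easier to propagate through extensions than the optimal constant
  \<open>lip_const\<close>, and uniformity in \<open>j\<close> is a statement about such bounds.\<close>

definition lipschitz_le :: "'a metric \<Rightarrow> real \<Rightarrow> ('a \<Rightarrow> real) \<Rightarrow> bool" where
  "lipschitz_le E K f \<longleftrightarrow>
     0 \<le> K \<and> (\<forall>x\<in>mspace E. \<forall>y\<in>mspace E. \<bar>f x - f y\<bar> \<le> K * mdist E x y)"

lemma lipschitz_leD:
  "lipschitz_le E K f \<Longrightarrow> x \<in> mspace E \<Longrightarrow> y \<in> mspace E \<Longrightarrow> \<bar>f x - f y\<bar> \<le> K * mdist E x y"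
  by (simp add: lipschitz_le_def)

lemma lipschitz_le_nonneg: "lipschitz_le E K f \<Longrightarrow> 0 \<le> K"
  by (simp add: lipschitz_le_def)

lemma lipschitz_le_mono: "lipschitz_le E K f \<Longrightarrow> K \<le> L \<Longrightarrow> lipschitz_le E L f"
  unfolding lipschitz_le_def by (meson mdist_nonneg mult_right_mono order_trans)

lemma lipschitz_le_imp_lip: "lipschitz_le E K f \<Longrightarrow> f \<in> lip E"
  unfolding lipschitz_le_def lip_def Lipschitz_continuous_map_def by (auto simp: dist_real_def)

lemma lip_const_le:
  assumes "lipschitz_le E K f"
  shows "lip_const E f \<le> K"
  using assms unfolding lip_const_def lipschitz_le_def
  by (intro cInf_lower bdd_belowI[of _ 0]) auto

lemma lip_imp_lipschitz_le:
  assumes "f \<in> lip E"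
  obtains K where "lipschitz_le E K f"
proof -
  obtain K where "K > 0" "\<forall>x\<in>mspace E. \<forall>y\<in>mspace E. dist (f x) (f y) \<le> K * mdist E x y"
    using assms unfolding lip_def Lipschitz_continuous_map_pos by auto
  then have "lipschitz_le E K f"
    by (simp add: lipschitz_le_def dist_real_def)
  then show thesis by (rule that)
qed

lemma lipschitz_le_lip_const:
  assumes "f \<in> lip E"
  shows "lipschitz_le E (lip_const E f) f"
proof -
  let ?S = "{L. 0 \<le> L \<and> (\<forall>x\<in>mspace E. \<forall>y\<in>mspace E. \<bar>f x - f y\<bar> \<le> L * mdist E x y)}"
  obtain K where "lipschitz_le E K f"
    using assms by (rule lip_imp_lipschitz_le)
  then have K: "K \<in> ?S"
    by (simp add: lipschitz_le_def)
  have pos: "0 \<le> Inf ?S"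
    using K by (intro cInf_greatest) auto
  have "\<bar>f x - f y\<bar> \<le> Inf ?S * mdist E x y" if xy: "x \<in> mspace E" "y \<in> mspace E" for x y
  proof (cases "mdist E x y = 0")
    case True
    then have "f x = f y" using K xy by auto
    then show ?thesis using True by simp
  next
    case False
    then have d: "mdist E x y > 0"
      by (simp add: order_less_le)
    have "\<bar>f x - f y\<bar> / mdist E x y \<le> Inf ?S"
      using K d xy by (intro cInf_greatest) (auto simp: divide_le_eq)
    then show ?thesis
      using d by (simp add: divide_le_eq)
  qed
  then show ?thesis
    using pos unfolding lipschitz_le_def lip_const_def by blast
qed

lemma lip_const_nonneg: "f \<in> lip E \<Longrightarrow> 0 \<le> lip_const E f"
  using lipschitz_le_lip_const lipschitz_le_nonneg by blast

lemma lipschitz_le_const: "0 \<le> K \<Longrightarrow> lipschitz_le E K (\<lambda>x. c)"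
  by (simp add: lipschitz_le_def)

lemma lipschitz_le_dist: "p \<in> mspace E \<Longrightarrow> lipschitz_le E 1 (\<lambda>x. mdist E p x)"
  unfolding lipschitz_le_def by (smt (verit) mdist_commute mdist_triangle)

lemma lipschitz_le_lincomb:
  assumes f: "lipschitz_le E K f" and g: "lipschitz_le E L g"
  shows "lipschitz_le E (\<bar>a\<bar> * K + \<bar>b\<bar> * L) (\<lambda>x. a * f x + b * g x)"
  unfolding lipschitz_le_def
proof (intro conjI ballI)
  show "0 \<le> \<bar>a\<bar> * K + \<bar>b\<bar> * L"
    using f g by (simp add: lipschitz_le_def)
  fix x y assume xy: "x \<in> mspace E" "y \<in> mspace E"
  have "\<bar>(a * f x + b * g x) - (a * f y + b * g y)\<bar> = \<bar>a * (f x - f y) + b * (g x - g y)\<bar>"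
    by (simp add: algebra_simps)
  also have "\<dots> \<le> \<bar>a\<bar> * \<bar>f x - f y\<bar> + \<bar>b\<bar> * \<bar>g x - g y\<bar>"
    by (metis abs_mult abs_triangle_ineq)
  also have "\<dots> \<le> \<bar>a\<bar> * (K * mdist E x y) + \<bar>b\<bar> * (L * mdist E x y)"
    using lipschitz_leD[OF f xy] lipschitz_leD[OF g xy] by (intro add_mono mult_left_mono) auto
  finally show "\<bar>(a * f x + b * g x) - (a * f y + b * g y)\<bar> \<le> (\<bar>a\<bar> * K + \<bar>b\<bar> * L) * mdist E x y"
    by (simp add: algebra_simps)
qed

lemma lipschitz_le_max:
  assumes f: "lipschitz_le E K f" and g: "lipschitz_le E K g"
  shows "lipschitz_le E K (\<lambda>x. max (f x) (g x))"
  unfolding lipschitz_le_def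
proof (intro conjI ballI)
  show "0 \<le> K" using f by (rule lipschitz_le_nonneg)
  fix x y assume xy: "x \<in> mspace E" "y \<in> mspace E"
  show "\<bar>max (f x) (g x) - max (f y) (g y)\<bar> \<le> K * mdist E x y"
    using lipschitz_leD[OF f xy] lipschitz_leD[OF g xy] by (auto simp: max_def abs_if split: if_splits)
qed

lemma lipschitz_le_uminus: "lipschitz_le E K f \<Longrightarrow> lipschitz_le E K (\<lambda>x. - f x)"
  unfolding lipschitz_le_def by (simp add: abs_minus_commute)

lemma lipschitz_le_min:
  assumes f: "lipschitz_le E K f" and g: "lipschitz_le E K g"
  shows "lipschitz_le E K (\<lambda>x. min (f x) (g x))"
  unfolding lipschitz_le_def
proof (intro conjI ballI)
  show "0 \<le> K" using f by (rule lipschitz_le_nonneg)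
  fix x y assume xy: "x \<in> mspace E" "y \<in> mspace E"
  show "\<bar>min (f x) (g x) - min (f y) (g y)\<bar> \<le> K * mdist E x y"
    using lipschitz_leD[OF f xy] lipschitz_leD[OF g xy] by (auto simp: min_def abs_if split: if_splits)
qed

lemma lipschitz_le_scale: "lipschitz_le E K f \<Longrightarrow> lipschitz_le E (\<bar>a\<bar> * K) (\<lambda>x. a * f x)"
  using lipschitz_le_lincomb[OF _ lipschitz_le_const[of 0 E 0], of K f a 0] by simp

lemma lip_b_iff: "f \<in> lip_b E \<longleftrightarrow> f \<in> lip E \<and> (\<exists>B. \<forall>x\<in>mspace E. \<bar>f x\<bar> \<le> B)"
  unfolding lip_b_def bounded_iff by auto

lemma lip_bI: "lipschitz_le E K f \<Longrightarrow> (\<And>x. x \<in> mspace E \<Longrightarrow> \<bar>f x\<bar> \<le> B) \<Longrightarrow> f \<in> lip_b E"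
  using lipschitz_le_imp_lip by (auto simp: lip_b_iff)

lemma lip_bE:
  assumes "f \<in> lip_b E"
  obtains K B where "lipschitz_le E K f" "\<And>x. x \<in> mspace E \<Longrightarrow> \<bar>f x\<bar> \<le> B" "0 \<le> B"
proof -
  obtain B where "\<forall>x\<in>mspace E. \<bar>f x\<bar> \<le> B" and l: "f \<in> lip E"
    using assms unfolding lip_b_iff by blast
  then have "\<And>x. x \<in> mspace E \<Longrightarrow> \<bar>f x\<bar> \<le> max B 0"
    by (meson max.coboundedI1)
  with lip_imp_lipschitz_le[OF l] that show thesis
    by (metis max.cobounded2)
qed

lemma lip_b_lincomb:
  assumes "f \<in> lip_b E" "g \<in> lip_b E"
  shows "(\<lambda>x. a * f x + b * g x) \<in> lip_b E"
proof -
  obtain K B where f: "lipschitz_le E K f" "\<And>x. x \<in> mspace E \<Longrightarrow> \<bar>f x\<bar> \<le> B"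
    using assms(1) by (rule lip_bE) blast
  obtain L C where g: "lipschitz_le E L g" "\<And>x. x \<in> mspace E \<Longrightarrow> \<bar>g x\<bar> \<le> C"
    using assms(2) by (rule lip_bE) blast
  have "\<bar>a * f x + b * g x\<bar> \<le> \<bar>a\<bar> * B + \<bar>b\<bar> * C" if "x \<in> mspace E" for x
  proof -
    have "\<bar>a * f x + b * g x\<bar> \<le> \<bar>a\<bar> * \<bar>f x\<bar> + \<bar>b\<bar> * \<bar>g x\<bar>"
      by (metis abs_mult abs_triangle_ineq)
    also have "\<dots> \<le> \<bar>a\<bar> * B + \<bar>b\<bar> * C"
      using f(2)[OF that] g(2)[OF that] by (intro add_mono mult_left_mono) auto
    finally show ?thesis .
  qed
  with lipschitz_le_lincomb[OF f(1) g(1)] show ?thesis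
    by (rule lip_bI)
qed

lemma lip_b_mult:
  assumes "f \<in> lip_b E" "g \<in> lip_b E"
  shows "(\<lambda>x. f x * g x) \<in> lip_b E"
proof -
  obtain K B where f: "lipschitz_le E K f" "\<And>x. x \<in> mspace E \<Longrightarrow> \<bar>f x\<bar> \<le> B" "0 \<le> B"
    using assms(1) by (rule lip_bE) blast
  obtain L C where g: "lipschitz_le E L g" "\<And>x. x \<in> mspace E \<Longrightarrow> \<bar>g x\<bar> \<le> C" "0 \<le> C"
    using assms(2) by (rule lip_bE) blast
  have "lipschitz_le E (B * L + C * K) (\<lambda>x. f x * g x)"
    unfolding lipschitz_le_def
  proof (intro conjI ballI)
    show "0 \<le> B * L + C * K"
      using f g by (auto simp: lipschitz_le_def)
    fix x y assume xy: "x \<in> mspace E" "y \<in> mspace E"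
    have "\<bar>f x * g x - f y * g y\<bar> = \<bar>f x * (g x - g y) + g y * (f x - f y)\<bar>"
      by (simp add: algebra_simps)
    also have "\<dots> \<le> \<bar>f x\<bar> * \<bar>g x - g y\<bar> + \<bar>g y\<bar> * \<bar>f x - f y\<bar>"
      by (metis abs_mult abs_triangle_ineq)
    also have "\<dots> \<le> B * (L * mdist E x y) + C * (K * mdist E x y)"
      using lipschitz_leD[OF f(1) xy] lipschitz_leD[OF g(1) xy] f g xy
      by (intro add_mono mult_mono) auto
    finally show "\<bar>f x * g x - f y * g y\<bar> \<le> (B * L + C * K) * mdist E x y"
      by (simp add: algebra_simps)
  qed
  moreover have "\<bar>f x * g x\<bar> \<le> B * C" if "x \<in> mspace E" for x
    using f g that by (simp add: abs_mult mult_mono)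
  ultimately show ?thesis
    by (rule lip_bI)
qed

lemma lip_b_const: "(\<lambda>x. c) \<in> lip_b E"
  using lip_bI[OF lipschitz_le_const[of 0], of E c "\<bar>c\<bar>"] by simp

lemma lip_b_sum: "finite I \<Longrightarrow> (\<And>i. i \<in> I \<Longrightarrow> f i \<in> lip_b E) \<Longrightarrow> (\<lambda>x. \<Sum>i\<in>I. f i x) \<in> lip_b E"
proof (induction I rule: finite_induct)
  case empty
  then show ?case by (simp add: lip_b_const)
next
  case (insert i I)
  then show ?case
    using lip_b_lincomb[of "f i" E "\<lambda>x. \<Sum>i\<in>I. f i x" 1 1] by simp
qed

lemma lip_tuples_conv:
  "\<pi> \<in> lip_tuples k E \<longleftrightarrow> length \<pi> = k \<and> (\<forall>i<k. \<pi> ! i \<in> lip E)"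
  unfolding lip_tuples_def by (auto simp: set_conv_nth)

lemma prod_lip_const_nonneg: "\<pi> \<in> lip_tuples k E \<Longrightarrow> 0 \<le> prod_list (map (lip_const E) \<pi>)"
  unfolding lip_tuples_def by (auto intro!: prod_list_nonneg lip_const_nonneg)

lemma prod_lip_const_le:
  assumes "length \<pi> = k" "\<And>i. i < k \<Longrightarrow> lipschitz_le E K (\<pi> ! i)"
  shows "prod_list (map (lip_const E) \<pi>) \<le> K ^ k"
  using assms
proof (induction \<pi> arbitrary: k)
  case Nil
  then show ?case by simp
next
  case (Cons p \<pi>)
  from Cons.prems obtain m where k: "k = Suc m" "length \<pi> = m" by auto
  have p: "lipschitz_le E K p"
    using Cons.prems(2)[of 0] k by simp
  have rest: "lipschitz_le E K (\<pi> ! i)" if "i < m" for i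
    using Cons.prems(2)[of "Suc i"] k that by simp
  have "\<pi> \<in> lip_tuples m E"
    using rest k lipschitz_le_imp_lip by (auto simp: lip_tuples_conv)
  then have "0 \<le> prod_list (map (lip_const E) \<pi>)"
    by (rule prod_lip_const_nonneg)
  then show ?case
    using Cons.IH[OF k(2) rest] lip_const_le[OF p] lipschitz_le_nonneg[OF p] k
    by (auto intro!: mult_mono)
qed

text \<open>McShane's construction: the infimum of the upward cones with slope \<open>K\<close> over the given values.
  The values are prescribed along a map \<open>h\<close> instead of on a subset, so that a function on one space
  can be extended to another one in which it is embedded.\<close>

lemma lipschitz_extension:
  assumes iso: "\<And>a. a \<in> A \<Longrightarrow> h a \<in> mspace E"
    and f: "\<And>a b. a \<in> A \<Longrightarrow> b \<in> A \<Longrightarrow> \<bar>f a - f b\<bar> \<le> K * mdist E (h a) (h b)"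
    and K: "0 \<le> K"
  obtains F where "lipschitz_le E K F" "\<And>a. a \<in> A \<Longrightarrow> F (h a) = f a"
proof (cases "A = {}")
  case True
  then show thesis
    using that[of "\<lambda>x. 0"] lipschitz_le_const[OF K, of E 0] by blast
next
  case False
  then obtain a0 where a0: "a0 \<in> A" by blast
  define F where "F x = (INF a\<in>A. f a + K * mdist E x (h a))" for x
  have bdd: "bdd_below ((\<lambda>a. f a + K * mdist E x (h a)) ` A)" if "x \<in> mspace E" for x
  proof (rule bdd_belowI2)
    fix a assume a: "a \<in> A"
    have "f a0 - f a \<le> K * mdist E (h a0) (h a)"
      using f[OF a0 a] by linarith
    also have "\<dots> \<le> K * (mdist E x (h a0) + mdist E x (h a))"
      using K iso[OF a] iso[OF a0] that mdist_triangle[of "h a0" E x "h a"]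
      by (intro mult_left_mono) (auto simp: mdist_commute)
    finally show "f a0 - K * mdist E x (h a0) \<le> f a + K * mdist E x (h a)"
      by (simp add: algebra_simps)
  qed
  have le: "F x \<le> F y + K * mdist E x y" if xy: "x \<in> mspace E" "y \<in> mspace E" for x y
  proof -
    have "F x - K * mdist E x y \<le> F y"
      unfolding F_def[of y]
    proof (rule cINF_greatest)
      fix a assume a: "a \<in> A"
      have "F x \<le> f a + K * mdist E x (h a)"
        unfolding F_def using bdd[OF xy(1)] a by (rule cINF_lower)
      also have "\<dots> \<le> f a + K * (mdist E x y + mdist E y (h a))"
        using K iso[OF a] xy mdist_triangle by (intro add_left_mono mult_left_mono) auto
      finally show "F x - K * mdist E x y \<le> f a + K * mdist E y (h a)"
        by (simp add: algebra_simps)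
    qed (use False in auto)
    then show ?thesis by simp
  qed
  have "lipschitz_le E K F"
    unfolding lipschitz_le_def
  proof (intro conjI ballI K)
    fix x y assume xy: "x \<in> mspace E" "y \<in> mspace E"
    show "\<bar>F x - F y\<bar> \<le> K * mdist E x y"
      using le[OF xy] le[OF xy(2,1)] by (simp add: mdist_commute abs_le_iff)
  qed
  moreover have "F (h a) = f a" if a: "a \<in> A" for a
  proof (rule antisym)
    have "F (h a) \<le> f a + K * mdist E (h a) (h a)"
      unfolding F_def using bdd[OF iso[OF a]] a by (rule cINF_lower)
    then show "F (h a) \<le> f a"
      using iso[OF a] by (simp add: mdist_refl)
    show "f a \<le> F (h a)"
      unfolding F_def
    proof (rule cINF_greatest)
      fix b assume "b \<in> A"
      then show "f a \<le> f b + K * mdist E (h a) (h b)"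
        using f[OF a] by (simp add: abs_le_iff) (smt (verit))
    qed (use False in auto)
  qed
  ultimately show thesis by (rule that)
qed

text \<open>Cutting the McShane extension off between \<open>\<plusminus>\<close> a bump function around \<open>q\<close> keeps its support
  in a ball that is only slightly larger than the given one, at the cost of a factor
  \<open>1 / \<rho>\<close> in the Lipschitz constant.\<close>

lemma localized_extension:
  assumes iso: "\<And>a. a \<in> A \<Longrightarrow> h a \<in> mspace E"
    and f: "\<And>a b. a \<in> A \<Longrightarrow> b \<in> A \<Longrightarrow> \<bar>f a - f b\<bar> \<le> K * mdist E (h a) (h b)"
    and K: "0 \<le> K" and q: "q \<in> mspace E" and \<rho>: "0 < \<rho>" "\<rho> \<le> 1"
    and bound: "\<And>a. a \<in> A \<Longrightarrow> \<bar>f a\<bar> \<le> K"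
    and supp: "\<And>a. a \<in> A \<Longrightarrow> r < mdist E q (h a) \<Longrightarrow> f a = 0"
  obtains F where "lipschitz_le E (K / \<rho>) F" "\<And>a. a \<in> A \<Longrightarrow> F (h a) = f a"
    "\<And>x. x \<in> mspace E \<Longrightarrow> \<bar>F x\<bar> \<le> K" "\<And>x. x \<in> mspace E \<Longrightarrow> r + \<rho> \<le> mdist E q x \<Longrightarrow> F x = 0"
proof -
  obtain F0 where F0: "lipschitz_le E K F0" "\<And>a. a \<in> A \<Longrightarrow> F0 (h a) = f a"
    using lipschitz_extension[where A = A and h = h and E = E and f = f and K = K, OF iso f K] by metis
  \<comment> \<open>The bump equals \<open>K\<close> up to distance \<open>r\<close> from \<open>q\<close> and decreases with slope \<open>K / \<rho>\<close> to zero at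
    distance \<open>r + \<rho>\<close>.\<close>
  define b where "b x = min K (max 0 (K / \<rho> * (r + \<rho>) + (- (K / \<rho>)) * mdist E q x))" for x
  have K': "K \<le> K / \<rho>"
    using K \<rho> by (simp add: le_divide_eq mult_left_le)
  have "lipschitz_le E (K / \<rho>) (\<lambda>x. (K / \<rho> * (r + \<rho>)) * 1 + (- (K / \<rho>)) * mdist E q x)"
    using lipschitz_le_lincomb[OF lipschitz_le_const[of 0 E 1] lipschitz_le_dist[OF q],
        of "K / \<rho> * (r + \<rho>)" "- (K / \<rho>)"] K \<rho> by simp
  then have b: "lipschitz_le E (K / \<rho>) b"
    unfolding b_def using K \<rho>
    by (intro lipschitz_le_min lipschitz_le_max lipschitz_le_const) auto
  define F where "F x = max (- b x) (min (F0 x) (b x))" for x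
  have b_nonneg: "0 \<le> b x" "b x \<le> K" for x
    using K by (auto simp: b_def)
  show thesis
  proof (rule that)
    show "lipschitz_le E (K / \<rho>) F"
      unfolding F_def using b lipschitz_le_mono[OF F0(1) K']
      by (intro lipschitz_le_max lipschitz_le_min lipschitz_le_uminus)
    show "F (h a) = f a" if a: "a \<in> A" for a
    proof (cases "r < mdist E q (h a)")
      case True
      then show ?thesis using supp[OF a] F0(2)[OF a] b_nonneg[of "h a"] by (simp add: F_def)
    next
      case False
      then have "K / \<rho> * \<rho> \<le> K / \<rho> * (r + \<rho> - mdist E q (h a))"
        using K \<rho> by (intro mult_left_mono) auto
      then have "b (h a) = K"
        using \<rho> K by (auto simp: b_def algebra_simps)
      then show ?thesis
        using bound[OF a] F0(2)[OF a] by (simp add: F_def abs_le_iff)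
    qed
    show "\<bar>F x\<bar> \<le> K" if "x \<in> mspace E" for x
      using b_nonneg[of x] by (auto simp: F_def)
    show "F x = 0" if "x \<in> mspace E" "r + \<rho> \<le> mdist E q x" for x
    proof -
      have "K / \<rho> * (r + \<rho>) \<le> K / \<rho> * mdist E q x"
        using that K \<rho> by (intro mult_left_mono) auto
      then have "b x = 0" using K by (simp add: b_def)
      then show ?thesis by (simp add: F_def)
    qed
  qed
qed

section \<open>Borel measures on metric spaces\<close>

lemma space_metric_borel [simp]: "space (metric_borel E) = mspace E"
  unfolding metric_borel_def by (rule space_measure_of) (use openin_subset in fastforce)

lemma sets_metric_borel:
  "sets (metric_borel E) = sigma_sets (mspace E) {U. openin (mtopology_of E) U}"
  unfolding metric_borel_def by (rule sets_measure_of) (use openin_subset in fastforce)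

lemma openin_in_metric_borel: "openin (mtopology_of E) U \<Longrightarrow> U \<in> sets (metric_borel E)"
  by (simp add: sets_metric_borel)

lemma closedin_in_metric_borel: "closedin (mtopology_of E) C \<Longrightarrow> C \<in> sets (metric_borel E)"
proof -
  assume C: "closedin (mtopology_of E) C"
  then have "mspace E - C \<in> sets (metric_borel E)"
    by (intro openin_in_metric_borel) (simp add: closedin_def)
  then have "mspace E - (mspace E - C) \<in> sets (metric_borel E)"
    by (metis sets.compl_sets space_metric_borel)
  moreover have "mspace E - (mspace E - C) = C"
    using closedin_subset[OF C] by auto
  ultimately show ?thesis by simp
qed

lemma mcball_in_metric_borel [simp]: "mcball_of E p r \<in> sets (metric_borel E)"
proof -
  interpret Metric_space "mspace E" "mdist E" by simp
  have "mcball_of E p r = mcball p r"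
    by (auto simp: mcball_def)
  then show ?thesis
    using closedin_mcball[of p r] by (simp add: closedin_in_metric_borel mtopology_of_def)
qed

lemma singleton_in_metric_borel: "p \<in> mspace E \<Longrightarrow> {p} \<in> sets (metric_borel E)"
proof -
  assume p: "p \<in> mspace E"
  have "mdist E p x \<le> 0 \<longleftrightarrow> x = p" if "x \<in> mspace E" for x
    using mdist_zero[OF p that] mdist_nonneg[of E p x] by (auto simp: order_le_less)
  with p have "mcball_of E p 0 = {p}"
    by (auto simp: mdist_refl)
  then show ?thesis by (metis mcball_in_metric_borel)
qed

lemma lip_imp_measurable:
  assumes "f \<in> lip E"
  shows "f \<in> borel_measurable (metric_borel E)"
proof (rule borel_measurableI)
  fix S :: "real set" assume "open S"
  have "continuous_map (mtopology_of E) euclidean f"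
    using Lipschitz_continuous_imp_continuous_map[of E euclidean_metric f] assms by (simp add: lip_def)
  then have "openin (mtopology_of E) {x \<in> topspace (mtopology_of E). f x \<in> S}"
    using \<open>open S\<close> by (intro openin_continuous_map_preimage) auto
  moreover have "{x \<in> topspace (mtopology_of E). f x \<in> S} = f -` S \<inter> space (metric_borel E)"
    by auto
  ultimately show "f -` S \<inter> space (metric_borel E) \<in> sets (metric_borel E)"
    by (simp add: openin_in_metric_borel)
qed

lemma lip_b_integrable:
  assumes f: "f \<in> lip_b E" and fin: "finite_measure \<mu>" and sets: "sets \<mu> = sets (metric_borel E)"
  shows "integrable \<mu> f"
proof -
  obtain K B where B: "\<And>x. x \<in> mspace E \<Longrightarrow> \<bar>f x\<bar> \<le> B"
    using f by (rule lip_bE) blast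
  have "f \<in> borel_measurable \<mu>"
    using lip_imp_measurable f sets by (auto simp: lip_b_def cong: measurable_cong_sets)
  moreover have "space \<mu> = mspace E"
    using sets by (metis sets_eq_imp_space_eq space_metric_borel)
  ultimately show ?thesis
    using B by (intro finite_measure.integrable_const_bound[OF fin, of _ B]) auto
qed

section \<open>The mass measure\<close>

definition sum_measure :: "'a measure \<Rightarrow> 'a measure \<Rightarrow> 'a measure" where
  "sum_measure \<mu> \<nu> = measure_of (space \<mu>) (sets \<mu>) (\<lambda>A. emeasure \<mu> A + emeasure \<nu> A)"

lemma sets_sum_measure [simp]: "sets (sum_measure \<mu> \<nu>) = sets \<mu>"
  by (simp add: sum_measure_def)

lemma space_sum_measure [simp]: "space (sum_measure \<mu> \<nu>) = space \<mu>"
  by (simp add: sum_measure_def)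

lemma emeasure_sum_measure:
  assumes "sets \<nu> = sets \<mu>" "A \<in> sets \<mu>"
  shows "emeasure (sum_measure \<mu> \<nu>) A = emeasure \<mu> A + emeasure \<nu> A"
  unfolding sum_measure_def
proof (rule emeasure_measure_of_sigma)
  show "sigma_algebra (space \<mu>) (sets \<mu>)" ..
  show "positive (sets \<mu>) (\<lambda>A. emeasure \<mu> A + emeasure \<nu> A)"
    by (simp add: positive_def)
  show "countably_additive (sets \<mu>) (\<lambda>A. emeasure \<mu> A + emeasure \<nu> A)"
  proof (rule countably_additiveI)
    fix F :: "nat \<Rightarrow> 'a set"
    assume F: "range F \<subseteq> sets \<mu>" "disjoint_family F"
    have "(\<Sum>i. emeasure \<mu> (F i) + emeasure \<nu> (F i)) = (\<Sum>i. emeasure \<mu> (F i)) + (\<Sum>i. emeasure \<nu> (F i))"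
      by (simp add: suminf_add[symmetric])
    then show "(\<Sum>i. emeasure \<mu> (F i) + emeasure \<nu> (F i)) = emeasure \<mu> (\<Union> (range F)) + emeasure \<nu> (\<Union> (range F))"
      using F assms(1) by (simp add: suminf_emeasure)
  qed
qed (fact assms(2))

lemma density_of_smaller_measure:
  assumes "finite_measure \<mu>" "sets \<nu> = sets \<mu>" "\<And>A. A \<in> sets \<mu> \<Longrightarrow> emeasure \<nu> A \<le> emeasure \<mu> A"
  obtains f where "f \<in> borel_measurable \<mu>" "\<nu> = density \<mu> f"
proof -
  interpret finite_measure \<mu> by fact
  have "absolutely_continuous \<mu> \<nu>"
    unfolding absolutely_continuous_def null_sets_def using assms(2,3) by fastforce
  from Radon_Nikodym[OF this assms(2)] that show thesis by metis
qed

text \<open>With the integral in \<open>ennreal\<close> the bound passes to densities and to monotone limits without side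
  conditions on integrability.\<close>

lemma mass_bound_iff_nn:
  "mass_bound k E T \<mu> \<longleftrightarrow>
     sets \<mu> = sets (metric_borel E) \<and> finite_measure \<mu> \<and>
     (\<forall>f\<in>lip_b E. \<forall>\<pi>\<in>lip_tuples k E.
        ennreal \<bar>T f \<pi>\<bar> \<le> ennreal (prod_list (map (lip_const E) \<pi>)) * (\<integral>\<^sup>+x. ennreal \<bar>f x\<bar> \<partial>\<mu>))"
proof -
  have "(\<bar>T f \<pi>\<bar> \<le> prod_list (map (lip_const E) \<pi>) * (\<integral>x. \<bar>f x\<bar> \<partial>\<mu>)) \<longleftrightarrow>
      (ennreal \<bar>T f \<pi>\<bar> \<le> ennreal (prod_list (map (lip_const E) \<pi>)) * (\<integral>\<^sup>+x. ennreal \<bar>f x\<bar> \<partial>\<mu>))"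
    if "sets \<mu> = sets (metric_borel E)" "finite_measure \<mu>" "f \<in> lip_b E" "\<pi> \<in> lip_tuples k E" for f \<pi>
  proof -
    have "(\<integral>\<^sup>+x. ennreal \<bar>f x\<bar> \<partial>\<mu>) = ennreal (\<integral>x. \<bar>f x\<bar> \<partial>\<mu>)"
      using lip_b_integrable[OF that(3,2,1)] by (intro nn_integral_eq_integral) auto
    then show ?thesis
      using prod_lip_const_nonneg[OF that(4)] by (simp add: ennreal_mult[symmetric])
  qed
  then show ?thesis
    unfolding mass_bound_def by blast
qed

text \<open>The sets whose indicators are \<open>L\<^sup>1\<close> limits of bounded Lipschitz functions form a Dynkin
  system, and the open sets belong to it by way of the distance to the complement. Finitely many
  measures are treated at once because mixing two bounds of a current needs one
  approximation that is good for both.\<close>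

lemma indicator_L1_approx_unclamped:
  assumes fin: "finite S" and S: "\<And>\<sigma>. \<sigma> \<in> S \<Longrightarrow> finite_measure \<sigma>"
    "\<And>\<sigma>. \<sigma> \<in> S \<Longrightarrow> sets \<sigma> = sets (metric_borel E)"
    and A: "A \<in> sets (metric_borel E)" and e: "0 < (e::real)"
  shows "\<exists>h\<in>lip_b E. \<forall>\<sigma>\<in>S. (\<integral>x. \<bar>h x - indicator A x\<bar> \<partial>\<sigma>) < e"
proof -
  have space: "space \<sigma> = mspace E" if "\<sigma> \<in> S" for \<sigma>
    using S(2)[OF that] by (metis sets_eq_imp_space_eq space_metric_borel)
  have int_ind: "integrable \<sigma> (indicator B :: 'a \<Rightarrow> real)"
    if "\<sigma> \<in> S" "B \<in> sets (metric_borel E)" for \<sigma> B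
    using S[OF that(1)] that(2) by (simp add: finite_measure.emeasure_finite less_top[symmetric])
  have int_lip: "integrable \<sigma> h" if "\<sigma> \<in> S" "h \<in> lip_b E" for \<sigma> h
    using S[OF that(1)] that(2) by (intro lip_b_integrable)
  have "Int_stable {U. openin (mtopology_of E) U}"
    by (auto simp: Int_stable_def)
  moreover have "{U. openin (mtopology_of E) U} \<subseteq> Pow (mspace E)"
    using openin_subset by fastforce
  moreover have "A \<in> sigma_sets (mspace E) {U. openin (mtopology_of E) U}"
    using A by (simp add: sets_metric_borel)
  ultimately have "\<forall>e>0. \<exists>h\<in>lip_b E. \<forall>\<sigma>\<in>S. (\<integral>x. \<bar>h x - indicator A x\<bar> \<partial>\<sigma>) < e"
  proof (induction A rule: sigma_sets_induct_disjoint)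
    case (basic U)
    then have U: "openin (mtopology_of E) U" by simp
    then have UE: "U \<subseteq> mspace E" using openin_subset by fastforce
    have UB: "U \<in> sets (metric_borel E)" using U by (rule openin_in_metric_borel)
    show ?case
    proof (cases "U = mspace E")
      case True
      have "(\<integral>x. \<bar>1 - indicator U x :: real\<bar> \<partial>\<sigma>) = 0" if "\<sigma> \<in> S" for \<sigma>
        using True space[OF that] by (intro integral_eq_zero_AE AE_I2) auto
      then show ?thesis
        using lip_b_const[of 1 E] by (auto intro!: bexI[of _ "\<lambda>_. 1"])
    next
      case False
      interpret Metric_space "mspace E" "mdist E" by simp
      define C where "C = mspace E - U"
      have C: "C \<noteq> {}" "C \<subseteq> mspace E" using False UE by (auto simp: C_def)
      define \<delta> where "\<delta> x = (INF c\<in>C. mdist E x c)" for x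
      have bdd: "bdd_below (mdist E x ` C)" for x
        by (rule bdd_belowI2[of _ 0]) simp
      have le: "\<delta> x \<le> \<delta> y + mdist E x y" if "x \<in> mspace E" "y \<in> mspace E" for x y
      proof -
        have "\<delta> x - mdist E x y \<le> \<delta> y"
          unfolding \<delta>_def[of y]
        proof (rule cINF_greatest)
          fix c assume c: "c \<in> C"
          have "\<delta> x \<le> mdist E x c" unfolding \<delta>_def using bdd c by (rule cINF_lower)
          also have "\<dots> \<le> mdist E x y + mdist E y c" using that c C by (intro mdist_triangle) auto
          finally show "\<delta> x - mdist E x y \<le> mdist E y c" by simp
        qed (use C in auto)
        then show ?thesis by simp
      qed
      have lipd: "lipschitz_le E 1 \<delta>"
        unfolding lipschitz_le_def
      proof (intro conjI ballI)
        fix x y assume "x \<in> mspace E" "y \<in> mspace E"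
        then show "\<bar>\<delta> x - \<delta> y\<bar> \<le> 1 * mdist E x y"
          using le[of x y] le[of y x] by (simp add: mdist_commute abs_le_iff)
      qed simp
      have \<delta>0: "\<delta> x = 0" if "x \<in> C" for x
      proof (rule antisym)
        show "\<delta> x \<le> 0" using cINF_lower[OF bdd[of x] that] that C by (auto simp: \<delta>_def)
        show "0 \<le> \<delta> x" unfolding \<delta>_def using C by (intro cINF_greatest) auto
      qed
      have \<delta>pos: "0 < \<delta> x" if "x \<in> U" for x
      proof -
        have "openin mtopology U" using U by (simp add: mtopology_of_def)
        then obtain r where r: "r > 0" "mball x r \<subseteq> U"
          using \<open>x \<in> U\<close> unfolding openin_mtopology by metis
        have "r \<le> mdist E x c" if "c \<in> C" for c
        proof (rule ccontr)
          assume "\<not> r \<le> mdist E x c"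
          then have "c \<in> mball x r" using that \<open>x \<in> U\<close> UE C by (auto simp: in_mball)
          then show False using r that by (auto simp: C_def)
        qed
        then have "r \<le> \<delta> x" unfolding \<delta>_def using C by (intro cINF_greatest) auto
        then show ?thesis using r by simp
      qed
      have \<delta>nonneg: "0 \<le> \<delta> x" for x
        unfolding \<delta>_def using C by (intro cINF_greatest) auto
      \<comment> \<open>\<open>\<delta>\<close> is the distance to the complement of \<open>U\<close>, hence positive exactly on \<open>U\<close>.\<close>
      define h where "h m x = min 1 (real m * \<delta> x)" for m x
      have hl: "h m \<in> lip_b E" for m
      proof (rule lip_bI)
        show "lipschitz_le E (max 1 (real m)) (h m)"
          unfolding h_def using lipschitz_le_scale[OF lipd, of "real m"]
          by (intro lipschitz_le_min lipschitz_le_const) (auto intro: lipschitz_le_mono)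
        show "\<bar>h m x\<bar> \<le> 1" for x
          using \<delta>nonneg[of x] by (auto simp: h_def)
      qed
      have lim: "(\<lambda>m. h m x) \<longlonglongrightarrow> indicator U x" if "x \<in> mspace E" for x
      proof (cases "x \<in> U")
        case True
        have "\<forall>\<^sub>F m in sequentially. 1 / \<delta> x \<le> real m"
          using filterlim_real_sequentially by (auto simp: filterlim_at_top)
        then have "\<forall>\<^sub>F m in sequentially. h m x = 1"
          by eventually_elim (use \<delta>pos[OF True] in \<open>simp add: h_def divide_le_eq\<close>)
        then show ?thesis using True by (simp add: tendsto_eventually)
      next
        case False
        then have "h m x = 0" for m using \<delta>0[of x] that by (simp add: h_def C_def)
        then show ?thesis using False by simp
      qed
      have conv: "(\<lambda>m. \<integral>x. \<bar>h m x - indicator U x\<bar> \<partial>\<sigma>) \<longlonglongrightarrow> 0" if s: "\<sigma> \<in> S" for \<sigma>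
      proof -
        interpret \<sigma>: finite_measure \<sigma> using S(1) s .
        have m: "U \<in> sets \<sigma>" "h m \<in> borel_measurable \<sigma>" for m
          using UB S(2)[OF s] int_lip[OF s hl] by auto
        have "(\<lambda>m. \<integral>x. \<bar>h m x - indicator U x\<bar> \<partial>\<sigma>) \<longlonglongrightarrow> (\<integral>x. 0 \<partial>\<sigma>)"
        proof (rule integral_dominated_convergence[where w = "\<lambda>_. 1"])
          show "AE x in \<sigma>. (\<lambda>i. \<bar>h i x - indicator U x\<bar>) \<longlonglongrightarrow> 0"
          proof (rule AE_I2)
            fix x assume "x \<in> space \<sigma>"
            then have "(\<lambda>m. h m x) \<longlonglongrightarrow> indicator U x" using lim space[OF s] by simp
            then have "(\<lambda>m. h m x - indicator U x) \<longlonglongrightarrow> 0" by (rule LIM_zero)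
            then show "(\<lambda>i. \<bar>h i x - indicator U x\<bar>) \<longlonglongrightarrow> 0" by (rule tendsto_rabs_zero)
          qed
          show "AE x in \<sigma>. norm \<bar>h i x - indicator U x\<bar> \<le> 1" for i
            using \<delta>nonneg by (auto simp: h_def indicator_def)
        qed (use m in auto)
        then show ?thesis by simp
      qed
      show ?thesis
      proof (intro allI impI)
        fix e :: real assume "0 < e"
        then have "\<forall>\<sigma>\<in>S. \<forall>\<^sub>F m in sequentially. (\<integral>x. \<bar>h m x - indicator U x\<bar> \<partial>\<sigma>) < e"
          by (intro ballI order_tendstoD(2)[OF conv])
        then have "\<forall>\<^sub>F m in sequentially. \<forall>\<sigma>\<in>S. (\<integral>x. \<bar>h m x - indicator U x\<bar> \<partial>\<sigma>) < e"
          using fin by (simp add: eventually_ball_finite)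
        then obtain m where "\<forall>\<sigma>\<in>S. (\<integral>x. \<bar>h m x - indicator U x\<bar> \<partial>\<sigma>) < e"
          using eventually_happens' sequentially_bot by blast
        then show "\<exists>h\<in>lip_b E. \<forall>\<sigma>\<in>S. (\<integral>x. \<bar>h x - indicator U x\<bar> \<partial>\<sigma>) < e"
          using hl by blast
      qed
    qed
  next
    case empty
    show ?case
      using lip_b_const[of 0 E] by (auto intro!: bexI[of _ "\<lambda>_. 0"])
  next
    case (compl A)
    show ?case
    proof (intro allI impI)
      fix e :: real assume "0 < e"
      with compl.IH obtain h where h: "h \<in> lip_b E" "\<forall>\<sigma>\<in>S. (\<integral>x. \<bar>h x - indicator A x\<bar> \<partial>\<sigma>) < e"
        by blast
      have "(\<lambda>x. 1 - h x) \<in> lip_b E"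
        using lip_b_lincomb[OF lip_b_const[of 1 E] h(1), of 1 "-1"] by simp
      moreover have "(\<integral>x. \<bar>(1 - h x) - indicator (mspace E - A) x\<bar> \<partial>\<sigma>) = (\<integral>x. \<bar>h x - indicator A x\<bar> \<partial>\<sigma>)"
        if "\<sigma> \<in> S" for \<sigma>
        using space[OF that] by (intro Bochner_Integration.integral_cong) (auto simp: indicator_def)
      ultimately show "\<exists>h\<in>lip_b E. \<forall>\<sigma>\<in>S. (\<integral>x. \<bar>h x - indicator (mspace E - A) x\<bar> \<partial>\<sigma>) < e"
        using h(2) by (intro bexI[of _ "\<lambda>x. 1 - h x"]) auto
    qed
  next
    case (union F)
    have FB: "F i \<in> sets (metric_borel E)" for i
      using union.hyps(2) by (auto simp: sets_metric_borel)
    show ?case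
    proof (intro allI impI)
      fix e :: real assume e: "0 < e"
      have "\<forall>\<^sub>F N in sequentially. measure \<sigma> (\<Union>i. F i) - (\<Sum>i<N. measure \<sigma> (F i)) < e / 2"
        if s: "\<sigma> \<in> S" for \<sigma>
      proof -
        interpret \<sigma>: finite_measure \<sigma> using S(1) s .
        have "(\<lambda>i. measure \<sigma> (F i)) sums measure \<sigma> (\<Union>i. F i)"
          using FB S(2)[OF s] union.hyps(1) by (intro \<sigma>.finite_measure_UNION) auto
        then have "(\<lambda>N. \<Sum>i<N. measure \<sigma> (F i)) \<longlonglongrightarrow> measure \<sigma> (\<Union>i. F i)"
          by (simp add: sums_def)
        then have "\<forall>\<^sub>F N in sequentially. measure \<sigma> (\<Union>i. F i) - e / 2 < (\<Sum>i<N. measure \<sigma> (F i))"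
          using e by (auto intro: order_tendstoD)
        then show ?thesis by eventually_elim simp
      qed
      then have "\<forall>\<^sub>F N in sequentially. \<forall>\<sigma>\<in>S. measure \<sigma> (\<Union>i. F i) - (\<Sum>i<N. measure \<sigma> (F i)) < e / 2"
        using fin by (simp add: eventually_ball_finite)
      then obtain N where N: "\<And>\<sigma>. \<sigma> \<in> S \<Longrightarrow> measure \<sigma> (\<Union>i. F i) - (\<Sum>i<N. measure \<sigma> (F i)) < e / 2"
        using eventually_happens' sequentially_bot by blast
      have "0 < e / (2 * (real N + 1))" using e by simp
      then have "\<forall>i. \<exists>h\<in>lip_b E. \<forall>\<sigma>\<in>S. (\<integral>x. \<bar>h x - indicator (F i) x\<bar> \<partial>\<sigma>) < e / (2 * (real N + 1))"
        using union.IH by blast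
      then obtain h where h: "\<And>i. h i \<in> lip_b E"
        "\<And>i \<sigma>. \<sigma> \<in> S \<Longrightarrow> (\<integral>x. \<bar>h i x - indicator (F i) x\<bar> \<partial>\<sigma>) < e / (2 * (real N + 1))"
        by metis
      have "(\<integral>x. \<bar>(\<Sum>i<N. h i x) - indicator (\<Union>i. F i) x\<bar> \<partial>\<sigma>) < e" if s: "\<sigma> \<in> S" for \<sigma>
      proof -
        interpret \<sigma>: finite_measure \<sigma> using S(1) s .
        have FU: "(\<Union>i. F i) \<in> sets (metric_borel E)" using FB by auto
        have i1: "integrable \<sigma> (\<lambda>x. \<bar>h i x - indicator (F i) x\<bar>)" for i
          using int_lip[OF s h(1)] int_ind[OF s FB] by auto
        have "(\<integral>x. \<bar>(\<Sum>i<N. h i x) - indicator (\<Union>i. F i) x\<bar> \<partial>\<sigma>) \<le>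
            (\<integral>x. (\<Sum>i<N. \<bar>h i x - indicator (F i) x\<bar>) + (indicator (\<Union>i. F i) x - (\<Sum>i<N. indicator (F i) x)) \<partial>\<sigma>)"
        proof (rule integral_mono)
          show "integrable \<sigma> (\<lambda>x. \<bar>(\<Sum>i<N. h i x) - indicator (\<Union>i. F i) x\<bar>)"
            using int_lip[OF s h(1)] int_ind[OF s FU] by auto
          show "integrable \<sigma> (\<lambda>x. (\<Sum>i<N. \<bar>h i x - indicator (F i) x\<bar>) +
              (indicator (\<Union>i. F i) x - (\<Sum>i<N. indicator (F i) x)))"
            using i1 int_ind[OF s FU] int_ind[OF s FB] by auto
          fix x
          have "(\<Sum>i<N. indicator (F i) x :: real) = indicator (\<Union>i<N. F i) x"
            using union.hyps(1) by (intro indicator_UN_disjoint[symmetric])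
              (auto simp: disjoint_family_on_def)
          also have "\<dots> \<le> indicator (\<Union>i. F i) x"
            by (auto simp: indicator_def)
          finally have 1: "(\<Sum>i<N. indicator (F i) x) \<le> (indicator (\<Union>i. F i) x :: real)" .
          have "(\<Sum>i<N. h i x) - indicator (\<Union>i. F i) x =
              (\<Sum>i<N. h i x - indicator (F i) x) - (indicator (\<Union>i. F i) x - (\<Sum>i<N. indicator (F i) x))"
            by (simp add: sum_subtractf)
          moreover have "\<bar>\<Sum>i<N. h i x - indicator (F i) x\<bar> \<le> (\<Sum>i<N. \<bar>h i x - indicator (F i) x\<bar>)"
            by (rule sum_abs)
          ultimately show "\<bar>(\<Sum>i<N. h i x) - indicator (\<Union>i. F i) x\<bar> \<le>
              (\<Sum>i<N. \<bar>h i x - indicator (F i) x\<bar>) + (indicator (\<Union>i. F i) x - (\<Sum>i<N. indicator (F i) x))"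
            using 1 by linarith
        qed
        also have "\<dots> = (\<Sum>i<N. \<integral>x. \<bar>h i x - indicator (F i) x\<bar> \<partial>\<sigma>) +
            (measure \<sigma> (\<Union>i. F i) - (\<Sum>i<N. measure \<sigma> (F i)))"
          using i1 int_ind[OF s FU] int_ind[OF s FB] FB FU S(2)[OF s] by simp
        also have "\<dots> < real N * (e / (2 * (real N + 1))) + e / 2"
          using N[OF s] sum_bounded_above[of "{..<N}" "\<lambda>i. \<integral>x. \<bar>h i x - indicator (F i) x\<bar> \<partial>\<sigma>"
              "e / (2 * (real N + 1))"] less_imp_le[OF h(2)[OF s]]
          by (intro add_le_less_mono) auto
        also have "\<dots> \<le> e"
          using e by (simp add: field_simps)
        finally show ?thesis .
      qed
      then show "\<exists>h\<in>lip_b E. \<forall>\<sigma>\<in>S. (\<integral>x. \<bar>h x - indicator (\<Union> (range F)) x\<bar> \<partial>\<sigma>) < e"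
        using lip_b_sum[of "{..<N}" h E] h(1) by (intro bexI[of _ "\<lambda>x. \<Sum>i<N. h i x"]) auto
    qed
  qed
  then show ?thesis using e by blast
qed

lemma indicator_L1_approx:
  assumes fin: "finite S" and S: "\<And>\<sigma>. \<sigma> \<in> S \<Longrightarrow> finite_measure \<sigma>"
    "\<And>\<sigma>. \<sigma> \<in> S \<Longrightarrow> sets \<sigma> = sets (metric_borel E)"
    and A: "A \<in> sets (metric_borel E)" and e: "0 < (e::real)"
  obtains h where "h \<in> lip_b E" "\<And>x. 0 \<le> h x" "\<And>x. h x \<le> 1"
    "\<And>\<sigma>. \<sigma> \<in> S \<Longrightarrow> (\<integral>x. \<bar>h x - indicator A x\<bar> \<partial>\<sigma>) < e"
proof -
  obtain g where g: "g \<in> lip_b E" "\<forall>\<sigma>\<in>S. (\<integral>x. \<bar>g x - indicator A x\<bar> \<partial>\<sigma>) < e"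
    using indicator_L1_approx_unclamped[OF assms] by blast
  define h where "h x = max 0 (min 1 (g x))" for x
  obtain K where K: "lipschitz_le E K g" using g(1) by (rule lip_bE)
  have h01: "0 \<le> h x" "h x \<le> 1" for x by (auto simp: h_def)
  have "lipschitz_le E K h"
    unfolding h_def using K lipschitz_le_nonneg[OF K]
    by (intro lipschitz_le_max lipschitz_le_min lipschitz_le_const)
  then have hl: "h \<in> lip_b E"
    using h01 by (intro lip_bI[of E K h 1]) auto
  have "(\<integral>x. \<bar>h x - indicator A x\<bar> \<partial>\<sigma>) \<le> (\<integral>x. \<bar>g x - indicator A x\<bar> \<partial>\<sigma>)" if s: "\<sigma> \<in> S" for \<sigma>
  proof -
    have "integrable \<sigma> (indicator A :: 'a \<Rightarrow> real)"
      using S[OF s] A by (simp add: finite_measure.emeasure_finite less_top[symmetric])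
    then have "integrable \<sigma> (\<lambda>x. \<bar>u x - indicator A x\<bar>)" if "u \<in> lip_b E" for u
      using lip_b_integrable[OF that S[OF s]]
      by (intro integrable_abs Bochner_Integration.integrable_diff)
    from this[OF hl] this[OF g(1)] show ?thesis
      by (rule integral_mono) (auto simp: h_def indicator_def)
  qed
  then show thesis
    using g(2) hl h01 that by (meson order_le_less_trans)
qed

lemma functional_lincomb:
  "multilinear_functional k E T \<Longrightarrow> f \<in> lip_b E \<Longrightarrow> g \<in> lip_b E \<Longrightarrow> \<pi> \<in> lip_tuples k E \<Longrightarrow>
    T (\<lambda>x. a * f x + b * g x) \<pi> = a * T f \<pi> + b * T g \<pi>"
  unfolding multilinear_functional_def by simp

text \<open>Splitting the test function with a Lipschitz approximation of the indicator of \<open>A\<close> allows one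
  bound to be used on \<open>A\<close> and the other one off \<open>A\<close>. This is what makes a least bound exist.\<close>

lemma mass_bound_split:
  assumes T: "multilinear_functional k E T"
    and \<mu>: "mass_bound k E T \<mu>" and \<nu>: "mass_bound k E T \<nu>"
    and A: "A \<in> sets (metric_borel E)" and f: "f \<in> lip_b E" and \<pi>: "\<pi> \<in> lip_tuples k E"
  shows "\<bar>T f \<pi>\<bar> \<le> prod_list (map (lip_const E) \<pi>) *
    ((\<integral>x. \<bar>f x\<bar> * indicator A x \<partial>\<mu>) + (\<integral>x. \<bar>f x\<bar> * (1 - indicator A x) \<partial>\<nu>))"
proof -
  define L where "L = prod_list (map (lip_const E) \<pi>)"
  have L: "0 \<le> L" unfolding L_def using \<pi> by (rule prod_lip_const_nonneg)
  obtain B where B: "\<And>x. x \<in> mspace E \<Longrightarrow> \<bar>f x\<bar> \<le> B" "0 \<le> B"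
    using f by (rule lip_bE) blast
  have fin: "finite_measure \<sigma>" and sets: "sets \<sigma> = sets (metric_borel E)" if "\<sigma> \<in> {\<mu>, \<nu>}" for \<sigma>
    using that \<mu> \<nu> by (auto simp: mass_bound_def)
  have space: "space \<sigma> = mspace E" if "\<sigma> \<in> {\<mu>, \<nu>}" for \<sigma>
    using sets[OF that] by (metis sets_eq_imp_space_eq space_metric_borel)
  have iA: "integrable \<sigma> (indicator A :: 'a \<Rightarrow> real)" if "\<sigma> \<in> {\<mu>, \<nu>}" for \<sigma>
    using fin[OF that] sets[OF that] A
    by (simp add: finite_measure.emeasure_finite less_top[symmetric])
  have il: "integrable \<sigma> g" if "\<sigma> \<in> {\<mu>, \<nu>}" "g \<in> lip_b E" for \<sigma> g
    using that(2) fin[OF that(1)] sets[OF that(1)] by (rule lip_b_integrable)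
  have ifA: "integrable \<sigma> (\<lambda>x. \<bar>f x\<bar> * indicator A x)" if "\<sigma> \<in> {\<mu>, \<nu>}" for \<sigma>
    using il[OF that f] sets[OF that] A by (intro integrable_real_mult_indicator integrable_abs) auto
  let ?R = "(\<integral>x. \<bar>f x\<bar> * indicator A x \<partial>\<mu>) + (\<integral>x. \<bar>f x\<bar> * (1 - indicator A x) \<partial>\<nu>)"
  have main: "\<bar>T f \<pi>\<bar> \<le> L * (?R + 2 * B * e)" if e: "0 < e" for e
  proof -
    obtain h where h: "h \<in> lip_b E" "\<And>x. 0 \<le> h x" "\<And>x. h x \<le> 1"
      "\<And>\<sigma>. \<sigma> \<in> {\<mu>, \<nu>} \<Longrightarrow> (\<integral>x. \<bar>h x - indicator A x\<bar> \<partial>\<sigma>) < e"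
      using indicator_L1_approx[of "{\<mu>, \<nu>}" E A e] fin sets A e by blast
    have h': "(\<lambda>x. 1 - h x) \<in> lip_b E"
      using lip_b_lincomb[OF lip_b_const[of 1 E] h(1), of 1 "-1"] by simp
    have fh: "(\<lambda>x. h x * f x) \<in> lip_b E" and fh': "(\<lambda>x. (1 - h x) * f x) \<in> lip_b E"
      using lip_b_mult[OF h(1) f] lip_b_mult[OF h' f] .
    have ihA: "integrable \<sigma> (\<lambda>x. \<bar>h x - indicator A x\<bar>)" if "\<sigma> \<in> {\<mu>, \<nu>}" for \<sigma>
      using il[OF that h(1)] iA[OF that] by (intro integrable_abs Bochner_Integration.integrable_diff)
    have "T f \<pi> = T (\<lambda>x. h x * f x) \<pi> + T (\<lambda>x. (1 - h x) * f x) \<pi>"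
      using functional_lincomb[OF T fh fh' \<pi>, of 1 1] by (simp add: algebra_simps)
    then have "\<bar>T f \<pi>\<bar> \<le> \<bar>T (\<lambda>x. h x * f x) \<pi>\<bar> + \<bar>T (\<lambda>x. (1 - h x) * f x) \<pi>\<bar>"
      by simp
    also have "\<dots> \<le> L * (\<integral>x. \<bar>h x * f x\<bar> \<partial>\<mu>) + L * (\<integral>x. \<bar>(1 - h x) * f x\<bar> \<partial>\<nu>)"
      using \<mu> \<nu> fh fh' \<pi> unfolding mass_bound_def L_def by (intro add_mono) blast+
    also have "\<dots> \<le> L * ((\<integral>x. \<bar>f x\<bar> * indicator A x \<partial>\<mu>) + B * e) +
        L * ((\<integral>x. \<bar>f x\<bar> * (1 - indicator A x) \<partial>\<nu>) + B * e)"
    proof (intro add_mono mult_left_mono L)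
      have "(\<integral>x. \<bar>h x * f x\<bar> \<partial>\<mu>) \<le> (\<integral>x. \<bar>f x\<bar> * indicator A x + B * \<bar>h x - indicator A x\<bar> \<partial>\<mu>)"
      proof (rule integral_mono)
        fix x assume "x \<in> space \<mu>"
        then have "\<bar>f x\<bar> \<le> B" using B space by simp
        then have "\<bar>f x\<bar> * (h x - indicator A x) \<le> B * \<bar>h x - indicator A x\<bar>"
          by (intro order_trans[OF mult_left_mono[OF abs_ge_self] mult_right_mono]) auto
        then show "\<bar>h x * f x\<bar> \<le> \<bar>f x\<bar> * indicator A x + B * \<bar>h x - indicator A x\<bar>"
          using h(2)[of x] by (simp add: abs_mult algebra_simps)
      qed (use il[of \<mu>, OF _ fh] ifA ihA in \<open>auto intro!: integrable_abs\<close>)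
      also have "\<dots> = (\<integral>x. \<bar>f x\<bar> * indicator A x \<partial>\<mu>) + B * (\<integral>x. \<bar>h x - indicator A x\<bar> \<partial>\<mu>)"
        using ifA[of \<mu>] ihA[of \<mu>] by simp
      also have "\<dots> \<le> (\<integral>x. \<bar>f x\<bar> * indicator A x \<partial>\<mu>) + B * e"
        using h(4)[of \<mu>] B(2) by (intro add_left_mono mult_left_mono) auto
      finally show "(\<integral>x. \<bar>h x * f x\<bar> \<partial>\<mu>) \<le> (\<integral>x. \<bar>f x\<bar> * indicator A x \<partial>\<mu>) + B * e" .
      have ifA': "integrable \<nu> (\<lambda>x. \<bar>f x\<bar> * (1 - indicator A x))"
        using ifA[of \<nu>] il[of \<nu>, OF _ f] by (simp add: right_diff_distrib)
      have "(\<integral>x. \<bar>(1 - h x) * f x\<bar> \<partial>\<nu>) \<le> (\<integral>x. \<bar>f x\<bar> * (1 - indicator A x) + B * \<bar>h x - indicator A x\<bar> \<partial>\<nu>)"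
      proof (rule integral_mono)
        fix x assume "x \<in> space \<nu>"
        then have "\<bar>f x\<bar> \<le> B" using B space by simp
        then have "\<bar>f x\<bar> * (indicator A x - h x) \<le> B * \<bar>h x - indicator A x\<bar>"
          by (subst abs_minus_commute, intro order_trans[OF mult_left_mono[OF abs_ge_self] mult_right_mono]) auto
        moreover have "\<bar>(1 - h x) * f x\<bar> = (1 - h x) * \<bar>f x\<bar>"
          using h(3)[of x] by (simp add: abs_mult)
        ultimately show "\<bar>(1 - h x) * f x\<bar> \<le> \<bar>f x\<bar> * (1 - indicator A x) + B * \<bar>h x - indicator A x\<bar>"
          by (simp add: algebra_simps)
      qed (use il[of \<nu>, OF _ fh'] ifA' ihA in \<open>auto intro!: integrable_abs\<close>)
      also have "\<dots> = (\<integral>x. \<bar>f x\<bar> * (1 - indicator A x) \<partial>\<nu>) + B * (\<integral>x. \<bar>h x - indicator A x\<bar> \<partial>\<nu>)"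
        using ifA' ihA[of \<nu>] by simp
      also have "\<dots> \<le> (\<integral>x. \<bar>f x\<bar> * (1 - indicator A x) \<partial>\<nu>) + B * e"
        using h(4)[of \<nu>] B(2) by (intro add_left_mono mult_left_mono) auto
      finally show "(\<integral>x. \<bar>(1 - h x) * f x\<bar> \<partial>\<nu>) \<le> (\<integral>x. \<bar>f x\<bar> * (1 - indicator A x) \<partial>\<nu>) + B * e" .
    qed
    finally show ?thesis by (simp add: algebra_simps)
  qed
  have "\<bar>T f \<pi>\<bar> \<le> L * ?R"
  proof (rule field_le_epsilon)
    fix e :: real assume "0 < e"
    moreover have pos: "0 < 2 * L * B + 1" using L B(2) by (simp add: add_nonneg_pos)
    ultimately have "\<bar>T f \<pi>\<bar> \<le> L * (?R + 2 * B * (e / (2 * L * B + 1)))"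
      by (intro main) simp
    also have "\<dots> = L * ?R + e * (2 * L * B / (2 * L * B + 1))"
      by (simp add: algebra_simps)
    also have "\<dots> \<le> L * ?R + e * 1"
      using \<open>0 < e\<close> L B(2) pos by (intro add_left_mono mult_left_mono) (auto simp: divide_le_eq_1)
    finally show "\<bar>T f \<pi>\<bar> \<le> L * ?R + e" by simp
  qed
  then show ?thesis by (simp add: L_def)
qed

text \<open>Split along the set where the first density is the smaller one.\<close>

lemma mass_bound_density_inf:
  assumes T: "multilinear_functional k E T" and \<sigma>: "sets \<sigma> = sets (metric_borel E)"
    and fg: "f \<in> borel_measurable \<sigma>" "g \<in> borel_measurable \<sigma>"
    and f: "mass_bound k E T (density \<sigma> f)" and g: "mass_bound k E T (density \<sigma> g)"
  shows "mass_bound k E T (density \<sigma> (\<lambda>x. inf (f x) (g x)))"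
  unfolding mass_bound_iff_nn
proof (intro conjI ballI)
  note [measurable] = fg
  have [measurable_cong]: "sets \<sigma> = sets (metric_borel E)" by fact
  have space: "space \<sigma> = mspace E"
    using \<sigma> by (metis sets_eq_imp_space_eq space_metric_borel)
  show "sets (density \<sigma> (\<lambda>x. inf (f x) (g x))) = sets (metric_borel E)"
    using \<sigma> by simp
  have fin: "finite_measure (density \<sigma> f)" "finite_measure (density \<sigma> g)"
    using f g by (auto simp: mass_bound_def)
  show "finite_measure (density \<sigma> (\<lambda>x. inf (f x) (g x)))"
  proof (rule finite_measureI)
    have "emeasure (density \<sigma> (\<lambda>x. inf (f x) (g x))) (space \<sigma>) \<le> emeasure (density \<sigma> f) (space \<sigma>)"
      by (auto simp: emeasure_density intro!: nn_integral_mono mult_right_mono)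
    also have "\<dots> < \<infinity>"
      using finite_measure.emeasure_finite[OF fin(1)] by (simp add: less_top)
    finally show "emeasure (density \<sigma> (\<lambda>x. inf (f x) (g x))) (space (density \<sigma> (\<lambda>x. inf (f x) (g x)))) \<noteq> \<infinity>"
      by simp
  qed
  fix u \<pi> assume u: "u \<in> lip_b E" and \<pi>: "\<pi> \<in> lip_tuples k E"
  define L where "L = prod_list (map (lip_const E) \<pi>)"
  have L: "0 \<le> L" unfolding L_def using \<pi> by (rule prod_lip_const_nonneg)
  define A where "A = {x \<in> space \<sigma>. f x \<le> g x}"
  have A[measurable]: "A \<in> sets \<sigma>" unfolding A_def by measurable
  have u_m[measurable]: "u \<in> borel_measurable \<sigma>"
    using u lip_imp_measurable \<sigma> by (auto simp: lip_b_def cong: measurable_cong_sets)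
  have eq: "ennreal (\<integral>x. v x \<partial>density \<sigma> w) = (\<integral>\<^sup>+x. w x * ennreal (v x) \<partial>\<sigma>)"
    if fin: "finite_measure (density \<sigma> w)" and w: "w \<in> borel_measurable \<sigma>" and v: "v \<in> borel_measurable \<sigma>"
      and bound: "\<And>x. 0 \<le> v x" "\<And>x. v x \<le> \<bar>u x\<bar>" for v w
  proof -
    have "integrable (density \<sigma> w) u"
      using u fin \<sigma> by (intro lip_b_integrable) auto
    then have "integrable (density \<sigma> w) v"
      using v bound by (elim Bochner_Integration.integrable_bound) auto
    then have "ennreal (\<integral>x. v x \<partial>density \<sigma> w) = (\<integral>\<^sup>+x. ennreal (v x) \<partial>density \<sigma> w)"
      using bound(1) by (intro nn_integral_eq_integral[symmetric]) auto
    then show ?thesis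
      using w v by (simp add: nn_integral_density)
  qed
  have "ennreal \<bar>T u \<pi>\<bar> \<le> ennreal (L * ((\<integral>x. \<bar>u x\<bar> * indicator A x \<partial>density \<sigma> f) +
      (\<integral>x. \<bar>u x\<bar> * (1 - indicator A x) \<partial>density \<sigma> g)))"
    unfolding L_def using T f g A \<sigma> u \<pi> by (intro ennreal_leI mass_bound_split) auto
  also have "\<dots> = ennreal L * (ennreal (\<integral>x. \<bar>u x\<bar> * indicator A x \<partial>density \<sigma> f) +
      ennreal (\<integral>x. \<bar>u x\<bar> * (1 - indicator A x) \<partial>density \<sigma> g))"
    using L by (subst ennreal_mult', simp, subst ennreal_plus) (auto intro!: integral_nonneg_AE simp: indicator_def)
  also have "\<dots> = ennreal L * ((\<integral>\<^sup>+x. f x * ennreal (\<bar>u x\<bar> * indicator A x) \<partial>\<sigma>) +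
      (\<integral>\<^sup>+x. g x * ennreal (\<bar>u x\<bar> * (1 - indicator A x)) \<partial>\<sigma>))"
    by (subst (1 2) eq) (use fin fg in \<open>auto simp: indicator_def\<close>)
  also have "\<dots> = ennreal L * (\<integral>\<^sup>+x. f x * ennreal (\<bar>u x\<bar> * indicator A x) + g x * ennreal (\<bar>u x\<bar> * (1 - indicator A x)) \<partial>\<sigma>)"
    by (subst nn_integral_add) auto
  also have "\<dots> = ennreal L * (\<integral>\<^sup>+x. inf (f x) (g x) * ennreal \<bar>u x\<bar> \<partial>\<sigma>)"
    by (intro arg_cong2[where f = "(*)"] refl nn_integral_cong)
      (auto simp: A_def indicator_def inf_min min_def)
  also have "\<dots> = ennreal L * (\<integral>\<^sup>+x. ennreal \<bar>u x\<bar> \<partial>density \<sigma> (\<lambda>x. inf (f x) (g x)))"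
    by (subst nn_integral_density) auto
  finally show "ennreal \<bar>T u \<pi>\<bar> \<le> ennreal (prod_list (map (lip_const E) \<pi>)) *
      (\<integral>\<^sup>+x. ennreal \<bar>u x\<bar> \<partial>density \<sigma> (\<lambda>x. inf (f x) (g x)))"
    by (simp add: L_def)
qed

lemma mass_bound_min:
  assumes T: "multilinear_functional k E T"
    and \<mu>: "mass_bound k E T \<mu>" and \<nu>: "mass_bound k E T \<nu>"
  obtains \<kappa> where "mass_bound k E T \<kappa>"
    "\<And>A. A \<in> sets (metric_borel E) \<Longrightarrow> emeasure \<kappa> A \<le> emeasure \<mu> A"
    "\<And>A. A \<in> sets (metric_borel E) \<Longrightarrow> emeasure \<kappa> A \<le> emeasure \<nu> A"
proof -
  define \<sigma> where "\<sigma> = sum_measure \<mu> \<nu>"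
  have sets: "sets \<mu> = sets (metric_borel E)" "sets \<nu> = sets (metric_borel E)"
    and fin: "finite_measure \<mu>" "finite_measure \<nu>"
    using \<mu> \<nu> by (auto simp: mass_bound_def)
  have \<sigma>: "sets \<sigma> = sets (metric_borel E)"
    by (simp add: \<sigma>_def sets)
  have sp: "space \<nu> = space \<mu>"
    using sets by (metis sets_eq_imp_space_eq)
  have em: "emeasure \<sigma> A = emeasure \<mu> A + emeasure \<nu> A" if "A \<in> sets (metric_borel E)" for A
    unfolding \<sigma>_def using sets that by (intro emeasure_sum_measure) auto
  have fin\<sigma>: "finite_measure \<sigma>"
  proof (rule finite_measureI)
    have "emeasure \<sigma> (space \<mu>) = emeasure \<mu> (space \<mu>) + emeasure \<nu> (space \<mu>)"
      using sets(1) by (intro em) (metis sets.top)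
    also have "\<dots> \<noteq> \<infinity>"
      using fin by (simp add: finite_measure.emeasure_finite)
    finally show "emeasure \<sigma> (space \<sigma>) \<noteq> \<infinity>" by (simp add: \<sigma>_def)
  qed
  obtain f where f: "f \<in> borel_measurable \<sigma>" "\<mu> = density \<sigma> f"
    by (rule density_of_smaller_measure[OF fin\<sigma>, of \<mu>]) (auto simp: sets \<sigma> em)
  obtain g where g: "g \<in> borel_measurable \<sigma>" "\<nu> = density \<sigma> g"
    by (rule density_of_smaller_measure[OF fin\<sigma>, of \<nu>]) (auto simp: sets \<sigma> em)
  show thesis
  proof (rule that)
    show "mass_bound k E T (density \<sigma> (\<lambda>x. inf (f x) (g x)))"
      using T \<sigma> f g \<mu> \<nu> by (intro mass_bound_density_inf) auto
    fix A assume "A \<in> sets (metric_borel E)"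
    then have A: "A \<in> sets \<sigma>" using \<sigma> by simp
    show "emeasure (density \<sigma> (\<lambda>x. inf (f x) (g x))) A \<le> emeasure \<mu> A"
      unfolding f(2) using A f(1) g(1)
      by (auto simp: emeasure_density intro!: nn_integral_mono mult_right_mono)
    show "emeasure (density \<sigma> (\<lambda>x. inf (f x) (g x))) A \<le> emeasure \<nu> A"
      unfolding g(2) using A f(1) g(1)
      by (auto simp: emeasure_density intro!: nn_integral_mono mult_right_mono)
  qed
qed

lemma mass_bound_density_INF:
  assumes T: "multilinear_functional k E T" and \<sigma>: "sets \<sigma> = sets (metric_borel E)"
    and fm: "\<And>i::nat. f i \<in> borel_measurable \<sigma>"
    and f: "\<And>i. mass_bound k E T (density \<sigma> (f i))"
  shows "mass_bound k E T (density \<sigma> (\<lambda>x. INF i. f i x))"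
proof -
  have [measurable_cong]: "sets \<sigma> = sets (metric_borel E)" by fact
  note [measurable] = fm
  have space: "space \<sigma> = mspace E"
    using \<sigma> by (metis sets_eq_imp_space_eq space_metric_borel)
  define F where "F m x = (INF i\<in>{..m}. f i x)" for m x
  have F_Suc: "F (Suc m) = (\<lambda>x. inf (f (Suc m) x) (F m x))" for m
    unfolding F_def by (simp add: atMost_Suc)
  have Fm[measurable]: "F m \<in> borel_measurable \<sigma>" for m
    unfolding F_def by measurable
  have bound: "mass_bound k E T (density \<sigma> (F m))" for m
  proof (induction m)
    case 0
    then show ?case using f[of 0] by (simp add: F_def)
  next
    case (Suc m)
    show ?case
      unfolding F_Suc using T \<sigma> fm Fm f Suc by (intro mass_bound_density_inf) auto
  qed
  have lim: "(\<lambda>m. F m x) \<longlonglongrightarrow> (INF i. f i x)" for x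
  proof -
    have "(\<lambda>m. F m x) \<longlonglongrightarrow> (INF m. F m x)"
      by (rule LIMSEQ_INF) (auto simp: F_def decseq_def intro!: INF_superset_mono)
    moreover have "(INF m. F m x) = (INF i. f i x)"
    proof (rule antisym)
      show "(INF m. F m x) \<le> (INF i. f i x)"
        unfolding F_def by (rule INF_mono) (auto intro: INF_lower)
      show "(INF i. f i x) \<le> (INF m. F m x)"
        unfolding F_def by (intro INF_greatest INF_lower) auto
    qed
    ultimately show ?thesis by simp
  qed
  have le0: "F m x \<le> f 0 x" for m x
    unfolding F_def by (rule INF_lower) simp
  have fin0: "(\<integral>\<^sup>+x. f 0 x \<partial>\<sigma>) < \<infinity>"
  proof -
    have "emeasure (density \<sigma> (f 0)) (space \<sigma>) < \<infinity>"
      using f[of 0] by (simp add: mass_bound_def finite_measure.emeasure_finite less_top[symmetric])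
    then show ?thesis by (simp add: emeasure_density cong: nn_integral_cong)
  qed
  show ?thesis
    unfolding mass_bound_iff_nn
  proof (intro conjI ballI)
    show "sets (density \<sigma> (\<lambda>x. INF i. f i x)) = sets (metric_borel E)"
      using \<sigma> by simp
    show "finite_measure (density \<sigma> (\<lambda>x. INF i. f i x))"
    proof (rule finite_measureI)
      have "emeasure (density \<sigma> (\<lambda>x. INF i. f i x)) (space \<sigma>) = (\<integral>\<^sup>+x. (INF i. f i x) \<partial>\<sigma>)"
        by (simp add: emeasure_density cong: nn_integral_cong)
      also have "\<dots> \<le> (\<integral>\<^sup>+x. f 0 x \<partial>\<sigma>)"
        by (intro nn_integral_mono INF_lower) auto
      finally show "emeasure (density \<sigma> (\<lambda>x. INF i. f i x)) (space (density \<sigma> (\<lambda>x. INF i. f i x))) \<noteq> \<infinity>"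
        using fin0 by simp
    qed
    fix u \<pi> assume u: "u \<in> lip_b E" and \<pi>: "\<pi> \<in> lip_tuples k E"
    define L where "L = prod_list (map (lip_const E) \<pi>)"
    have u_m[measurable]: "u \<in> borel_measurable \<sigma>"
      using u lip_imp_measurable \<sigma> by (auto simp: lip_b_def cong: measurable_cong_sets)
    obtain B where B: "\<And>x. x \<in> mspace E \<Longrightarrow> \<bar>u x\<bar> \<le> B" "0 \<le> B"
      using u by (rule lip_bE) blast
    have "(\<lambda>m. \<integral>\<^sup>+x. F m x * ennreal \<bar>u x\<bar> \<partial>\<sigma>) \<longlonglongrightarrow> (\<integral>\<^sup>+x. (INF i. f i x) * ennreal \<bar>u x\<bar> \<partial>\<sigma>)"
    proof (rule nn_integral_dominated_convergence[where w = "\<lambda>x. f 0 x * ennreal B"])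
      show "AE x in \<sigma>. F j x * ennreal \<bar>u x\<bar> \<le> f 0 x * ennreal B" for j
        using le0 B by (intro AE_I2 mult_mono) (auto simp: space)
      show "(\<integral>\<^sup>+x. f 0 x * ennreal B \<partial>\<sigma>) < \<infinity>"
        using fin0 by (simp add: nn_integral_multc ennreal_mult_less_top)
      show "AE x in \<sigma>. (\<lambda>i. F i x * ennreal \<bar>u x\<bar>) \<longlonglongrightarrow> (INF i. f i x) * ennreal \<bar>u x\<bar>"
        using lim by (subst (1 2) mult.commute, intro AE_I2 ennreal_tendsto_cmult) auto
    qed auto
    then have "(\<lambda>m. ennreal L * (\<integral>\<^sup>+x. F m x * ennreal \<bar>u x\<bar> \<partial>\<sigma>)) \<longlonglongrightarrow>
        ennreal L * (\<integral>\<^sup>+x. (INF i. f i x) * ennreal \<bar>u x\<bar> \<partial>\<sigma>)"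
      by (intro ennreal_tendsto_cmult) auto
    moreover have "ennreal \<bar>T u \<pi>\<bar> \<le> ennreal L * (\<integral>\<^sup>+x. F m x * ennreal \<bar>u x\<bar> \<partial>\<sigma>)" for m
    proof -
      have "(\<integral>\<^sup>+x. ennreal \<bar>u x\<bar> \<partial>density \<sigma> (F m)) = (\<integral>\<^sup>+x. F m x * ennreal \<bar>u x\<bar> \<partial>\<sigma>)"
        by (rule nn_integral_density) measurable
      then show ?thesis
        using bound[of m] u \<pi> unfolding mass_bound_iff_nn L_def by metis
    qed
    ultimately have "ennreal \<bar>T u \<pi>\<bar> \<le> ennreal L * (\<integral>\<^sup>+x. (INF i. f i x) * ennreal \<bar>u x\<bar> \<partial>\<sigma>)"
      by (intro LIMSEQ_le_const) auto
    then show "ennreal \<bar>T u \<pi>\<bar> \<le> ennreal (prod_list (map (lip_const E) \<pi>)) *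
        (\<integral>\<^sup>+x. ennreal \<bar>u x\<bar> \<partial>density \<sigma> (\<lambda>x. INF i. f i x))"
      by (simp add: nn_integral_density L_def)
  qed
qed

text \<open>After passing to minima with a fixed bound, a minimizing sequence for the total mass has densities
  with respect to that bound, and the infimum of the densities attains the minimal mass. A bound of
  minimal mass is the least one, since its minimum with any other bound cannot lose mass.\<close>

lemma least_mass_bound_exists:
  assumes T: "multilinear_functional k E T" and ex: "mass_bound k E T \<mu>0"
  obtains \<mu> where "mass_bound k E T \<mu>"
    "\<And>\<nu> A. mass_bound k E T \<nu> \<Longrightarrow> A \<in> sets (metric_borel E) \<Longrightarrow> emeasure \<mu> A \<le> emeasure \<nu> A"
proof -
  define total where "total = (\<lambda>\<nu>. emeasure \<nu> (mspace E)) ` {\<nu>. mass_bound k E T \<nu>}"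
  have "total \<noteq> {}" using ex by (auto simp: total_def)
  then obtain t :: "nat \<Rightarrow> ennreal" where t: "range t \<subseteq> total" "Inf total = (INF i. t i)"
    using ennreal_Inf_countable_INF by metis
  have "\<exists>f. f \<in> borel_measurable \<mu>0 \<and> mass_bound k E T (density \<mu>0 f) \<and>
      emeasure (density \<mu>0 f) (mspace E) \<le> t i" for i
  proof -
    obtain \<nu> where \<nu>: "mass_bound k E T \<nu>" "emeasure \<nu> (mspace E) = t i"
      using t(1) unfolding total_def by (metis (mono_tags, lifting) imageE mem_Collect_eq range_subsetD)
    obtain \<kappa> where \<kappa>: "mass_bound k E T \<kappa>"
      "\<And>A. A \<in> sets (metric_borel E) \<Longrightarrow> emeasure \<kappa> A \<le> emeasure \<mu>0 A"
      "\<And>A. A \<in> sets (metric_borel E) \<Longrightarrow> emeasure \<kappa> A \<le> emeasure \<nu> A"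
      using mass_bound_min[OF T ex \<nu>(1)] by blast
    have "finite_measure \<mu>0" "sets \<kappa> = sets \<mu>0" "sets \<mu>0 = sets (metric_borel E)"
      using ex \<kappa>(1) by (auto simp: mass_bound_def)
    then obtain f where "f \<in> borel_measurable \<mu>0" "\<kappa> = density \<mu>0 f"
      using density_of_smaller_measure[of \<mu>0 \<kappa>] \<kappa>(2) by metis
    then show ?thesis
      using \<kappa>(1) \<kappa>(3)[of "mspace E"] \<nu>(2) by (metis sets.top space_metric_borel)
  qed
  then obtain f where f: "\<And>i. f i \<in> borel_measurable \<mu>0" "\<And>i. mass_bound k E T (density \<mu>0 (f i))"
      "\<And>i. emeasure (density \<mu>0 (f i)) (mspace E) \<le> t i"
    by metis
  define \<mu> where "\<mu> = density \<mu>0 (\<lambda>x. INF i. f i x)"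
  have sets0: "sets \<mu>0 = sets (metric_borel E)"
    using ex by (simp add: mass_bound_def)
  have topE: "mspace E \<in> sets (metric_borel E)"
    by (metis sets.top space_metric_borel)
  have \<mu>: "mass_bound k E T \<mu>"
    unfolding \<mu>_def using T sets0 f by (intro mass_bound_density_INF) auto
  have "emeasure \<mu> (mspace E) \<le> t i" for i
  proof -
    have "(\<lambda>x. INF i. f i x) \<in> borel_measurable \<mu>0"
      using f(1) by (intro borel_measurable_INF) auto
    then have "emeasure \<mu> (mspace E) \<le> emeasure (density \<mu>0 (f i)) (mspace E)"
      unfolding \<mu>_def using f(1) topE sets0
      by (auto simp: emeasure_density intro!: nn_integral_mono mult_right_mono INF_lower)
    also have "\<dots> \<le> t i" by (rule f(3))
    finally show ?thesis .
  qed
  then have minimal: "emeasure \<mu> (mspace E) \<le> emeasure \<nu> (mspace E)" if "mass_bound k E T \<nu>" for \<nu>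
  proof -
    assume *: "\<And>i. emeasure \<mu> (mspace E) \<le> t i"
    have "emeasure \<mu> (mspace E) \<le> Inf total"
      unfolding t(2) using * by (rule INF_greatest)
    also have "\<dots> \<le> emeasure \<nu> (mspace E)"
      using that by (intro Inf_lower) (auto simp: total_def)
    finally show ?thesis .
  qed
  \<comment> \<open>The minimum \<open>\<kappa>\<close> of \<open>\<mu>\<close> and \<open>\<nu>\<close> lies below \<open>\<mu>\<close> and has at least its total mass, so it equals \<open>\<mu>\<close>.\<close>
  show thesis
  proof (rule that[OF \<mu>])
    fix \<nu> A assume \<nu>: "mass_bound k E T \<nu>" and A: "A \<in> sets (metric_borel E)"
    obtain \<kappa> where \<kappa>: "mass_bound k E T \<kappa>"
      "\<And>A. A \<in> sets (metric_borel E) \<Longrightarrow> emeasure \<kappa> A \<le> emeasure \<mu> A"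
      "\<And>A. A \<in> sets (metric_borel E) \<Longrightarrow> emeasure \<kappa> A \<le> emeasure \<nu> A"
      using mass_bound_min[OF T \<mu> \<nu>] by blast
    have AE: "A \<subseteq> mspace E" using sets.sets_into_space[OF A] by simp
    have cA: "mspace E - A \<in> sets (metric_borel E)" using A topE by (rule sets.Diff[rotated])
    have split: "emeasure \<rho> (mspace E) = emeasure \<rho> A + emeasure \<rho> (mspace E - A)"
      if "mass_bound k E T \<rho>" for \<rho>
    proof -
      have "sets \<rho> = sets (metric_borel E)" using that by (simp add: mass_bound_def)
      then have "emeasure \<rho> A + emeasure \<rho> (mspace E - A) = emeasure \<rho> (A \<union> (mspace E - A))"
        using A cA by (intro plus_emeasure) auto
      moreover have "A \<union> (mspace E - A) = mspace E" using AE by auto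
      ultimately show ?thesis by simp
    qed
    have "emeasure \<mu> A + emeasure \<mu> (mspace E - A) \<le> emeasure \<kappa> A + emeasure \<kappa> (mspace E - A)"
      using minimal[OF \<kappa>(1)] split \<mu> \<kappa>(1) by metis
    also have "\<dots> \<le> emeasure \<kappa> A + emeasure \<mu> (mspace E - A)"
      using \<kappa>(2)[OF cA] by (rule add_left_mono)
    finally have "emeasure \<mu> A \<le> emeasure \<kappa> A"
      using \<mu> by (simp add: mass_bound_def finite_measure.emeasure_finite)
    also have "\<dots> \<le> emeasure \<nu> A" using \<kappa>(3) A .
    finally show "emeasure \<mu> A \<le> emeasure \<nu> A" .
  qed
qed

lemma mass_measure_least:
  assumes "metric_current k E T"
  shows mass_bound_mass_measure: "mass_bound k E T (mass_measure k E T)"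
    and mass_measure_le: "mass_bound k E T \<nu> \<Longrightarrow> A \<in> sets (metric_borel E) \<Longrightarrow>
      emeasure (mass_measure k E T) A \<le> emeasure \<nu> A"
proof -
  let ?P = "\<lambda>\<mu>. mass_bound k E T \<mu> \<and>
        (\<forall>\<nu>. mass_bound k E T \<nu> \<longrightarrow> (\<forall>A\<in>sets (metric_borel E). emeasure \<mu> A \<le> emeasure \<nu> A))"
  obtain \<mu>0 where "multilinear_functional k E T" "mass_bound k E T \<mu>0"
    using assms by (auto simp: metric_current_def)
  then obtain \<mu> where \<mu>: "?P \<mu>"
    using least_mass_bound_exists by metis
  have "?P (mass_measure k E T)"
    unfolding mass_measure_def
  proof (rule theI)
    show "?P \<mu>" by (fact \<mu>)
    fix \<nu> assume \<nu>: "?P \<nu>"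
    show "\<nu> = \<mu>"
    proof (rule measure_eqI)
      show "sets \<nu> = sets \<mu>" using \<mu> \<nu> by (simp add: mass_bound_def)
      fix A assume "A \<in> sets \<nu>"
      then have "A \<in> sets (metric_borel E)" using \<nu> by (simp add: mass_bound_def)
      then show "emeasure \<nu> A = emeasure \<mu> A" using \<mu> \<nu> by (intro antisym) auto
    qed
  qed
  then show "mass_bound k E T (mass_measure k E T)"
    and "mass_bound k E T \<nu> \<Longrightarrow> A \<in> sets (metric_borel E) \<Longrightarrow>
      emeasure (mass_measure k E T) A \<le> emeasure \<nu> A"
    by blast+
qed

section \<open>Consequences of the mass bound\<close>

text \<open>Currents act on functions on the whole type, but only the values on the space matter. In the
  first argument this is the mass bound. In the others it is the continuity axiom, applied
  to a constant sequence.\<close>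

lemma functional_cong:
  assumes T: "metric_current k E T"
    and f: "f \<in> lip_b E" "g \<in> lip_b E" "\<And>x. x \<in> mspace E \<Longrightarrow> f x = g x"
    and \<pi>: "\<pi> \<in> lip_tuples k E" "\<rho> \<in> lip_tuples k E"
      "\<And>i x. i < k \<Longrightarrow> x \<in> mspace E \<Longrightarrow> (\<pi> ! i) x = (\<rho> ! i) x"
  shows "T f \<pi> = T g \<rho>"
proof -
  obtain \<mu> where \<mu>: "mass_bound k E T \<mu>" using T by (auto simp: metric_current_def)
  have lin: "multilinear_functional k E T" and cont: "continuous_functional k E T"
    using T by (auto simp: metric_current_def)
  have space: "space \<mu> = mspace E"
    using \<mu> unfolding mass_bound_def by (metis sets_eq_imp_space_eq space_metric_borel)
  let ?h = "\<lambda>x. 1 * f x + (-1) * g x"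
  have "?h \<in> lip_b E" using f(1,2) by (rule lip_b_lincomb)
  then have "\<bar>T ?h \<pi>\<bar> \<le> prod_list (map (lip_const E) \<pi>) * (\<integral>x. \<bar>?h x\<bar> \<partial>\<mu>)"
    using \<mu> \<pi>(1) unfolding mass_bound_def by blast
  also have "(\<integral>x. \<bar>?h x\<bar> \<partial>\<mu>) = 0"
    using f(3) space by (intro integral_eq_zero_AE AE_I2) auto
  finally have 1: "T f \<pi> = T g \<pi>"
    using functional_lincomb[OF lin f(1,2) \<pi>(1), of 1 "-1"] by simp
  have "lip_const E (\<rho> ! i) \<le> (\<Sum>i<k. lip_const E (\<rho> ! i))" if "i < k" for i
    using \<pi>(2) that by (intro member_le_sum) (auto simp: lip_tuples_conv lip_const_nonneg)
  moreover have "(\<lambda>m. (\<rho> ! i) x) \<longlonglongrightarrow> (\<pi> ! i) x" if "i < k" "x \<in> mspace E" for i x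
    using \<pi>(3)[OF that] by simp
  ultimately have "(\<lambda>m. T g \<rho>) \<longlonglongrightarrow> T g \<pi>"
    using cont[unfolded continuous_functional_def, rule_format, OF f(2) \<pi>(1),
        of "\<lambda>_. \<rho>" "\<Sum>i<k. lip_const E (\<rho> ! i)"] \<pi>(2) by blast
  then have "T g \<pi> = T g \<rho>"
    by (simp add: LIMSEQ_const_iff)
  with 1 show ?thesis by simp
qed

lemma current_estimate:
  assumes \<mu>: "mass_bound k E T \<mu>" and f: "f \<in> lip_b E" "\<And>x. x \<in> mspace E \<Longrightarrow> \<bar>f x\<bar> \<le> B"
    and A: "A \<in> sets (metric_borel E)" "\<And>x. x \<in> mspace E \<Longrightarrow> x \<notin> A \<Longrightarrow> f x = 0"
    and \<pi>: "length \<pi> = k" "\<And>i. i < k \<Longrightarrow> lipschitz_le E K (\<pi> ! i)" and K: "0 \<le> K"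
  shows "\<bar>T f \<pi>\<bar> \<le> K ^ k * (B * measure \<mu> A)"
proof -
  have sets: "sets \<mu> = sets (metric_borel E)" and fin: "finite_measure \<mu>"
    using \<mu> by (auto simp: mass_bound_def)
  have space: "space \<mu> = mspace E"
    using sets by (metis sets_eq_imp_space_eq space_metric_borel)
  have \<pi>': "\<pi> \<in> lip_tuples k E"
    using \<pi> lipschitz_le_imp_lip by (auto simp: lip_tuples_conv)
  have iA: "integrable \<mu> (indicator A :: 'a \<Rightarrow> real)"
    using fin sets A by (simp add: finite_measure.emeasure_finite less_top[symmetric])
  have iB: "integrable \<mu> (\<lambda>x. B * indicator A x)"
    using iA by simp
  have "\<bar>T f \<pi>\<bar> \<le> prod_list (map (lip_const E) \<pi>) * (\<integral>x. \<bar>f x\<bar> \<partial>\<mu>)"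
    using \<mu> f(1) \<pi>' unfolding mass_bound_def by blast
  also have "\<dots> \<le> K ^ k * (\<integral>x. \<bar>f x\<bar> \<partial>\<mu>)"
    using prod_lip_const_le[OF \<pi>] by (intro mult_right_mono) auto
  also have "\<dots> \<le> K ^ k * (\<integral>x. B * indicator A x \<partial>\<mu>)"
    using K f(2) A(2) space iB lip_b_integrable[OF f(1) fin sets]
    by (intro mult_left_mono integral_mono) (auto split: split_indicator)
  also have "(\<integral>x. B * indicator A x \<partial>\<mu>) = B * measure \<mu> A"
    using A(1) sets sets.sets_into_space[OF A(1)] space by (simp add: Int_absorb2)
  finally show ?thesis .
qed

text \<open>If the current vanished on all test functions supported near \<open>p\<close>, then the mass measure with the
  ball removed would still be a bound, contradicting minimality.\<close>

lemma exists_localized_test: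
  assumes T: "metric_current k E T" and p: "p \<in> mspace E" and e: "0 < e"
    and pos: "0 < emeasure (mass_measure k E T) (mcball_of E p e)"
  obtains f \<pi> where "f \<in> lip_b E" "\<pi> \<in> lip_tuples k E" "T f \<pi> \<noteq> 0"
    "\<And>x. x \<in> mspace E \<Longrightarrow> 2 * e < mdist E p x \<Longrightarrow> f x = 0"
proof (rule ccontr)
  assume "\<not> thesis"
  with that have zero: "T f \<pi> = 0" if "f \<in> lip_b E" "\<pi> \<in> lip_tuples k E"
    "\<And>x. x \<in> mspace E \<Longrightarrow> 2 * e < mdist E p x \<Longrightarrow> f x = 0" for f \<pi>
    using that by blast
  define \<mu> where "\<mu> = mass_measure k E T"
  have \<mu>: "mass_bound k E T \<mu>"
    unfolding \<mu>_def using T by (rule mass_bound_mass_measure)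
  have lin: "multilinear_functional k E T"
    using T by (simp add: metric_current_def)
  have sets: "sets \<mu> = sets (metric_borel E)" and fin: "finite_measure \<mu>"
    using \<mu> by (auto simp: mass_bound_def)
  have space: "space \<mu> = mspace E"
    using sets by (metis sets_eq_imp_space_eq space_metric_borel)
  define A where "A = mspace E - mcball_of E p e"
  have A: "A \<in> sets \<mu>"
    unfolding A_def sets by (metis mcball_in_metric_borel sets.compl_sets space_metric_borel)
  define \<nu> where "\<nu> = density \<mu> (indicator A)"
  obtain \<eta> where \<eta>: "\<eta> \<in> lip_b E" "\<And>x. x \<in> mspace E \<Longrightarrow> 2 * e < mdist E p x \<Longrightarrow> \<eta> x = 0"
    "\<And>x. x \<in> mspace E \<Longrightarrow> mdist E p x \<le> e \<Longrightarrow> \<eta> x = 1" "\<And>x. 0 \<le> \<eta> x" "\<And>x. \<eta> x \<le> 1"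
  proof
    let ?\<eta> = "\<lambda>x. min 1 (max 0 (2 * 1 + (- (1 / e)) * mdist E p x))"
    have "lipschitz_le E (1 / e) (\<lambda>x. 2 * 1 + (- (1 / e)) * mdist E p x)"
      using lipschitz_le_lincomb[OF lipschitz_le_const[of 0 E 1] lipschitz_le_dist[OF p], of 2 "- (1 / e)"] e
      by simp
    then have "lipschitz_le E (1 / e) ?\<eta>"
      using e by (intro lipschitz_le_min lipschitz_le_max lipschitz_le_const) auto
    then show "?\<eta> \<in> lip_b E" by (rule lip_bI[of _ _ _ 1]) auto
    show "?\<eta> x = 0" if "2 * e < mdist E p x" for x
      using e that by (simp add: field_simps)
    show "?\<eta> x = 1" if "mdist E p x \<le> e" for x
      using e that by (simp add: field_simps)
  qed auto
  have "mass_bound k E T \<nu>"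
    unfolding mass_bound_iff_nn
  proof (intro conjI ballI)
    show "sets \<nu> = sets (metric_borel E)" by (simp add: \<nu>_def sets)
    show "finite_measure \<nu>"
      using fin A by (intro finite_measureI)
        (simp add: \<nu>_def emeasure_density finite_measure.emeasure_finite sets.sets_into_space Int_absorb1)
    fix f \<pi> assume f: "f \<in> lip_b E" and \<pi>: "\<pi> \<in> lip_tuples k E"
    have \<eta>': "(\<lambda>x. 1 - \<eta> x) \<in> lip_b E"
      using lip_b_lincomb[OF lip_b_const[of 1 E] \<eta>(1), of 1 "-1"] by simp
    have f1: "(\<lambda>x. \<eta> x * f x) \<in> lip_b E" and f2: "(\<lambda>x. (1 - \<eta> x) * f x) \<in> lip_b E"
      using lip_b_mult[OF \<eta>(1) f] lip_b_mult[OF \<eta>' f] .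
    have "T f \<pi> = T (\<lambda>x. \<eta> x * f x) \<pi> + T (\<lambda>x. (1 - \<eta> x) * f x) \<pi>"
      using functional_lincomb[OF lin f1 f2 \<pi>, of 1 1] by (simp add: algebra_simps)
    also have "T (\<lambda>x. \<eta> x * f x) \<pi> = 0"
      using f1 \<pi> \<eta>(2) by (intro zero) auto
    finally have "T f \<pi> = T (\<lambda>x. (1 - \<eta> x) * f x) \<pi>" by simp
    then have "ennreal \<bar>T f \<pi>\<bar> \<le> ennreal (prod_list (map (lip_const E) \<pi>)) *
        (\<integral>\<^sup>+x. ennreal \<bar>(1 - \<eta> x) * f x\<bar> \<partial>\<mu>)"
      using \<mu> f2 \<pi> unfolding mass_bound_iff_nn by metis
    also have "(\<integral>\<^sup>+x. ennreal \<bar>(1 - \<eta> x) * f x\<bar> \<partial>\<mu>) \<le> (\<integral>\<^sup>+x. indicator A x * ennreal \<bar>f x\<bar> \<partial>\<mu>)"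
    proof (rule nn_integral_mono)
      fix x assume "x \<in> space \<mu>"
      then have x: "x \<in> mspace E" using space by simp
      show "ennreal \<bar>(1 - \<eta> x) * f x\<bar> \<le> indicator A x * ennreal \<bar>f x\<bar>"
      proof (cases "x \<in> A")
        case True
        then show ?thesis
          using \<eta>(4,5)[of x] by (simp add: abs_mult mult_left_le_one_le)
      next
        case False
        then show ?thesis using x p \<eta>(3)[of x] by (simp add: A_def)
      qed
    qed
    also have "(\<integral>\<^sup>+x. indicator A x * ennreal \<bar>f x\<bar> \<partial>\<mu>) = (\<integral>\<^sup>+x. ennreal \<bar>f x\<bar> \<partial>\<nu>)"
    proof -
      have "f \<in> borel_measurable \<mu>"
        using lip_b_integrable[OF f fin sets] by auto
      then show ?thesis
        unfolding \<nu>_def using A by (subst nn_integral_density) auto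
    qed
    finally show "ennreal \<bar>T f \<pi>\<bar> \<le> ennreal (prod_list (map (lip_const E) \<pi>)) * (\<integral>\<^sup>+x. ennreal \<bar>f x\<bar> \<partial>\<nu>)"
      by (simp add: mult_left_mono)
  qed
  then have "emeasure \<mu> (mcball_of E p e) \<le> emeasure \<nu> (mcball_of E p e)"
    unfolding \<mu>_def using T by (intro mass_measure_le) auto
  also have "\<dots> = 0"
  proof -
    have "mcball_of E p e \<in> sets \<mu>" "A \<inter> mcball_of E p e = {}"
      by (auto simp: sets A_def)
    then show ?thesis
      using A by (simp add: \<nu>_def emeasure_density indicator_inter_arith[symmetric])
  qed
  finally show False using pos by (simp add: \<mu>_def)
qed

text \<open>Sequences that approximate \<open>g\<close> cut off to \<open>V\<close> in \<open>L\<^sup>1\<close> also approximate \<open>g\<close>, since the two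
  functions agree almost everywhere; so the limit that defines the restricted current is
  \<open>T g \<pi>\<close>. The constant sequence \<open>g\<close> shows that no other value qualifies.\<close>

lemma restrict_current_eq:
  assumes T: "metric_current k E T" and V: "V \<in> sets (metric_borel E)"
    and g: "g \<in> lip_b E" and \<pi>: "\<pi> \<in> lip_tuples k E"
    and N: "N \<in> null_sets (mass_measure k E T)" "\<And>x. x \<in> mspace E \<Longrightarrow> g x \<noteq> 0 \<Longrightarrow> x \<notin> V \<Longrightarrow> x \<in> N"
  shows "restrict_current k E T V g \<pi> = T g \<pi>"
proof -
  define \<mu> where "\<mu> = mass_measure k E T"
  have \<mu>: "mass_bound k E T \<mu>"
    unfolding \<mu>_def using T by (rule mass_bound_mass_measure)
  have sets: "sets \<mu> = sets (metric_borel E)" and fin: "finite_measure \<mu>"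
    using \<mu> by (auto simp: mass_bound_def)
  have space: "space \<mu> = mspace E"
    using sets by (metis sets_eq_imp_space_eq space_metric_borel)
  have lin: "multilinear_functional k E T"
    using T by (simp add: metric_current_def)
  define L where "L = prod_list (map (lip_const E) \<pi>)"
  define V\<^sub>g where "V\<^sub>g x = indicator V x * g x" for x
  have ae: "AE x in \<mu>. V\<^sub>g x = g x"
    using N unfolding \<mu>_def[symmetric]
    by (intro AE_I'[of N]) (auto simp: V\<^sub>g_def space indicator_def split: if_splits)
  have 1: "(\<lambda>m. T (h m) \<pi>) \<longlonglongrightarrow> T g \<pi>"
    if h: "\<And>m::nat. h m \<in> lip_b E" and lim: "(\<lambda>m. \<integral>\<^sup>+x. ennreal \<bar>h m x - V\<^sub>g x\<bar> \<partial>\<mu>) \<longlonglongrightarrow> 0" for h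
  proof -
    have le: "ennreal \<bar>T (h m) \<pi> - T g \<pi>\<bar> \<le> ennreal L * (\<integral>\<^sup>+x. ennreal \<bar>h m x - V\<^sub>g x\<bar> \<partial>\<mu>)" for m
    proof -
      let ?d = "\<lambda>x. 1 * h m x + (-1) * g x"
      have "?d \<in> lip_b E" using h g by (rule lip_b_lincomb)
      then have "ennreal \<bar>T ?d \<pi>\<bar> \<le> ennreal L * (\<integral>\<^sup>+x. ennreal \<bar>?d x\<bar> \<partial>\<mu>)"
        using \<mu> \<pi> unfolding mass_bound_iff_nn L_def by blast
      moreover have "(\<integral>\<^sup>+x. ennreal \<bar>?d x\<bar> \<partial>\<mu>) = (\<integral>\<^sup>+x. ennreal \<bar>h m x - V\<^sub>g x\<bar> \<partial>\<mu>)"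
        using ae by (intro nn_integral_cong_AE) auto
      moreover have "T ?d \<pi> = T (h m) \<pi> - T g \<pi>"
        using functional_lincomb[OF lin h g \<pi>, where a = 1 and b = "-1"] by simp
      ultimately show ?thesis by metis
    qed
    have "(\<lambda>m. ennreal L * (\<integral>\<^sup>+x. ennreal \<bar>h m x - V\<^sub>g x\<bar> \<partial>\<mu>)) \<longlonglongrightarrow> ennreal L * 0"
      using lim by (intro ennreal_tendsto_cmult) auto
    then have up: "(\<lambda>m. ennreal L * (\<integral>\<^sup>+x. ennreal \<bar>h m x - V\<^sub>g x\<bar> \<partial>\<mu>)) \<longlonglongrightarrow> 0"
      by simp
    have "(\<lambda>m. ennreal \<bar>T (h m) \<pi> - T g \<pi>\<bar>) \<longlonglongrightarrow> ennreal 0"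
      unfolding ennreal_0
      by (rule tendsto_sandwich[OF _ _ tendsto_const up]) (use le in auto)
    then have "(\<lambda>m. \<bar>T (h m) \<pi> - T g \<pi>\<bar>) \<longlonglongrightarrow> 0"
      by (subst (asm) tendsto_ennreal_iff) auto
    then have "(\<lambda>m. T (h m) \<pi> - T g \<pi>) \<longlonglongrightarrow> 0"
      by (rule tendsto_rabs_zero_cancel)
    then show ?thesis by (rule LIM_zero_cancel)
  qed
  have const: "(\<lambda>m::nat. \<integral>\<^sup>+x. ennreal \<bar>g x - V\<^sub>g x\<bar> \<partial>\<mu>) \<longlonglongrightarrow> 0"
  proof -
    have "(\<integral>\<^sup>+x. ennreal \<bar>g x - V\<^sub>g x\<bar> \<partial>\<mu>) = (\<integral>\<^sup>+x. 0 \<partial>\<mu>)"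
      using ae by (intro nn_integral_cong_AE) auto
    then show ?thesis by simp
  qed
  show ?thesis
    unfolding restrict_current_def borel_extension_def \<mu>_def[symmetric] V\<^sub>g_def[symmetric]
  proof (rule the_equality)
    show "\<forall>h. (\<forall>m. h m \<in> lip_b E) \<and> (\<lambda>m. \<integral>\<^sup>+x. ennreal \<bar>h m x - V\<^sub>g x\<bar> \<partial>\<mu>) \<longlonglongrightarrow> 0 \<longrightarrow>
        (\<lambda>m. T (h m) \<pi>) \<longlonglongrightarrow> T g \<pi>"
      using 1 by blast
    fix c
    assume "\<forall>h. (\<forall>m. h m \<in> lip_b E) \<and> (\<lambda>m. \<integral>\<^sup>+x. ennreal \<bar>h m x - V\<^sub>g x\<bar> \<partial>\<mu>) \<longlonglongrightarrow> 0 \<longrightarrow>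
        (\<lambda>m. T (h m) \<pi>) \<longlonglongrightarrow> c"
    from this[rule_format, of "\<lambda>_. g"] have "(\<lambda>m::nat. T g \<pi>) \<longlonglongrightarrow> c"
      using g const by simp
    then show "c = T g \<pi>" by (simp add: LIMSEQ_const_iff)
  qed
qed

text \<open>In \<open>S1 - S2 = U + \<partial>V\<close> both terms are controlled by mass: \<open>U\<close> directly, and \<open>\<partial>V\<close> because
  its value at \<open>(F, P)\<close> is the value of \<open>V\<close> at \<open>(1, F # P)\<close>, where \<open>F\<close> enters only through its
  Lipschitz constant.\<close>

lemma flat_dist_bound:
  assumes flat: "flat_dist n Z S1 S2 < ennreal e"
    and F: "lipschitz_le Z K F" "\<And>x. x \<in> mspace Z \<Longrightarrow> \<bar>F x\<bar> \<le> K"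
    and P: "length P = n" "\<And>i. i < n \<Longrightarrow> lipschitz_le Z K (P ! i)"
  shows "\<bar>S1 F P - S2 F P\<bar> \<le> K ^ (n + 1) * e"
proof -
  have K: "0 \<le> K" using F(1) by (rule lipschitz_le_nonneg)
  have topE: "mspace Z \<in> sets (metric_borel Z)"
    by (metis sets.top space_metric_borel)
  obtain U V where UV: "mass n Z U + mass (n + 1) Z V < ennreal e"
    "integral_current n Z U" "integral_current (n + 1) Z V"
    "current_eq n Z (\<lambda>f \<pi>. S1 f \<pi> - S2 f \<pi>) (\<lambda>f \<pi>. U f \<pi> + boundary V f \<pi>)"
    using flat unfolding flat_dist_def Inf_less_iff by blast
  have U: "mass_bound n Z U (mass_measure n Z U)"
    and V: "mass_bound (n + 1) Z V (mass_measure (n + 1) Z V)"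
    using UV(2,3) by (auto intro: mass_bound_mass_measure simp: integral_current_def normal_current_def)
  have mU: "mass n Z U = ennreal (measure (mass_measure n Z U) (mspace Z))"
    and mV: "mass (n + 1) Z V = ennreal (measure (mass_measure (n + 1) Z V) (mspace Z))"
    using U V by (auto simp: mass_def mass_bound_def finite_measure.emeasure_eq_measure)
  have Fb: "F \<in> lip_b Z" using F by (rule lip_bI)
  have Pt: "P \<in> lip_tuples n Z"
    using P lipschitz_le_imp_lip by (auto simp: lip_tuples_conv)
  have 1: "\<bar>U F P\<bar> \<le> K ^ n * (K * measure (mass_measure n Z U) (mspace Z))"
    using current_estimate[OF U Fb F(2) topE _ P K] by simp
  have FP: "lipschitz_le Z K ((F # P) ! i)" if "i < n + 1" for i
    using F(1) P(2) that by (cases i) auto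
  have 2: "\<bar>boundary V F P\<bar> \<le> K ^ (n + 1) * (1 * measure (mass_measure (n + 1) Z V) (mspace Z))"
    unfolding boundary_def
    using current_estimate[OF V lip_b_const[of 1] _ topE _ _ FP K, of 1] P(1) by simp
  have "\<bar>S1 F P - S2 F P\<bar> = \<bar>U F P + boundary V F P\<bar>"
    using UV(4) Fb Pt by (simp add: current_eq_def)
  also have "\<dots> \<le> K ^ (n + 1) * (measure (mass_measure n Z U) (mspace Z) + measure (mass_measure (n + 1) Z V) (mspace Z))"
    using 1 2 by (simp add: algebra_simps)
  also have "\<dots> \<le> K ^ (n + 1) * e"
  proof (rule mult_left_mono)
    have "ennreal (measure (mass_measure n Z U) (mspace Z) + measure (mass_measure (n + 1) Z V) (mspace Z)) < ennreal e"
      using UV(1) unfolding mU mV by simp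
    then show "measure (mass_measure n Z U) (mspace Z) + measure (mass_measure (n + 1) Z V) (mspace Z) \<le> e"
      by (subst (asm) ennreal_less_iff) (auto simp: add_nonneg_nonneg)
  qed (use K in auto)
  finally show ?thesis .
qed

section \<open>Extending isometric embeddings to completions\<close>

lemma limitin_mtopology_of:
  "limitin (mtopology_of E) \<sigma> p F \<longleftrightarrow>
     p \<in> mspace E \<and> (\<forall>\<^sub>F i in F. \<sigma> i \<in> mspace E) \<and> ((\<lambda>i. mdist E (\<sigma> i) p) \<longlongrightarrow> 0) F"
  unfolding mtopology_of_def
  by (rule Metric_space.limitin_metric_dist_null) simp

lemma limitin_mtopology_of_unique:
  "limitin (mtopology_of E) \<sigma> p sequentially \<Longrightarrow> limitin (mtopology_of E) \<sigma> q sequentially \<Longrightarrow> p = q"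
  unfolding mtopology_of_def
  by (rule Metric_space.limitin_metric_unique[of "mspace E" "mdist E" \<sigma> _ sequentially]) auto

lemma closure_sequence:
  assumes "p \<in> mtopology_of E closure_of S"
  obtains \<sigma> where "range \<sigma> \<subseteq> S" "limitin (mtopology_of E) \<sigma> p sequentially"
proof -
  have p: "p \<in> mspace E" "\<And>r. r > 0 \<Longrightarrow> \<exists>y\<in>S. y \<in> mspace E \<and> mdist E p y < r"
    using assms unfolding mtopology_of_def
    by (auto simp: Metric_space.metric_closure_of Metric_space.in_mball)
  have "\<forall>i. \<exists>y. y \<in> S \<and> y \<in> mspace E \<and> mdist E p y < 1 / real (Suc i)"
    using p(2) by (metis of_nat_0_less_iff zero_less_Suc zero_less_divide_1_iff)
  then obtain \<sigma> where \<sigma>: "\<And>i. \<sigma> i \<in> S" "\<And>i. \<sigma> i \<in> mspace E" "\<And>i. mdist E p (\<sigma> i) < 1 / real (Suc i)"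
    by metis
  have "(\<lambda>i. mdist E (\<sigma> i) p) \<longlonglongrightarrow> 0"
  proof (rule tendsto_sandwich[OF _ _ tendsto_const])
    show "\<forall>\<^sub>F i in sequentially. mdist E (\<sigma> i) p \<le> 1 / real (Suc i)"
      using \<sigma>(3) by (intro always_eventually allI) (metis mdist_commute less_imp_le)
    show "(\<lambda>i. 1 / real (Suc i)) \<longlonglongrightarrow> 0" by (rule lim_1_over_n[THEN LIMSEQ_Suc])
  qed auto
  then show thesis
    using \<sigma> p(1) by (intro that[of \<sigma>]) (auto simp: limitin_mtopology_of)
qed

lemma mdist_tendsto:
  assumes a: "limitin (mtopology_of E) a p sequentially" and b: "limitin (mtopology_of E) b q sequentially"
  shows "(\<lambda>i. mdist E (a i) (b i)) \<longlonglongrightarrow> mdist E p q"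
proof -
  have pq: "p \<in> mspace E" "q \<in> mspace E"
    using a b by (auto simp: limitin_mtopology_of)
  have ev: "\<forall>\<^sub>F i in sequentially. a i \<in> mspace E \<and> b i \<in> mspace E"
    using a b by (auto simp: limitin_mtopology_of eventually_conj_iff)
  have "(\<lambda>i. mdist E (a i) p + mdist E (b i) q) \<longlonglongrightarrow> 0 + 0"
    using a b by (intro tendsto_add) (auto simp: limitin_mtopology_of)
  then have lim: "(\<lambda>i. mdist E (a i) p + mdist E (b i) q) \<longlonglongrightarrow> 0"
    by simp
  have "(\<lambda>i. mdist E (a i) (b i) - mdist E p q) \<longlonglongrightarrow> 0"
  proof (rule Lim_null_comparison[OF _ lim])
    show "\<forall>\<^sub>F i in sequentially. norm (mdist E (a i) (b i) - mdist E p q) \<le> mdist E (a i) p + mdist E (b i) q"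
      using ev
    proof eventually_elim
      case (elim i)
      then have i: "a i \<in> mspace E" "b i \<in> mspace E" by auto
      show ?case
        using mdist_triangle[OF i(1) pq(1) i(2)] mdist_triangle[OF pq(1) pq(2) i(2)]
          mdist_triangle[OF pq(1) i(1) pq(2)] mdist_triangle[OF i(1) i(2) pq(2)]
        by (simp add: mdist_commute abs_le_iff)
    qed
  qed
  then show ?thesis by (rule LIM_zero_cancel)
qed

text \<open>The image of a convergent sequence is Cauchy, and the images of two sequences with the same limit
  approach each other; so the description in \<open>completion_extension\<close> determines a point.\<close>

lemma completion_extension_limit:
  assumes dense: "mtopology_of (cs_completion M) closure_of cs_set M = mspace (cs_completion M)"
    and sub: "cs_set M \<subseteq> mspace (cs_completion M)"
    and Z: "mcomplete_of Z" and \<phi>: "metric_isometric_embedding M Z \<phi>"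
    and p: "p \<in> mspace (cs_completion M)"
    and \<sigma>: "range \<sigma> \<subseteq> cs_set M" "limitin (mtopology_of (cs_completion M)) \<sigma> p sequentially"
  shows "limitin (mtopology_of Z) (\<lambda>i. \<phi> (\<sigma> i)) (completion_extension M Z \<phi> p) sequentially"
proof -
  let ?E = "cs_completion M"
  let ?P = "\<lambda>z. \<forall>\<sigma>. range \<sigma> \<subseteq> cs_set M \<and> limitin (mtopology_of ?E) \<sigma> p sequentially
           \<longrightarrow> limitin (mtopology_of Z) (\<lambda>i. \<phi> (\<sigma> i)) z sequentially"
  have \<phi>Z: "\<phi> x \<in> mspace Z" if "x \<in> cs_set M" for x
    using \<phi> that by (auto simp: metric_isometric_embedding_def)
  have iso: "mdist Z (\<phi> x) (\<phi> y) = mdist ?E x y" if "x \<in> cs_set M" "y \<in> cs_set M" for x y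
    using \<phi> that by (auto simp: metric_isometric_embedding_def)
  have \<sigma>': "\<sigma> i \<in> cs_set M" for i using \<sigma>(1) by auto
  interpret E: Metric_space "mspace ?E" "mdist ?E" by simp
  interpret Z: Metric_space "mspace Z" "mdist Z" by simp
  have "E.MCauchy \<sigma>"
    using \<sigma> sub by (intro E.convergent_imp_MCauchy[of \<sigma> p]) (auto simp: mtopology_of_def)
  then have "Z.MCauchy (\<lambda>i. \<phi> (\<sigma> i))"
    using \<phi>Z \<sigma>' by (auto simp: E.MCauchy_def Z.MCauchy_def iso)
  then obtain z where "limitin Z.mtopology (\<lambda>i. \<phi> (\<sigma> i)) z sequentially"
    using Z by (auto simp: mcomplete_of_def Z.mcomplete_def)
  then have z: "limitin (mtopology_of Z) (\<lambda>i. \<phi> (\<sigma> i)) z sequentially"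
    by (simp add: mtopology_of_def)
  then have zZ: "z \<in> mspace Z" by (simp add: limitin_mtopology_of)
  have Pz: "?P z"
  proof (intro allI impI, elim conjE)
    fix \<tau> assume \<tau>: "range \<tau> \<subseteq> cs_set M" "limitin (mtopology_of ?E) \<tau> p sequentially"
    then have \<tau>': "\<tau> i \<in> cs_set M" for i by auto
    have "(\<lambda>i. mdist ?E (\<tau> i) (\<sigma> i)) \<longlonglongrightarrow> mdist ?E p p"
      using \<tau>(2) \<sigma>(2) by (rule mdist_tendsto)
    moreover have "(\<lambda>i. mdist Z (\<phi> (\<sigma> i)) z) \<longlonglongrightarrow> 0"
      using z by (simp add: limitin_mtopology_of)
    ultimately have "(\<lambda>i. mdist ?E (\<tau> i) (\<sigma> i) + mdist Z (\<phi> (\<sigma> i)) z) \<longlonglongrightarrow> mdist ?E p p + 0"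
      by (rule tendsto_add)
    then have lim: "(\<lambda>i. mdist ?E (\<tau> i) (\<sigma> i) + mdist Z (\<phi> (\<sigma> i)) z) \<longlonglongrightarrow> 0"
      using p by simp
    have "(\<lambda>i. mdist Z (\<phi> (\<tau> i)) z) \<longlonglongrightarrow> 0"
    proof (rule tendsto_sandwich[OF _ _ tendsto_const lim])
      show "\<forall>\<^sub>F i in sequentially. mdist Z (\<phi> (\<tau> i)) z \<le> mdist ?E (\<tau> i) (\<sigma> i) + mdist Z (\<phi> (\<sigma> i)) z"
        using mdist_triangle[OF \<phi>Z[OF \<tau>'] \<phi>Z[OF \<sigma>'] zZ] by (simp add: iso \<tau>' \<sigma>')
    qed auto
    then show "limitin (mtopology_of Z) (\<lambda>i. \<phi> (\<tau> i)) z sequentially"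
      using zZ \<phi>Z \<tau>' by (simp add: limitin_mtopology_of)
  qed
  have "completion_extension M Z \<phi> p = z"
    unfolding completion_extension_def
  proof (rule the_equality)
    show "?P z" by (fact Pz)
    fix w assume "?P w"
    then have "limitin (mtopology_of Z) (\<lambda>i. \<phi> (\<sigma> i)) w sequentially"
      using \<sigma> by blast
    then show "w = z" using z by (rule limitin_mtopology_of_unique)
  qed
  then show ?thesis using z by simp
qed

lemma completion_extension_isometry:
  assumes M: "integral_current_space n M"
    and Z: "mcomplete_of Z" and \<phi>: "metric_isometric_embedding M Z \<phi>"
  shows completion_extension_in: "p \<in> mspace (cs_completion M) \<Longrightarrow> completion_extension M Z \<phi> p \<in> mspace Z"
    and completion_extension_dist: "p \<in> mspace (cs_completion M) \<Longrightarrow> q \<in> mspace (cs_completion M) \<Longrightarrow>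
      mdist Z (completion_extension M Z \<phi> p) (completion_extension M Z \<phi> q) = mdist (cs_completion M) p q"
    and completion_extension_eq: "x \<in> cs_set M \<Longrightarrow> completion_extension M Z \<phi> x = \<phi> x"
proof -
  let ?E = "cs_completion M"
  have dense: "mtopology_of ?E closure_of cs_set M = mspace ?E" and sub: "cs_set M \<subseteq> mspace ?E"
    using M by (auto simp: integral_current_space_def)
  note lim = completion_extension_limit[OF dense sub Z \<phi>]
  have "\<exists>\<sigma>. range \<sigma> \<subseteq> cs_set M \<and> limitin (mtopology_of ?E) \<sigma> p sequentially"
    if "p \<in> mspace ?E" for p
    using closure_sequence[of p ?E "cs_set M"] that dense by metis
  then obtain \<sigma> where \<sigma>: "\<And>p. p \<in> mspace ?E \<Longrightarrow> range (\<sigma> p) \<subseteq> cs_set M"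
    "\<And>p. p \<in> mspace ?E \<Longrightarrow> limitin (mtopology_of ?E) (\<sigma> p) p sequentially"
    by metis
  have l: "limitin (mtopology_of Z) (\<lambda>i. \<phi> (\<sigma> p i)) (completion_extension M Z \<phi> p) sequentially"
    if "p \<in> mspace ?E" for p
    using lim[OF that] \<sigma>[OF that] by blast
  show "completion_extension M Z \<phi> p \<in> mspace Z" if "p \<in> mspace ?E"
    using l[OF that] by (simp add: limitin_mtopology_of)
  show "mdist Z (completion_extension M Z \<phi> p) (completion_extension M Z \<phi> q) = mdist ?E p q"
    if p: "p \<in> mspace ?E" and q: "q \<in> mspace ?E"
  proof -
    have "(\<lambda>i. mdist Z (\<phi> (\<sigma> p i)) (\<phi> (\<sigma> q i))) = (\<lambda>i. mdist ?E (\<sigma> p i) (\<sigma> q i))"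
      using \<phi> range_subsetD[OF \<sigma>(1)[OF p]] range_subsetD[OF \<sigma>(1)[OF q]]
      by (simp add: metric_isometric_embedding_def)
    then show ?thesis
      using mdist_tendsto[OF l[OF p] l[OF q]] mdist_tendsto[OF \<sigma>(2)[OF p] \<sigma>(2)[OF q]]
      by (metis LIMSEQ_unique)
  qed
  show "completion_extension M Z \<phi> x = \<phi> x" if x: "x \<in> cs_set M"
  proof -
    have xE: "x \<in> mspace ?E" using x sub by auto
    have "limitin (mtopology_of Z) (\<lambda>i::nat. \<phi> x) (completion_extension M Z \<phi> x) sequentially"
      using x xE by (intro lim[OF xE, of "\<lambda>_. x"]) auto
    moreover have "limitin (mtopology_of Z) (\<lambda>i::nat. \<phi> x) (\<phi> x) sequentially"
      using \<phi> x by (auto simp: metric_isometric_embedding_def)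
    ultimately show ?thesis by (rule limitin_mtopology_of_unique)
  qed
qed

section \<open>Integral currents are concentrated on their set\<close>

lemma low_density_radius:
  assumes p: "p \<in> mspace E" "p \<notin> current_set n E T" and \<eta>: "0 < \<eta>" and r0: "0 < r0"
  shows "\<exists>r>0. r < r0 \<and> emeasure (mass_measure n E T) (mcball_of E p r) < ennreal (\<eta> * r ^ n)"
proof (rule ccontr)
  assume "\<not> ?thesis"
  then have le: "ennreal (\<eta> * r ^ n) \<le> emeasure (mass_measure n E T) (mcball_of E p r)"
    if "0 < r" "r < r0" for r
    using that by (meson not_le)
  have "\<forall>\<^sub>F r in at_right 0. r \<in> {0<..<r0}"
    using r0 by (rule eventually_at_right_real)
  then have "\<forall>\<^sub>F r in at_right 0. ennreal \<eta> \<le>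
      emeasure (mass_measure n E T) (mcball_of E p r) / ennreal (r ^ n)"
  proof eventually_elim
    case (elim r)
    then have r: "0 < r" "r < r0" by auto
    have "ennreal \<eta> = ennreal (\<eta> * r ^ n) / ennreal (r ^ n)"
      using \<eta> r by (subst divide_ennreal) auto
    also have "\<dots> \<le> emeasure (mass_measure n E T) (mcball_of E p r) / ennreal (r ^ n)"
      using le[OF r] by (rule divide_right_mono_ennreal)
    finally show ?case .
  qed
  then have "ennreal \<eta> \<le> Liminf (at_right 0)
      (\<lambda>r. emeasure (mass_measure n E T) (mcball_of E p r) / ennreal (r ^ n))"
    by (rule Liminf_bounded)
  moreover have "0 < ennreal \<eta>" using \<eta> by simp
  ultimately show False
    using p by (auto simp: current_set_def dest: less_le_trans)
qed

subsection \<open>Null sets of Hausdorff measure have Borel hulls\<close>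

text \<open>Replacing the sets of a cover by their closures does not change the Hausdorff content, because
  diameters stay the same.\<close>

lemma ediam_closure_of:
  assumes "C \<subseteq> mspace E"
  shows "ediam E (mtopology_of E closure_of C) = ediam E C"
proof (rule antisym)
  show "ediam E (mtopology_of E closure_of C) \<le> ediam E C"
    unfolding ediam_def[of E "mtopology_of E closure_of C"]
  proof (intro SUP_least)
    fix x y assume x: "x \<in> mtopology_of E closure_of C" and y: "y \<in> mtopology_of E closure_of C"
    obtain \<sigma> where \<sigma>: "range \<sigma> \<subseteq> C" "limitin (mtopology_of E) \<sigma> x sequentially"
      using closure_sequence[OF x] by blast
    obtain \<tau> where \<tau>: "range \<tau> \<subseteq> C" "limitin (mtopology_of E) \<tau> y sequentially"
      using closure_sequence[OF y] by blast
    have lim: "(\<lambda>i. ennreal (mdist E (\<sigma> i) (\<tau> i))) \<longlonglongrightarrow> ennreal (mdist E x y)"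
      using \<sigma>(2) \<tau>(2) by (intro tendsto_ennrealI mdist_tendsto)
    have "ennreal (mdist E (\<sigma> i) (\<tau> i)) \<le> ediam E C" for i
      unfolding ediam_def using \<sigma>(1) \<tau>(1) by (intro SUP_upper2[of "\<sigma> i"] SUP_upper2[of "\<tau> i"]) auto
    then show "ennreal (mdist E x y) \<le> ediam E C"
      by (intro LIMSEQ_le_const2[OF lim] exI allI impI)
  qed
  have "C \<subseteq> mtopology_of E closure_of C"
    using assms by (intro closure_of_subset) simp
  then show "ediam E C \<le> ediam E (mtopology_of E closure_of C)"
    unfolding ediam_def by (meson SUP_subset_mono order_refl)
qed

text \<open>For every \<open>m\<close> there is a cover by closed sets of diameter at most \<open>1 / Suc m\<close> with content below
  \<open>1 / Suc m\<close>. The intersection of these countable unions is Borel and again null.\<close>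

lemma hausdorff_null_hull:
  assumes null: "hausdorff_measure k E A = 0"
  obtains B where "B \<in> sets (metric_borel E)" "A \<subseteq> B" "hausdorff_measure k E B = 0"
proof -
  let ?w = "\<lambda>C. if C = {} then 0 else ennreal (unit_ball_vol (real k)) * (ediam E C / 2) ^ k"
  have "\<exists>C. (\<forall>i::nat. C i \<subseteq> mspace E \<and> ediam E (C i) \<le> ennreal (1 / real (Suc m))) \<and>
      A \<subseteq> (\<Union>i. C i) \<and> (\<Sum>i. ?w (C i)) < ennreal (1 / real (Suc m))" for m
  proof -
    have "hausdorff_pre k E (1 / real (Suc m)) A \<le> hausdorff_measure k E A"
      unfolding hausdorff_measure_def by (rule SUP_upper) simp
    then have "hausdorff_pre k E (1 / real (Suc m)) A < ennreal (1 / real (Suc m))"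
      using null by simp
    then show ?thesis
      unfolding hausdorff_pre_def Inf_less_iff
    proof (elim bexE CollectE exE conjE)
      fix w and C :: "nat \<Rightarrow> 'a set"
      assume "w < ennreal (1 / real (Suc m))" and w: "w = (\<Sum>i. ?w (C i))"
        and C: "\<forall>i. C i \<subseteq> mspace E \<and> ediam E (C i) \<le> ennreal (1 / real (Suc m))" "A \<subseteq> (\<Union>i. C i)"
      then have "(\<Sum>i. ?w (C i)) < ennreal (1 / real (Suc m))" by (simp only: w)
      with C show ?thesis by (intro exI[of _ C] conjI)
    qed
  qed
  then have "\<forall>m. \<exists>C. (\<forall>i::nat. C i \<subseteq> mspace E \<and> ediam E (C i) \<le> ennreal (1 / real (Suc m))) \<and>
      A \<subseteq> (\<Union>i. C i) \<and> (\<Sum>i. ?w (C i)) < ennreal (1 / real (Suc m))" ..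
  then obtain C where C': "\<forall>m. (\<forall>i::nat. C m i \<subseteq> mspace E \<and> ediam E (C m i) \<le> ennreal (1 / real (Suc m))) \<and>
      A \<subseteq> (\<Union>i. C m i) \<and> (\<Sum>i. ?w (C m i)) < ennreal (1 / real (Suc m))"
    by (rule exE[OF choice])
  have C: "\<And>m i. C m i \<subseteq> mspace E" "\<And>m i. ediam E (C m i) \<le> ennreal (1 / real (Suc m))"
    "\<And>m. A \<subseteq> (\<Union>i. C m i)" "\<And>m. (\<Sum>i. ?w (C m i)) < ennreal (1 / real (Suc m))"
    by (simp_all only: C'[rule_format])
  define D where "D m i = mtopology_of E closure_of (C m i)" for m i
  define B where "B = (\<Inter>m. \<Union>i. D m i)"
  have CD: "C m i \<subseteq> D m i" for m i
    unfolding D_def using C(1) by (intro closure_of_subset) simp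
  have DE: "D m i \<subseteq> mspace E" for m i
    unfolding D_def using closure_of_subset_topspace[of "mtopology_of E"] by simp
  have wD: "?w (D m i) = ?w (C m i)" for m i
  proof -
    have "D m i = {} \<longleftrightarrow> C m i = {}"
      unfolding D_def using C(1) by (intro closure_of_eq_empty) simp
    then show ?thesis
      unfolding D_def by (simp add: ediam_closure_of[OF C(1)])
  qed
  have "hausdorff_pre k E \<delta> B = 0" if \<delta>: "\<delta> > 0" for \<delta>
  proof -
    obtain m0 where m0: "1 / real (Suc m0) < \<delta>"
      using nat_approx_posE[OF \<delta>] by metis
    have "hausdorff_pre k E \<delta> B \<le> ennreal (1 / real (Suc m))" if m: "m \<ge> m0" for m
    proof -
      have "1 / real (Suc m) \<le> 1 / real (Suc m0)"
        using m by (intro divide_left_mono) auto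
      then have "ediam E (D m i) \<le> ennreal \<delta>" for i
        unfolding D_def ediam_closure_of[OF C(1)] using C(2)[of m i] m0
        by (meson ennreal_leI less_imp_le order_trans)
      then have "hausdorff_pre k E \<delta> B \<le> (\<Sum>i. ?w (D m i))"
        unfolding hausdorff_pre_def using DE by (intro Inf_lower CollectI exI[of _ "D m"]) (auto simp: B_def)
      also have "\<dots> \<le> ennreal (1 / real (Suc m))"
        unfolding wD using C(4)[of m] by (rule less_imp_le)
      finally show ?thesis .
    qed
    moreover have "(\<lambda>m. ennreal (1 / real (Suc m))) \<longlonglongrightarrow> ennreal 0"
      by (intro tendsto_ennrealI lim_1_over_n[THEN LIMSEQ_Suc])
    ultimately have "hausdorff_pre k E \<delta> B \<le> ennreal 0"
      by (intro LIMSEQ_le_const) auto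
    then show ?thesis by simp
  qed
  then have "hausdorff_measure k E B \<le> 0"
    unfolding hausdorff_measure_def by (intro SUP_least) simp
  then have "hausdorff_measure k E B = 0" by simp
  moreover have "A \<subseteq> B"
  proof
    fix a assume "a \<in> A"
    have "a \<in> (\<Union>i. D m i)" for m
    proof -
      obtain i where "a \<in> C m i" using subsetD[OF C(3) \<open>a \<in> A\<close>, of m] by (rule UN_E)
      then show ?thesis using subsetD[OF CD] by (intro UN_I[of i]) auto
    qed
    then show "a \<in> B" by (simp add: B_def)
  qed
  moreover have "B \<in> sets (metric_borel E)"
  proof -
    have "D m i \<in> sets (metric_borel E)" for m i
      unfolding D_def by (intro closedin_in_metric_borel) simp
    then show ?thesis
      unfolding B_def by (intro sets.countable_INT image_subsetI sets.countable_UN) auto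
  qed
  ultimately show thesis by (intro that[of B])
qed

subsection \<open>A dyadic stopping argument\<close>

text \<open>A dyadic cube of level \<open>m\<close>, with side length \<open>1 / 2 ^ m\<close>, is represented by its integer index
  vector; this function gives the index of the cube containing a point.\<close>

definition dyadic_cube :: "nat \<Rightarrow> nat \<Rightarrow> (nat \<Rightarrow> real) \<Rightarrow> nat \<Rightarrow> int" where
  "dyadic_cube k m a = (\<lambda>i\<in>{..<k}. \<lfloor>2 ^ m * a i\<rfloor>)"

definition dyadic_children :: "nat \<Rightarrow> (nat \<Rightarrow> int) \<Rightarrow> (nat \<Rightarrow> int) set" where
  "dyadic_children k c = Pi\<^sub>E {..<k} (\<lambda>i. {2 * c i, 2 * c i + 1})"

lemma finite_dyadic_children: "finite (dyadic_children k c)"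
  unfolding dyadic_children_def by (intro finite_PiE) auto

lemma card_dyadic_children: "card (dyadic_children k c) = 2 ^ k"
  unfolding dyadic_children_def by (simp add: card_PiE numeral_2_eq_2)

lemma dyadic_Suc_child: "dyadic_cube k (Suc m) a \<in> dyadic_children k (dyadic_cube k m a)"
proof -
  have "\<lfloor>2 * t\<rfloor> \<in> {2 * \<lfloor>t\<rfloor>, 2 * \<lfloor>t\<rfloor> + 1}" for t :: real
    by (auto simp: floor_eq_iff) linarith+
  from this[of "2 ^ m * a i" for i] show ?thesis
    unfolding dyadic_children_def dyadic_cube_def by (auto simp: mult.assoc)
qed

lemma dyadic_eq_imp_close:
  assumes "dyadic_cube k m a = dyadic_cube k m b"
  shows "L2_set (\<lambda>i. a i - b i) {..<k} \<le> real k / 2 ^ m"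
proof -
  have "\<bar>a i - b i\<bar> \<le> 1 / 2 ^ m" if "i < k" for i
  proof -
    have "\<lfloor>2 ^ m * a i\<rfloor> = \<lfloor>2 ^ m * b i\<rfloor>"
      using fun_cong[OF assms, of i] that by (simp add: dyadic_cube_def)
    then have "\<bar>2 ^ m * a i - 2 ^ m * b i\<bar> \<le> 1" by linarith
    then have "2 ^ m * \<bar>a i - b i\<bar> \<le> 1"
      by (metis abs_mult abs_of_pos right_diff_distrib zero_less_numeral zero_less_power)
    then show ?thesis by (simp add: field_simps)
  qed
  then have "(\<Sum>i<k. \<bar>a i - b i\<bar>) \<le> real k * (1 / 2 ^ m)"
    using sum_bounded_above[of "{..<k}" "\<lambda>i. \<bar>a i - b i\<bar>" "1 / 2 ^ m"] by simp
  then show ?thesis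
    using L2_set_le_sum_abs[of "\<lambda>i. a i - b i" "{..<k}"] by simp
qed

text \<open>Call a cube good if its image has a hull of measure at most \<open>b\<close> times the volume of the cube, and
  stop at the first good cube on the way down. The stopped cubes inside a unit cube are
  disjoint, so the hulls have total measure at most \<open>b\<close>. Recursion on the depth
  takes the place of a covering theorem and of Lebesgue measure: a cube has \<open>2 ^ k\<close> children, each with
  \<open>1 / 2 ^ k\<close> of its volume.\<close>

lemma dyadic_stopping:
  fixes \<mu> :: "'a measure" and f :: "(nat \<Rightarrow> real) \<Rightarrow> 'a"
  assumes PA: "P \<subseteq> A" and b: "0 \<le> b"
    and good: "\<And>a. a \<in> P \<Longrightarrow> \<exists>m. \<exists>H\<in>sets \<mu>. f ` {x \<in> A. dyadic_cube k m x = dyadic_cube k m a} \<subseteq> H \<and>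
      emeasure \<mu> H \<le> ennreal (b / 2 ^ (m * k))"
  shows "\<exists>H\<in>sets \<mu>. f ` {a \<in> P. dyadic_cube k 0 a = c} \<subseteq> H \<and> emeasure \<mu> H \<le> ennreal b"
proof -
  define good where "good m c \<longleftrightarrow> (\<exists>H\<in>sets \<mu>. f ` {x \<in> A. dyadic_cube k m x = c} \<subseteq> H \<and>
      emeasure \<mu> H \<le> ennreal (b / 2 ^ (m * k)))" for m c
  define enc where "enc m c = (SOME H. H \<in> sets \<mu> \<and> f ` {x \<in> A. dyadic_cube k m x = c} \<subseteq> H \<and>
      emeasure \<mu> H \<le> ennreal (b / 2 ^ (m * k)))" for m c
  have enc: "enc m c \<in> sets \<mu> \<and> f ` {x \<in> A. dyadic_cube k m x = c} \<subseteq> enc m c \<and>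
      emeasure \<mu> (enc m c) \<le> ennreal (b / 2 ^ (m * k))" if "good m c" for m c
    using that unfolding good_def enc_def Bex_def by (rule someI_ex)
  \<comment> \<open>\<open>H d m c\<close> is the union of the hulls of the cubes inside the cube \<open>c\<close> of level \<open>m\<close> at which
    the process stops within \<open>d\<close> further subdivisions.\<close>
  define H where "H = rec_nat (\<lambda>m c. if good m c then enc m c else {})
    (\<lambda>d R m c. if good m c then enc m c else (\<Union>c'\<in>dyadic_children k c. R (Suc m) c'))"
  have H_0: "H 0 m c = (if good m c then enc m c else {})" for m c
    by (simp add: H_def)
  have H_Suc: "H (Suc d) m c = (if good m c then enc m c else (\<Union>c'\<in>dyadic_children k c. H d (Suc m) c'))"
    for d m c
    by (simp add: H_def)
  have sets: "H d m c \<in> sets \<mu>" for d m c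
  proof (induction d arbitrary: m c)
    case 0
    then show ?case using enc by (simp add: H_0)
  next
    case (Suc d)
    then show ?case
      using enc finite_dyadic_children by (auto simp: H_Suc intro!: sets.finite_UN)
  qed
  have meas: "emeasure \<mu> (H d m c) \<le> ennreal (b / 2 ^ (m * k))" for d m c
  proof (induction d arbitrary: m c)
    case 0
    then show ?case using enc by (simp add: H_0)
  next
    case (Suc d)
    show ?case
    proof (cases "good m c")
      case True
      then show ?thesis using enc by (simp add: H_Suc)
    next
      case False
      then have "emeasure \<mu> (H (Suc d) m c) \<le> (\<Sum>c'\<in>dyadic_children k c. emeasure \<mu> (H d (Suc m) c'))"
        using sets by (simp add: H_Suc) (intro emeasure_subadditive_finite finite_dyadic_children, auto)
      also have "\<dots> \<le> of_nat (card (dyadic_children k c)) * ennreal (b / 2 ^ (Suc m * k))"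
        by (rule sum_bounded_above) (rule Suc.IH)
      also have "\<dots> = ennreal (2 ^ k * (b / 2 ^ (Suc m * k)))"
      proof -
        have "of_nat (card (dyadic_children k c)) = ennreal (2 ^ k)"
          by (simp only: card_dyadic_children ennreal_of_nat_eq_real_of_nat of_nat_power of_nat_numeral)
        then show ?thesis by (simp only: ennreal_mult'[OF zero_le_power[OF zero_le_numeral]])
      qed
      also have "2 ^ k * (b / 2 ^ (Suc m * k)) = b / 2 ^ (m * k)"
        by (simp add: power_add)
      finally show ?thesis .
    qed
  qed
  have mono: "H d m c \<subseteq> H (Suc d) m c" for d m c
  proof (induction d arbitrary: m c)
    case 0
    then show ?case by (auto simp: H_0 H_Suc)
  next
    case (Suc d)
    show ?case
      unfolding H_Suc[of "Suc d" m c] H_Suc[of d m c]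
      by (cases "good m c") (simp, simp only: if_False, intro UN_mono Suc.IH order_refl)
  qed
  have cover: "f a \<in> H d m (dyadic_cube k m a)" if "a \<in> A" "good (m + d) (dyadic_cube k (m + d) a)" for a d m
    using that(2)
  proof (induction d arbitrary: m)
    case 0
    then have "f a \<in> enc m (dyadic_cube k m a)" using enc[of m "dyadic_cube k m a"] that(1) by auto
    then show ?case using 0 by (simp add: H_0)
  next
    case (Suc d)
    show ?case
    proof (cases "good m (dyadic_cube k m a)")
      case True
      then have "f a \<in> enc m (dyadic_cube k m a)" using enc[of m "dyadic_cube k m a"] that(1) by auto
      then show ?thesis using True by (simp add: H_Suc)
    next
      case False
      have "f a \<in> H d (Suc m) (dyadic_cube k (Suc m) a)"
        using Suc.prems by (intro Suc.IH) simp
      then show ?thesis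
        using False dyadic_Suc_child[of k m a] by (auto simp: H_Suc)
    qed
  qed
  show ?thesis
  proof (intro bexI conjI)
    show "(\<Union>d. H d 0 c) \<in> sets \<mu>" using sets by auto
    show "f ` {a \<in> P. dyadic_cube k 0 a = c} \<subseteq> (\<Union>d. H d 0 c)"
    proof clarify
      fix a assume a: "a \<in> P"
      then obtain m where "good m (dyadic_cube k m a)"
        using good unfolding good_def by blast
      then have "f a \<in> H m 0 (dyadic_cube k 0 a)"
        using a PA by (intro cover) auto
      then show "f a \<in> (\<Union>d. H d 0 (dyadic_cube k 0 a))" by blast
    qed
    have "emeasure \<mu> (\<Union>d. H d 0 c) = (SUP d. emeasure \<mu> (H d 0 c))"
      using sets mono by (intro SUP_emeasure_incseq[symmetric] incseq_SucI) auto
    also have "\<dots> \<le> ennreal b"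
      using meas[of _ 0] by (intro SUP_least) simp
    finally show "emeasure \<mu> (\<Union>d. H d 0 c) \<le> ennreal b" .
  qed
qed

text \<open>The ball of radius \<open>r\<close> around \<open>f a\<close> contains the image of a dyadic cube around \<open>a\<close> of
  size comparable to \<open>r\<close>. If the density at \<open>f a\<close> is small at the scale \<open>r\<close>, this ball is a
  hull that makes the cube good, with \<open>b\<close> a fixed multiple of that density.\<close>

lemma low_density_lipschitz_image_null:
  assumes sets: "sets \<mu> = sets (metric_borel E)"
    and A: "A \<subseteq> mspace (euclid k)" and f: "Lipschitz_continuous_map (submetric (euclid k) A) E f"
    and PA: "P \<subseteq> A"
    and low: "\<And>a \<eta> r0. a \<in> P \<Longrightarrow> 0 < \<eta> \<Longrightarrow> 0 < r0 \<Longrightarrow>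
      \<exists>r>0. r < r0 \<and> emeasure \<mu> (mcball_of E (f a) r) < ennreal (\<eta> * r ^ k)"
  shows "\<exists>N\<in>null_sets \<mu>. f ` P \<subseteq> N"
proof -
  have AA: "A \<inter> mspace (euclid k) = A" using A by auto
  obtain L where L: "L > 0" "\<And>x y. x \<in> A \<Longrightarrow> y \<in> A \<Longrightarrow> mdist E (f x) (f y) \<le> L * mdist (euclid k) x y"
    and fE: "\<And>x. x \<in> A \<Longrightarrow> f x \<in> mspace E"
    using f unfolding Lipschitz_continuous_map_pos by (auto simp: AA)
  define K where "K = L * real k + 1"
  have K: "K > 0" using L(1) by (simp add: K_def add_nonneg_pos)
  have step: "\<exists>H\<in>sets \<mu>. f ` {a \<in> P. dyadic_cube k 0 a = c} \<subseteq> H \<and> emeasure \<mu> H \<le> ennreal (\<eta> * (2 * K) ^ k)"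
    if \<eta>: "0 < \<eta>" for \<eta> c
  proof (rule dyadic_stopping[OF PA])
    show "0 \<le> \<eta> * (2 * K) ^ k" using \<eta> K by simp
    fix a assume a: "a \<in> P"
    then have aA: "a \<in> A" using PA by auto
    obtain r where r: "0 < r" "r < K" "emeasure \<mu> (mcball_of E (f a) r) < ennreal (\<eta> * r ^ k)"
      using low[OF a \<eta> K] by blast
    have ex: "\<exists>m. K / 2 ^ m \<le> r"
    proof -
      obtain m where "K / r < 2 ^ m" using real_arch_pow[of 2 "K / r"] by auto
      then show ?thesis using r(1) by (intro exI[of _ m]) (simp add: field_simps)
    qed
    \<comment> \<open>A cube of level \<open>m\<close> has image of diameter at most \<open>K / 2 ^ m\<close>. The largest cube that fits into the
      ball gives \<open>r \<le> 2 * K / 2 ^ m\<close>; it has a predecessor because \<open>r < K\<close>.\<close>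
    define m where "m = (LEAST m. K / 2 ^ m \<le> r)"
    have m: "K / 2 ^ m \<le> r" unfolding m_def using ex by (rule LeastI_ex)
    then have "m \<noteq> 0" using r(2) by (cases m) auto
    then obtain m' where m': "m = Suc m'" by (cases m) auto
    have "\<not> K / 2 ^ m' \<le> r" using not_less_Least[of m' "\<lambda>m. K / 2 ^ m \<le> r"] m' by (simp add: m_def)
    then have r2: "r \<le> 2 * K / 2 ^ m" by (simp add: m')
    show "\<exists>m. \<exists>H\<in>sets \<mu>. f ` {x \<in> A. dyadic_cube k m x = dyadic_cube k m a} \<subseteq> H \<and>
        emeasure \<mu> H \<le> ennreal (\<eta> * (2 * K) ^ k / 2 ^ (m * k))"
    proof (intro exI[of _ m] bexI[of _ "mcball_of E (f a) r"] conjI)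
      show "f ` {x \<in> A. dyadic_cube k m x = dyadic_cube k m a} \<subseteq> mcball_of E (f a) r"
      proof clarify
        fix x assume x: "x \<in> A" "dyadic_cube k m x = dyadic_cube k m a"
        have "mdist E (f a) (f x) \<le> L * mdist (euclid k) a x"
          using aA x(1) by (rule L(2))
        also have "\<dots> \<le> L * (real k / 2 ^ m)"
          using L(1) dyadic_eq_imp_close[of k m a x] x(2) by (intro mult_left_mono) (auto simp: mdist_euclid)
        also have "\<dots> \<le> K / 2 ^ m"
          by (simp add: K_def divide_right_mono)
        also have "\<dots> \<le> r" by (rule m)
        finally show "f x \<in> mcball_of E (f a) r" using fE aA x(1) by simp
      qed
      have "emeasure \<mu> (mcball_of E (f a) r) \<le> ennreal (\<eta> * r ^ k)"
        using r(3) by simp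
      also have "\<eta> * r ^ k \<le> \<eta> * (2 * K / 2 ^ m) ^ k"
        using \<eta> r2 r(1) by (intro mult_left_mono power_mono) auto
      also have "\<eta> * (2 * K / 2 ^ m) ^ k = \<eta> * (2 * K) ^ k / 2 ^ (m * k)"
        by (simp add: power_divide power_mult)
      finally show "emeasure \<mu> (mcball_of E (f a) r) \<le> ennreal (\<eta> * (2 * K) ^ k / 2 ^ (m * k))"
        by (simp add: ennreal_leI)
    qed (simp add: sets)
  qed
  have cell: "\<exists>N\<in>null_sets \<mu>. f ` {a \<in> P. dyadic_cube k 0 a = c} \<subseteq> N" for c
  proof -
    have "\<forall>j. \<exists>H. H \<in> sets \<mu> \<and> f ` {a \<in> P. dyadic_cube k 0 a = c} \<subseteq> H \<and>
        emeasure \<mu> H \<le> ennreal (1 / real (Suc j))"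
    proof
      fix j
      have "0 < 1 / real (Suc j) / (2 * K) ^ k" using K by simp
      from step[OF this, of c] show "\<exists>H. H \<in> sets \<mu> \<and> f ` {a \<in> P. dyadic_cube k 0 a = c} \<subseteq> H \<and>
        emeasure \<mu> H \<le> ennreal (1 / real (Suc j))" using K by auto
    qed
    from choice[OF this] obtain H where H: "\<And>j. H j \<in> sets \<mu>" "\<And>j. f ` {a \<in> P. dyadic_cube k 0 a = c} \<subseteq> H j"
      "\<And>j. emeasure \<mu> (H j) \<le> ennreal (1 / real (Suc j))"
      by auto
    have le: "emeasure \<mu> (\<Inter>j. H j) \<le> ennreal (1 / real (Suc j))" for j
    proof -
      have "emeasure \<mu> (\<Inter>j. H j) \<le> emeasure \<mu> (H j)"
        using H(1) by (intro emeasure_mono) auto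
      also have "\<dots> \<le> ennreal (1 / real (Suc j))" by (rule H(3))
      finally show ?thesis .
    qed
    have "(\<lambda>j. ennreal (1 / real (Suc j))) \<longlonglongrightarrow> ennreal 0"
      by (intro tendsto_ennrealI lim_1_over_n[THEN LIMSEQ_Suc])
    then have "emeasure \<mu> (\<Inter>j. H j) \<le> ennreal 0"
      using le by (intro LIMSEQ_le_const) auto
    moreover have "(\<Inter>j. H j) \<in> sets \<mu>" using H(1) by auto
    ultimately show ?thesis
      using H(2) by (intro bexI[of _ "\<Inter>j. H j"]) (auto simp: null_sets_def)
  qed
  then obtain N where N: "\<And>c. N c \<in> null_sets \<mu>" "\<And>c. f ` {a \<in> P. dyadic_cube k 0 a = c} \<subseteq> N c"
    by metis
  have "countable (Pi\<^sub>E {..<k} (\<lambda>_. UNIV :: int set))"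
    by (intro countable_PiE) auto
  then have "(\<Union>c\<in>Pi\<^sub>E {..<k} (\<lambda>_. UNIV). N c) \<in> null_sets \<mu>"
    using N(1) by (intro null_sets_UN')
  moreover have "f ` P \<subseteq> (\<Union>c\<in>Pi\<^sub>E {..<k} (\<lambda>_. UNIV). N c)"
  proof clarify
    fix a assume "a \<in> P"
    then have "f a \<in> N (dyadic_cube k 0 a)" using N(2)[of "dyadic_cube k 0 a"] by auto
    moreover have "dyadic_cube k 0 a \<in> Pi\<^sub>E {..<k} (\<lambda>_. UNIV)" by (simp add: dyadic_cube_def)
    ultimately show "f a \<in> (\<Union>c\<in>Pi\<^sub>E {..<k} (\<lambda>_. UNIV). N c)" by blast
  qed
  ultimately show ?thesis by blast
qed

text \<open>Outside a null set all points lie on countably many Lipschitz images, up to an Hausdorff-null set whose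
  Borel hull the current does not charge. On each image the points outside the set of
  the current have lower density zero.\<close>

lemma rectifiable_concentrated:
  assumes T: "integer_rectifiable k E T" and k: "k > 0"
  shows "\<exists>N\<in>null_sets (mass_measure k E T). mspace E - current_set k E T \<subseteq> N"
proof -
  define \<mu> where "\<mu> = mass_measure k E T"
  have cur: "metric_current k E T"
    using T by (simp add: integer_rectifiable_def)
  have sets: "sets \<mu> = sets (metric_borel E)"
    using mass_bound_mass_measure[OF cur] by (simp add: mass_bound_def \<mu>_def)
  obtain S where S: "countably_rectifiable k E S" and SN: "\<exists>N\<in>null_sets \<mu>. mspace E - S \<subseteq> N"
    and ac: "\<And>B. B \<in> sets (metric_borel E) \<Longrightarrow> hausdorff_measure k E B = 0 \<Longrightarrow> emeasure \<mu> B = 0"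
    using T k unfolding integer_rectifiable_def \<mu>_def by auto
  obtain N0 where N0: "N0 \<in> null_sets \<mu>" "mspace E - S \<subseteq> N0" using SN by blast
  obtain A f where A: "\<And>i::nat. A i \<subseteq> mspace (euclid k)"
    and f: "\<And>i. Lipschitz_continuous_map (submetric (euclid k) (A i)) E (f i)"
    and null: "hausdorff_measure k E (S - (\<Union>i. f i ` A i)) = 0"
    using S unfolding countably_rectifiable_def by blast
  obtain B where B: "B \<in> sets (metric_borel E)" "S - (\<Union>i. f i ` A i) \<subseteq> B" "hausdorff_measure k E B = 0"
    using hausdorff_null_hull[OF null] by blast
  have BN: "B \<in> null_sets \<mu>"
    using B(1) ac[OF B(1,3)] sets by (simp add: null_sets_def)
  define P where "P i = {a \<in> A i. f i a \<notin> current_set k E T}" for i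
  have "\<exists>N\<in>null_sets \<mu>. f i ` P i \<subseteq> N" for i
  proof (rule low_density_lipschitz_image_null[OF sets A f])
    show "P i \<subseteq> A i" by (auto simp: P_def)
    fix a \<eta> r0 :: real assume "0 < \<eta>" "0 < r0"
    fix a assume a: "a \<in> P i"
    have "f i a \<in> mspace E"
      using Lipschitz_continuous_map_image[OF f[of i]] a A[of i] by (auto simp: P_def)
    moreover have "f i a \<notin> current_set k E T"
      using a by (simp add: P_def)
    ultimately show "\<exists>r>0. r < r0 \<and> emeasure \<mu> (mcball_of E (f i a) r) < ennreal (\<eta> * r ^ k)"
      unfolding \<mu>_def using \<open>0 < \<eta>\<close> \<open>0 < r0\<close> by (rule low_density_radius)
  qed
  then obtain N where N: "\<And>i. N i \<in> null_sets \<mu>" "\<And>i. f i ` P i \<subseteq> N i" by metis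
  have "N0 \<union> B \<union> (\<Union>i. N i) \<in> null_sets \<mu>"
    using N0(1) BN N(1) by (intro null_sets.Un null_sets_UN)
  moreover have "mspace E - current_set k E T \<subseteq> N0 \<union> B \<union> (\<Union>i. N i)"
  proof
    fix p assume p: "p \<in> mspace E - current_set k E T"
    show "p \<in> N0 \<union> B \<union> (\<Union>i. N i)"
    proof (cases "p \<in> S \<and> p \<in> (\<Union>i. f i ` A i)")
      case True
      then obtain i a where "a \<in> A i" "p = f i a" by blast
      then have "p \<in> f i ` P i" using p by (auto simp: P_def)
      then show ?thesis using N(2) by blast
    next
      case False
      then show ?thesis using p N0(2) B(2) by blast
    qed
  qed
  ultimately show ?thesis unfolding \<mu>_def by blast
qed

text \<open>In dimension zero the current is a countable sum of weighted point evaluations. The weights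
  give a mass bound, so the mass measure lives on the countable set of atoms.\<close>

lemma zero_dimensional_concentrated:
  assumes T: "integer_rectifiable 0 E T"
  shows "\<exists>N\<in>null_sets (mass_measure 0 E T). mspace E - current_set 0 E T \<subseteq> N"
proof -
  define \<mu> where "\<mu> = mass_measure 0 E T"
  have cur: "metric_current 0 E T"
    using T by (simp add: integer_rectifiable_def)
  have sets: "sets \<mu> = sets (metric_borel E)"
    using mass_bound_mass_measure[OF cur] by (simp add: mass_bound_def \<mu>_def)
  obtain S and \<theta> :: "'a \<Rightarrow> int" where S: "countable S" "S \<subseteq> mspace E"
    and sum: "(\<lambda>x. real_of_int (\<theta> x)) summable_on S"
    and T_eq: "\<And>f. f \<in> lip_b E \<Longrightarrow> T f [] = (\<Sum>\<^sub>\<infinity>x\<in>S. real_of_int (\<theta> x) * f x)"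
    using T by (auto simp: integer_rectifiable_def)
  have S_sets: "S \<in> sets (metric_borel E)"
  proof (rule sets.countable[OF _ S(1)])
    fix a assume "a \<in> S"
    then have "a \<in> mspace E" using S(2) by auto
    then show "{a} \<in> sets (metric_borel E)" by (rule singleton_in_metric_borel)
  qed
  have int: "integrable (count_space S) (\<lambda>x. real_of_int (\<theta> x))"
    using iffD1[OF summable_on_iff_abs_summable_on_real sum]
    unfolding abs_summable_equivalent Infinite_Set_Sum.abs_summable_on_def .
  define \<nu> where "\<nu> = distr (density (count_space S) (\<lambda>x. ennreal \<bar>real_of_int (\<theta> x)\<bar>)) (metric_borel E) (\<lambda>x. x)"
  have id: "(\<lambda>x. x) \<in> measurable (density (count_space S) (\<lambda>x. ennreal \<bar>real_of_int (\<theta> x)\<bar>)) (metric_borel E)"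
    using S(2) by auto
  have nu_int: "(\<integral>\<^sup>+x. g x \<partial>\<nu>) = (\<integral>\<^sup>+x. ennreal \<bar>real_of_int (\<theta> x)\<bar> * g x \<partial>count_space S)"
    if "g \<in> borel_measurable (metric_borel E)" for g
    unfolding \<nu>_def using id that by (simp add: nn_integral_distr nn_integral_density)
  have "mass_bound 0 E T \<nu>"
    unfolding mass_bound_iff_nn
  proof (intro conjI ballI)
    show "sets \<nu> = sets (metric_borel E)" by (simp add: \<nu>_def)
    show "finite_measure \<nu>"
    proof (rule finite_measureI)
      have "emeasure \<nu> (space \<nu>) = (\<integral>\<^sup>+x. 1 \<partial>\<nu>)" by simp
      also have "\<dots> = (\<integral>\<^sup>+x. ennreal (norm (real_of_int (\<theta> x))) \<partial>count_space S)"
        by (subst nu_int) auto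
      also have "\<dots> < \<infinity>"
        using int by (simp add: integrable_iff_bounded)
      finally show "emeasure \<nu> (space \<nu>) \<noteq> \<infinity>" by simp
    qed
    fix f :: "'a \<Rightarrow> real" and \<pi> assume f: "f \<in> lip_b E" and "\<pi> \<in> lip_tuples 0 E"
    then have \<pi>: "\<pi> = []" by (simp add: lip_tuples_def)
    obtain B where B: "\<And>x. x \<in> mspace E \<Longrightarrow> \<bar>f x\<bar> \<le> B"
      using f by (rule lip_bE) blast
    have "integrable (count_space S) (\<lambda>x. B * real_of_int (\<theta> x))"
      using int by simp
    then have int': "integrable (count_space S) (\<lambda>x. real_of_int (\<theta> x) * f x)"
    proof (rule Bochner_Integration.integrable_bound)
      show "AE x in count_space S. norm (real_of_int (\<theta> x) * f x) \<le> norm (B * real_of_int (\<theta> x))"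
      proof (rule AE_I2)
        fix x assume "x \<in> space (count_space S)"
        then have "\<bar>f x\<bar> \<le> \<bar>B\<bar>" using B[of x] S(2) by auto
        then show "norm (real_of_int (\<theta> x) * f x) \<le> norm (B * real_of_int (\<theta> x))"
          by (simp add: abs_mult mult.commute[of _ "\<bar>f x\<bar>"] mult_right_mono)
      qed
    qed auto
    then have "T f \<pi> = (\<integral>x. real_of_int (\<theta> x) * f x \<partial>count_space S)"
      unfolding \<pi> T_eq[OF f] infsetsum_def[symmetric]
      by (intro infsetsum_infsum[symmetric]) (simp add: Infinite_Set_Sum.abs_summable_on_def)
    then have "ennreal \<bar>T f \<pi>\<bar> \<le> ennreal (\<integral>x. \<bar>real_of_int (\<theta> x) * f x\<bar> \<partial>count_space S)"
      by (intro ennreal_leI) (metis integral_abs_bound)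
    also have "\<dots> = (\<integral>\<^sup>+x. ennreal \<bar>real_of_int (\<theta> x) * f x\<bar> \<partial>count_space S)"
      using int' by (intro nn_integral_eq_integral[symmetric]) auto
    also have "\<dots> = (\<integral>\<^sup>+x. ennreal \<bar>f x\<bar> \<partial>\<nu>)"
    proof -
      have "f \<in> borel_measurable (metric_borel E)"
        using f by (intro lip_imp_measurable) (simp add: lip_b_def)
      then show ?thesis by (subst nu_int) (auto simp: abs_mult ennreal_mult)
    qed
    finally show "ennreal \<bar>T f \<pi>\<bar> \<le> ennreal (prod_list (map (lip_const E) \<pi>)) * (\<integral>\<^sup>+x. ennreal \<bar>f x\<bar> \<partial>\<nu>)"
      by (simp add: \<pi>)
  qed
  moreover have c: "mspace E - S \<in> sets (metric_borel E)"
    using S_sets by (metis sets.compl_sets space_metric_borel)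
  ultimately have "emeasure \<mu> (mspace E - S) \<le> emeasure \<nu> (mspace E - S)"
    unfolding \<mu>_def using cur by (intro mass_measure_le)
  also have "\<dots> = (\<integral>\<^sup>+x. indicator (mspace E - S) x \<partial>\<nu>)"
    using c by (simp add: \<nu>_def)
  also have "\<dots> = (\<integral>\<^sup>+x. ennreal \<bar>real_of_int (\<theta> x)\<bar> * indicator (mspace E - S) x \<partial>count_space S)"
    using c by (intro nu_int) auto
  also have "\<dots> = (\<integral>\<^sup>+x. 0 \<partial>count_space S)"
    by (intro nn_integral_cong) auto
  finally have N1: "mspace E - S \<in> null_sets \<mu>"
    using c sets by (simp add: null_sets_def)
  have N2: "(\<Union>p\<in>S - current_set 0 E T. {p}) \<in> null_sets \<mu>"
  proof (rule null_sets_UN')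
    show "countable (S - current_set 0 E T)" using S(1) by auto
    fix p assume p: "p \<in> S - current_set 0 E T"
    then have pE: "p \<in> mspace E" using S(2) by auto
    have "emeasure \<mu> {p} \<le> 0"
    proof (rule ennreal_le_epsilon)
      fix \<eta> :: real assume "0 < \<eta>"
      have "p \<notin> current_set 0 E T" using p by simp
      from low_density_radius[OF pE this \<open>0 < \<eta>\<close> zero_less_one]
      obtain r where r: "0 < r" "emeasure \<mu> (mcball_of E p r) < ennreal (\<eta> * r ^ 0)"
        unfolding \<mu>_def by blast
      have "emeasure \<mu> {p} \<le> emeasure \<mu> (mcball_of E p r)"
        using pE r(1) sets by (intro emeasure_mono) (auto simp: mdist_refl)
      also have "\<dots> \<le> ennreal \<eta>" using r(2) by simp
      finally show "emeasure \<mu> {p} \<le> 0 + ennreal \<eta>" by simp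
    qed
    then show "{p} \<in> null_sets \<mu>"
      using pE sets by (simp add: null_sets_def singleton_in_metric_borel)
  qed
  have "(mspace E - S) \<union> (\<Union>p\<in>S - current_set 0 E T. {p}) \<in> null_sets \<mu>"
    using N1 N2 by (rule null_sets.Un)
  moreover have "mspace E - current_set 0 E T \<subseteq> (mspace E - S) \<union> (\<Union>p\<in>S - current_set 0 E T. {p})"
    by auto
  ultimately show ?thesis unfolding \<mu>_def by blast
qed

lemma integral_current_concentrated:
  assumes "integral_current n E T"
  shows "\<exists>N\<in>null_sets (mass_measure n E T). mspace E - current_set n E T \<subseteq> N"
  using assms rectifiable_concentrated[of n E T] zero_dimensional_concentrated[of E T]
  by (cases "n = 0") (auto simp: integral_current_def)

section \<open>Transporting test functions\<close>

lemma lipschitz_le_pullback: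
  assumes "lipschitz_le Z K F" "\<And>a. a \<in> mspace E \<Longrightarrow> h a \<in> mspace Z"
    "\<And>a b. a \<in> mspace E \<Longrightarrow> b \<in> mspace E \<Longrightarrow> mdist Z (h a) (h b) = mdist E a b"
  shows "lipschitz_le E K (F \<circ> h)"
  unfolding lipschitz_le_def
proof (intro conjI ballI)
  show "0 \<le> K" using assms(1) by (rule lipschitz_le_nonneg)
  fix x y assume "x \<in> mspace E" "y \<in> mspace E"
  then show "\<bar>(F \<circ> h) x - (F \<circ> h) y\<bar> \<le> K * mdist E x y"
    using lipschitz_leD[OF assms(1) assms(2) assms(2), of x y] assms(3)[of x y] by simp
qed

lemma isometric_preimage_ball_borel:
  assumes z: "z \<in> mspace Z" and h: "\<And>a. a \<in> mspace E \<Longrightarrow> h a \<in> mspace Z"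
    "\<And>a b. a \<in> mspace E \<Longrightarrow> b \<in> mspace E \<Longrightarrow> mdist Z (h a) (h b) = mdist E a b"
  shows "{p \<in> mspace E. mdist Z z (h p) \<le> r} \<in> sets (metric_borel E)"
proof -
  have "lipschitz_le E 1 ((\<lambda>y. mdist Z z y) \<circ> h)"
    using lipschitz_le_dist[OF z] h by (rule lipschitz_le_pullback)
  then have "(\<lambda>p. mdist Z z (h p)) \<in> borel_measurable (metric_borel E)"
    using lip_imp_measurable[OF lipschitz_le_imp_lip] by (simp add: comp_def)
  then have "{p \<in> space (metric_borel E). mdist Z z (h p) \<le> r} \<in> sets (metric_borel E)"
    by measurable
  then show ?thesis by simp
qed

lemma lip_b_pullback:
  assumes F: "lipschitz_le Z K F" "\<And>z. z \<in> mspace Z \<Longrightarrow> \<bar>F z\<bar> \<le> B"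
    and h: "\<And>a. a \<in> mspace E \<Longrightarrow> h a \<in> mspace Z"
      "\<And>a b. a \<in> mspace E \<Longrightarrow> b \<in> mspace E \<Longrightarrow> mdist Z (h a) (h b) = mdist E a b"
  shows "F \<circ> h \<in> lip_b E"
proof (rule lip_bI)
  show "lipschitz_le E K (F \<circ> h)" using F(1) h by (rule lipschitz_le_pullback)
  show "\<bar>(F \<circ> h) a\<bar> \<le> B" if "a \<in> mspace E" for a
    using F(2)[OF h(1)[OF that]] by simp
qed

lemma lip_tuples_pullback:
  assumes P: "length P = n" "\<And>i. i < n \<Longrightarrow> lipschitz_le Z K (P ! i)"
    and h: "\<And>a. a \<in> mspace E \<Longrightarrow> h a \<in> mspace Z"
      "\<And>a b. a \<in> mspace E \<Longrightarrow> b \<in> mspace E \<Longrightarrow> mdist Z (h a) (h b) = mdist E a b"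
  shows "map (\<lambda>p. p \<circ> h) P \<in> lip_tuples n E"
  unfolding lip_tuples_conv
proof (intro conjI allI impI)
  fix i assume i: "i < n"
  have "lipschitz_le E K (P ! i \<circ> h)" using P(2)[OF i] h by (rule lipschitz_le_pullback)
  then show "map (\<lambda>p. p \<circ> h) P ! i \<in> lip E"
    using P(1) i by (simp add: lipschitz_le_imp_lip)
qed (simp add: P(1))

text \<open>The vehicle for comparing currents in different ambient spaces: a test tuple is carried from
  \<open>E\<close> to any space \<open>Z\<close> that contains \<open>E\<close> isometrically. The bound \<open>K\<close> serves for the values and for all
  Lipschitz constants, and the support grows by \<open>\<rho>\<close>.\<close>

lemma transplant_test:
  assumes h: "\<And>a. a \<in> mspace E \<Longrightarrow> h a \<in> mspace Z"
    "\<And>a b. a \<in> mspace E \<Longrightarrow> b \<in> mspace E \<Longrightarrow> mdist Z (h a) (h b) = mdist E a b"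
    and q: "q \<in> mspace E"
    and f: "lipschitz_le E K f" "\<And>a. a \<in> mspace E \<Longrightarrow> \<bar>f a\<bar> \<le> K"
      "\<And>a. a \<in> mspace E \<Longrightarrow> r < mdist E q a \<Longrightarrow> f a = 0"
    and \<pi>: "\<And>i. i < n \<Longrightarrow> lipschitz_le E K (\<pi> ! i)"
    and \<rho>: "0 < \<rho>" "\<rho> \<le> 1"
  obtains F P where "lipschitz_le Z (K / \<rho>) F" "\<And>z. z \<in> mspace Z \<Longrightarrow> \<bar>F z\<bar> \<le> K"
    "\<And>z. z \<in> mspace Z \<Longrightarrow> r + \<rho> \<le> mdist Z (h q) z \<Longrightarrow> F z = 0"
    "\<And>a. a \<in> mspace E \<Longrightarrow> F (h a) = f a"
    "length P = n" "\<And>i. i < n \<Longrightarrow> lipschitz_le Z (K / \<rho>) (P ! i)"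
    "\<And>i a. i < n \<Longrightarrow> a \<in> mspace E \<Longrightarrow> (P ! i) (h a) = (\<pi> ! i) a"
proof -
  have K: "0 \<le> K" using f(1) by (rule lipschitz_le_nonneg)
  have K': "K \<le> K / \<rho>"
    using K \<rho> by (simp add: le_divide_eq mult_left_le)
  have f1: "\<bar>f a - f b\<bar> \<le> K * mdist Z (h a) (h b)" if "a \<in> mspace E" "b \<in> mspace E" for a b
    using lipschitz_leD[OF f(1) that] h(2)[OF that] by simp
  have f2: "f a = 0" if "a \<in> mspace E" "r < mdist Z (h q) (h a)" for a
    using f(3)[OF that(1)] h(2)[OF q that(1)] that(2) by simp
  obtain F where F: "lipschitz_le Z (K / \<rho>) F" "\<And>a. a \<in> mspace E \<Longrightarrow> F (h a) = f a"
    "\<And>x. x \<in> mspace Z \<Longrightarrow> \<bar>F x\<bar> \<le> K" "\<And>x. x \<in> mspace Z \<Longrightarrow> r + \<rho> \<le> mdist Z (h q) x \<Longrightarrow> F x = 0"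
    by (rule localized_extension[where A = "mspace E" and h = h and E = Z and f = f and K = K and r = r,
        OF h(1) f1 K h(1)[OF q] \<rho> f(2) f2]) (assumption+, blast)
  have "\<exists>G. lipschitz_le Z K G \<and> (\<forall>a\<in>mspace E. G (h a) = (\<pi> ! i) a)" if i: "i < n" for i
  proof -
    have "\<bar>(\<pi> ! i) a - (\<pi> ! i) b\<bar> \<le> K * mdist Z (h a) (h b)" if "a \<in> mspace E" "b \<in> mspace E" for a b
      using lipschitz_leD[OF \<pi>[OF i] that] h(2)[OF that] by simp
    from lipschitz_extension[where A = "mspace E" and h = h and E = Z and f = "\<pi> ! i" and K = K, OF h(1) this K]
    show ?thesis by metis
  qed
  then obtain G where G: "\<And>i. i < n \<Longrightarrow> lipschitz_le Z K (G i)"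
    "\<And>i a. i < n \<Longrightarrow> a \<in> mspace E \<Longrightarrow> G i (h a) = (\<pi> ! i) a"
    by metis
  show thesis
  proof (rule that[of F "map G [0..<n]"])
    show "lipschitz_le Z (K / \<rho>) (map G [0..<n] ! i)" if "i < n" for i
      using lipschitz_le_mono[OF G(1)[OF that] K'] that by simp
  qed (use F G(2) in auto)
qed

text \<open>A ball around a point of the closure contains a small ball around a point of the set itself, where
  the positive lower density forces positive mass at all small scales.\<close>

lemma ball_in_support_positive:
  assumes dense: "mtopology_of E closure_of current_set n E T = mspace E"
    and T: "metric_current n E T" and p: "p \<in> mspace E" and r: "0 < r"
  shows "0 < emeasure (mass_measure n E T) (mcball_of E p r)"
proof -
  define \<mu> where "\<mu> = mass_measure n E T"
  have sets: "sets \<mu> = sets (metric_borel E)"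
    using mass_bound_mass_measure[OF T] by (simp add: mass_bound_def \<mu>_def)
  obtain \<sigma> where \<sigma>: "range \<sigma> \<subseteq> current_set n E T" "limitin (mtopology_of E) \<sigma> p sequentially"
    using closure_sequence[of p E "current_set n E T"] p dense by metis
  have "\<forall>\<^sub>F i in sequentially. mdist E (\<sigma> i) p < r / 2"
    using \<sigma>(2) r by (intro order_tendstoD(2)[where y = 0]) (auto simp: limitin_mtopology_of)
  then obtain i where i: "mdist E (\<sigma> i) p < r / 2"
    using eventually_happens' sequentially_bot by blast
  define y where "y = \<sigma> i"
  have y: "y \<in> mspace E" "mdist E p y < r / 2"
    "0 < Liminf (at_right 0) (\<lambda>r. emeasure \<mu> (mcball_of E y r) / ennreal (r ^ n))"
    using \<sigma>(1) i by (auto simp: y_def current_set_def \<mu>_def mdist_commute)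
  have "\<forall>\<^sub>F s in at_right 0. s \<in> {0<..<r / 2}"
    using r by (intro eventually_at_right_real) simp
  moreover have "\<forall>\<^sub>F s in at_right 0. 0 < emeasure \<mu> (mcball_of E y s) / ennreal (s ^ n)"
    using y(3) by (rule less_LiminfD)
  ultimately have "\<forall>\<^sub>F s in at_right 0. s \<in> {0<..<r / 2} \<and> 0 < emeasure \<mu> (mcball_of E y s) / ennreal (s ^ n)"
    by (rule eventually_conj)
  then obtain s where s: "s \<in> {0<..<r / 2}" "0 < emeasure \<mu> (mcball_of E y s) / ennreal (s ^ n)"
    using eventually_happens'[OF trivial_limit_at_right_real] by blast
  have "0 < emeasure \<mu> (mcball_of E y s)"
    using s(2) by (metis ennreal_zero_divide not_gr_zero)
  also have "\<dots> \<le> emeasure \<mu> (mcball_of E p r)"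
  proof (rule emeasure_mono)
    show "mcball_of E y s \<subseteq> mcball_of E p r"
    proof
      fix a assume "a \<in> mcball_of E y s"
      then show "a \<in> mcball_of E p r"
        using s(1) y p mdist_triangle[of p E y a] by auto
    qed
  qed (simp add: sets)
  finally show ?thesis by (simp add: \<mu>_def)
qed

section \<open>Mass near the given points\<close>

text \<open>A fixed test near \<open>x_inf\<close> on which \<open>N_inf\<close> does not vanish travels from \<open>N_inf\<close> to \<open>W\<close>, to \<open>R j\<close>, and
  to \<open>Z\<close>. All bounds along the way are independent of \<open>j\<close>, so the two flat convergences lose only a
  fixed fraction of its value. The last value is bounded by the mass of \<open>M_inf\<close> on the support of
  the test.\<close>

lemma limit_mass_near_points:
  fixes n :: nat
    and M :: "nat \<Rightarrow> 'a current_space" and M_inf :: "'b current_space"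
    and R :: "nat \<Rightarrow> 'a current_space" and N_inf :: "'c current_space"
    and W :: "'w metric" and Z :: "'z metric"
  assumes M: "\<And>j. integral_current_space n (M j)"
    and M_inf: "integral_current_space n M_inf"
    and res: "\<And>j. is_restriction_space n (M j) (V j) (R j)"
    and R: "\<And>j. integral_current_space n (R j)"
    and N: "integral_current_space n N_inf"
    and x_inf: "x_inf \<in> mspace (cs_completion N_inf)"
    and W: "mcomplete_of W"
    and conv_W: "pointed_flat_converges n W R \<psi> x N_inf \<psi>_inf x_inf"
    and ball: "0 < \<delta>" "\<forall>\<^sub>F j in sequentially.
           {y \<in> cs_set (M j). mdist (cs_completion (M j)) (x j) y \<le> \<delta>} \<subseteq> V j"
    and xM: "\<And>j. x j \<in> cs_set (M j)"
    and Z: "mcomplete_of Z"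
    and conv_Z: "flat_converges n Z M \<phi> M_inf \<phi>_inf"
    and \<epsilon>: "0 < \<epsilon>"
  shows "\<exists>c>0. \<forall>\<^sub>F j in sequentially.
    c \<le> measure (mass_measure n (cs_completion M_inf) (cs_current M_inf))
      {p \<in> mspace (cs_completion M_inf). mdist Z (\<phi> j (x j)) (completion_extension M_inf Z \<phi>_inf p) \<le> \<epsilon>}"
proof -
  define E where "E j = cs_completion (M j)" for j
  define ER where "ER j = cs_completion (R j)" for j
  define EN where "EN = cs_completion N_inf"
  define EM where "EM = cs_completion M_inf"
  define \<psi>' where "\<psi>' j = completion_extension (R j) W (\<psi> j)" for j
  define \<phi>' where "\<phi>' j = completion_extension (M j) Z (\<phi> j)" for j
  define \<psi>N where "\<psi>N = completion_extension N_inf W \<psi>_inf"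
  define \<phi>M where "\<phi>M = completion_extension M_inf Z \<phi>_inf"
  define \<mu> where "\<mu> = mass_measure n EM (cs_current M_inf)"
  have cur: "metric_current n (cs_completion L) (cs_current L)" if "integral_current_space n L"
    for L :: "'x current_space"
    using that by (simp add: integral_current_space_def integral_current_def normal_current_def)
  have embW: "metric_isometric_embedding (R j) W (\<psi> j)" "metric_isometric_embedding N_inf W \<psi>_inf"
    and embZ: "metric_isometric_embedding (M j) Z (\<phi> j)" "metric_isometric_embedding M_inf Z \<phi>_inf" for j
    using conv_W conv_Z by (auto simp: pointed_flat_converges_def flat_converges_def)
  have \<psi>'_in: "a \<in> mspace (ER j) \<Longrightarrow> \<psi>' j a \<in> mspace W"
    and \<psi>'_dist: "a \<in> mspace (ER j) \<Longrightarrow> b \<in> mspace (ER j) \<Longrightarrow> mdist W (\<psi>' j a) (\<psi>' j b) = mdist (ER j) a b"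
    and \<psi>'_eq: "a \<in> cs_set (R j) \<Longrightarrow> \<psi>' j a = \<psi> j a" for j a b
    using completion_extension_isometry[OF R W embW(1)] by (auto simp: \<psi>'_def ER_def)
  have \<phi>'_in: "a \<in> mspace (E j) \<Longrightarrow> \<phi>' j a \<in> mspace Z"
    and \<phi>'_dist: "a \<in> mspace (E j) \<Longrightarrow> b \<in> mspace (E j) \<Longrightarrow> mdist Z (\<phi>' j a) (\<phi>' j b) = mdist (E j) a b"
    and \<phi>'_eq: "a \<in> cs_set (M j) \<Longrightarrow> \<phi>' j a = \<phi> j a" for j a b
    using completion_extension_isometry[OF M Z embZ(1)] by (auto simp: \<phi>'_def E_def)
  have \<psi>N_in: "a \<in> mspace EN \<Longrightarrow> \<psi>N a \<in> mspace W"
    and \<psi>N_dist: "a \<in> mspace EN \<Longrightarrow> b \<in> mspace EN \<Longrightarrow> mdist W (\<psi>N a) (\<psi>N b) = mdist EN a b" for a b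
    using completion_extension_isometry[OF N W embW(2)] by (auto simp: \<psi>N_def EN_def)
  have \<phi>M_in: "a \<in> mspace EM \<Longrightarrow> \<phi>M a \<in> mspace Z"
    and \<phi>M_dist: "a \<in> mspace EM \<Longrightarrow> b \<in> mspace EM \<Longrightarrow> mdist Z (\<phi>M a) (\<phi>M b) = mdist EM a b" for a b
    using completion_extension_isometry[OF M_inf Z embZ(2)] by (auto simp: \<phi>M_def EM_def)
  have sub: "mspace (ER j) \<subseteq> mspace (E j)" "mdist (ER j) = mdist (E j)" for j
    using res[of j] by (auto simp: is_restriction_space_def Let_def ER_def E_def)
  have V: "V j \<in> sets (metric_borel (E j))"
    and TR: "current_eq n (E j) (pushforward (\<lambda>x. x) (cs_current (R j)))
      (restrict_current n (E j) (cs_current (M j)) (V j))" for j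
    using res[of j] by (auto simp: is_restriction_space_def Let_def E_def)
  have xR: "x j \<in> cs_set (R j)" for j
    using conv_W by (simp add: pointed_flat_converges_def)
  have xER: "x j \<in> mspace (ER j)" for j
    using xR[of j] R[of j] by (auto simp: integral_current_space_def ER_def)
  then have xE: "x j \<in> mspace (E j)" for j using sub(1) by blast
  have xN: "x_inf \<in> mspace EN" using x_inf by (simp add: EN_def)

  \<comment> \<open>The support of the test has radius \<open>2 * \<rho>\<close> in \<open>N_inf\<close>, \<open>3 * \<rho>\<close> in \<open>W\<close>, \<open>4 * \<rho>\<close> around \<open>x j\<close> in \<open>R j\<close>, since
    \<open>\<psi> j (x j)\<close> comes \<open>\<rho>\<close>-close to the image of \<open>x_inf\<close>, and finally \<open>5 * \<rho>\<close> in \<open>Z\<close>.\<close>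
  define \<rho> where "\<rho> = min 1 (min \<epsilon> \<delta>) / 5"
  have \<rho>: "0 < \<rho>" "\<rho> \<le> 1" "5 * \<rho> \<le> \<epsilon>" "5 * \<rho> \<le> \<delta>"
    using \<epsilon> ball(1) by (auto simp: \<rho>_def)

  have pos: "0 < emeasure (mass_measure n EN (cs_current N_inf)) (mcball_of EN x_inf \<rho>)"
  proof (rule ball_in_support_positive[OF _ _ xN \<rho>(1)])
    show "mtopology_of EN closure_of current_set n EN (cs_current N_inf) = mspace EN"
      using N by (simp add: integral_current_space_def EN_def)
    show "metric_current n EN (cs_current N_inf)"
      unfolding EN_def using N by (rule cur)
  qed
  obtain f \<pi> where f: "f \<in> lip_b EN" and \<pi>: "\<pi> \<in> lip_tuples n EN"
    and nonzero: "cs_current N_inf f \<pi> \<noteq> 0"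
    and f_supp: "\<And>a. a \<in> mspace EN \<Longrightarrow> 2 * \<rho> < mdist EN x_inf a \<Longrightarrow> f a = 0"
    using exists_localized_test[OF cur[OF N] x_inf \<rho>(1)] pos unfolding EN_def by metis
  define \<tau> where "\<tau> = \<bar>cs_current N_inf f \<pi>\<bar>"
  have \<tau>: "0 < \<tau>" using nonzero by (simp add: \<tau>_def)
  obtain K0 B where K0: "lipschitz_le EN K0 f" "\<And>a. a \<in> mspace EN \<Longrightarrow> \<bar>f a\<bar> \<le> B" "0 \<le> B"
    using f by (rule lip_bE) blast
  define K where "K = K0 + B + (\<Sum>i<n. lip_const EN (\<pi> ! i))"
  have lc: "0 \<le> lip_const EN (\<pi> ! i)" if "i < n" for i
    using \<pi> that by (intro lip_const_nonneg) (simp add: lip_tuples_conv)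
  have sum_nonneg: "0 \<le> (\<Sum>i<n. lip_const EN (\<pi> ! i))"
    using lc by (intro sum_nonneg) auto
  have K0_nonneg: "0 \<le> K0" using K0(1) by (rule lipschitz_le_nonneg)
  have fK: "lipschitz_le EN K f"
    using K0 sum_nonneg by (auto simp: K_def intro: lipschitz_le_mono)
  have fB: "\<bar>f a\<bar> \<le> K" if "a \<in> mspace EN" for a
    using K0(2)[OF that] sum_nonneg K0_nonneg by (simp add: K_def)
  have \<pi>K: "lipschitz_le EN K (\<pi> ! i)" if i: "i < n" for i
  proof (rule lipschitz_le_mono)
    show "lipschitz_le EN (lip_const EN (\<pi> ! i)) (\<pi> ! i)"
      using \<pi> i by (intro lipschitz_le_lip_const) (simp add: lip_tuples_conv)
    have "lip_const EN (\<pi> ! i) \<le> (\<Sum>i<n. lip_const EN (\<pi> ! i))"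
      using i lc by (intro member_le_sum) auto
    then show "lip_const EN (\<pi> ! i) \<le> K"
      using K0_nonneg K0(3) by (simp add: K_def)
  qed
  have K: "0 \<le> K" using fK by (rule lipschitz_le_nonneg)

  obtain F P where F: "lipschitz_le W (K / \<rho>) F" "\<And>z. z \<in> mspace W \<Longrightarrow> \<bar>F z\<bar> \<le> K"
    "\<And>z. z \<in> mspace W \<Longrightarrow> 2 * \<rho> + \<rho> \<le> mdist W (\<psi>N x_inf) z \<Longrightarrow> F z = 0"
    "\<And>a. a \<in> mspace EN \<Longrightarrow> F (\<psi>N a) = f a"
    and P: "length P = n" "\<And>i. i < n \<Longrightarrow> lipschitz_le W (K / \<rho>) (P ! i)"
    "\<And>i a. i < n \<Longrightarrow> a \<in> mspace EN \<Longrightarrow> (P ! i) (\<psi>N a) = (\<pi> ! i) a"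
    by (rule transplant_test[where E = EN and h = \<psi>N and Z = W and q = x_inf and K = K and f = f
          and r = "2 * \<rho>" and n = n and \<pi> = \<pi> and \<rho> = \<rho>,
          OF \<psi>N_in \<psi>N_dist xN fK fB f_supp \<pi>K \<rho>(1,2)]) (assumption+, blast)
  \<comment> \<open>Each of the two extensions costs a factor \<open>1 / \<rho>\<close>.\<close>
  define K2 where "K2 = K / \<rho>"
  define K3 where "K3 = K2 / \<rho>"
  have K2: "K \<le> K2" and K2_nonneg: "0 \<le> K2"
    using K \<rho> by (auto simp: K2_def le_divide_eq mult_left_le)
  have K3: "K2 \<le> K3" and K3_nonneg: "0 \<le> K3"
    using K2_nonneg \<rho> by (auto simp: K3_def le_divide_eq mult_left_le)
  note F = F[folded K2_def] and P = P[folded K2_def]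
  have F_K2: "\<bar>F z\<bar> \<le> K2" if "z \<in> mspace W" for z
    using F(2)[OF that] K2 by simp

  have limit_value: "embedded_current N_inf W \<psi>_inf F P = cs_current N_inf f \<pi>"
  proof -
    have "cs_current N_inf (F \<circ> \<psi>N) (map (\<lambda>p. p \<circ> \<psi>N) P) = cs_current N_inf f \<pi>"
    proof (rule functional_cong[OF cur[OF N], folded EN_def])
      show "F \<circ> \<psi>N \<in> lip_b EN"
        by (rule lip_b_pullback[OF F(1,2) \<psi>N_in \<psi>N_dist])
      show "map (\<lambda>p. p \<circ> \<psi>N) P \<in> lip_tuples n EN"
        by (rule lip_tuples_pullback[OF P(1,2) \<psi>N_in \<psi>N_dist])
    qed (use f \<pi> F P in auto)
    then show ?thesis by (simp add: embedded_current_def pushforward_def \<psi>N_def)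
  qed

  \<comment> \<open>A flat distance below \<open>e\<close> changes the value of the test by at most \<open>C * e = \<tau> / 4\<close>. One such
    loss occurs in \<open>W\<close> and one in \<open>Z\<close>, which leaves at least \<open>\<tau> / 2\<close>.\<close>
  define C where "C = K3 ^ (n + 1) + 1"
  have C: "K3 ^ (n + 1) \<le> C" "K2 ^ (n + 1) \<le> C" "0 < C"
  proof -
    show "K3 ^ (n + 1) \<le> C" by (simp add: C_def)
    have "K2 ^ (n + 1) \<le> K3 ^ (n + 1)" using K3 K2_nonneg by (intro power_mono)
    then show "K2 ^ (n + 1) \<le> C" unfolding C_def by linarith
    have "0 \<le> K3 ^ (n + 1)" using K3_nonneg by (intro zero_le_power)
    then show "0 < C" unfolding C_def by linarith
  qed
  define e where "e = \<tau> / (4 * C)"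
  have e: "0 < e" and Ce: "C * e = \<tau> / 4"
    using \<tau> C(3) by (auto simp: e_def)
  define c where "c = \<tau> / (4 * C)"
  have c: "0 < c" using \<tau> C(3) by (simp add: c_def)

  have ev_W: "\<forall>\<^sub>F j in sequentially.
      flat_dist n W (embedded_current (R j) W (\<psi> j)) (embedded_current N_inf W \<psi>_inf) < ennreal e"
    using conv_W e by (intro order_tendstoD(2)[where y = 0]) (auto simp: pointed_flat_converges_def flat_converges_def)
  have ev_Z: "\<forall>\<^sub>F j in sequentially.
      flat_dist n Z (embedded_current (M j) Z (\<phi> j)) (embedded_current M_inf Z \<phi>_inf) < ennreal e"
    using conv_Z e by (intro order_tendstoD(2)[where y = 0]) (auto simp: flat_converges_def)
  have lim_w: "limitin (mtopology_of W) (\<lambda>j. \<psi> j (x j)) (\<psi>N x_inf) sequentially"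
    using conv_W by (simp add: pointed_flat_converges_def \<psi>N_def)
  then have ev_w: "\<forall>\<^sub>F j in sequentially. mdist W (\<psi> j (x j)) (\<psi>N x_inf) < \<rho>"
    using \<rho>(1) by (intro order_tendstoD(2)[where y = 0]) (auto simp: limitin_mtopology_of)

  have "\<forall>\<^sub>F j in sequentially. c \<le> measure \<mu> {p \<in> mspace EM. mdist Z (\<phi> j (x j)) (\<phi>M p) \<le> \<epsilon>}"
    using ev_W ev_Z ev_w ball(2)
  proof eventually_elim
    case (elim j)
    define TR where "TR = cs_current (R j)"
    define TM where "TM = cs_current (M j)"
    have wN: "\<psi>N x_inf \<in> mspace W" using \<psi>N_in xN .
    have value_R: "\<tau> - \<tau> / 4 \<le> \<bar>embedded_current (R j) W (\<psi> j) F P\<bar>"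
    proof -
      have "\<bar>embedded_current (R j) W (\<psi> j) F P - embedded_current N_inf W \<psi>_inf F P\<bar> \<le> K2 ^ (n + 1) * e"
        using flat_dist_bound[OF elim(1) F(1) F_K2 P(1,2)] .
      also have "\<dots> \<le> C * e" using C(2) e by (intro mult_right_mono) auto
      finally show ?thesis unfolding limit_value Ce \<tau>_def by linarith
    qed

    have supp_R: "(F \<circ> \<psi>' j) a = 0" if a: "a \<in> mspace (ER j)" and far: "4 * \<rho> < mdist (ER j) (x j) a" for a
    proof -
      have "mdist W (\<psi>' j (x j)) (\<psi>' j a) \<le> mdist W (\<psi>' j (x j)) (\<psi>N x_inf) + mdist W (\<psi>N x_inf) (\<psi>' j a)"
        using wN \<psi>'_in a xER by (intro mdist_triangle) auto
      then have "3 * \<rho> \<le> mdist W (\<psi>N x_inf) (\<psi>' j a)"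
        using far \<psi>'_dist[OF xER a] elim(3) \<psi>'_eq[OF xR] by simp
      then show ?thesis using F(3)[OF \<psi>'_in[OF a]] by simp
    qed
    have lip_R: "lipschitz_le (ER j) K2 (F \<circ> \<psi>' j)"
      using F(1) \<psi>'_in \<psi>'_dist by (rule lipschitz_le_pullback)
    have bd_R: "\<bar>(F \<circ> \<psi>' j) a\<bar> \<le> K2" if "a \<in> mspace (ER j)" for a
      using F_K2[OF \<psi>'_in[OF that]] by simp
    have lipP_R: "lipschitz_le (ER j) K2 (map (\<lambda>p. p \<circ> \<psi>' j) P ! i)" if "i < n" for i
      using lipschitz_le_pullback[OF P(2)[OF that] \<psi>'_in \<psi>'_dist] P(1) that by simp
    have \<phi>R_in: "\<phi>' j a \<in> mspace Z" if "a \<in> mspace (ER j)" for a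
      using \<phi>'_in sub(1) that by blast
    have \<phi>R_dist: "mdist Z (\<phi>' j a) (\<phi>' j b) = mdist (ER j) a b"
      if "a \<in> mspace (ER j)" "b \<in> mspace (ER j)" for a b
      using \<phi>'_dist sub(1)[of j] sub(2)[of j] that by (metis subsetD)
    obtain G Q where G: "lipschitz_le Z (K2 / \<rho>) G" "\<And>z. z \<in> mspace Z \<Longrightarrow> \<bar>G z\<bar> \<le> K2"
      "\<And>z. z \<in> mspace Z \<Longrightarrow> 4 * \<rho> + \<rho> \<le> mdist Z (\<phi>' j (x j)) z \<Longrightarrow> G z = 0"
      "\<And>a. a \<in> mspace (ER j) \<Longrightarrow> G (\<phi>' j a) = (F \<circ> \<psi>' j) a"
      and Q: "length Q = n" "\<And>i. i < n \<Longrightarrow> lipschitz_le Z (K2 / \<rho>) (Q ! i)"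
      "\<And>i a. i < n \<Longrightarrow> a \<in> mspace (ER j) \<Longrightarrow> (Q ! i) (\<phi>' j a) = (map (\<lambda>p. p \<circ> \<psi>' j) P ! i) a"
      by (rule transplant_test[where E = "ER j" and h = "\<phi>' j" and Z = Z and q = "x j" and K = K2
          and f = "F \<circ> \<psi>' j" and r = "4 * \<rho>" and n = n and \<pi> = "map (\<lambda>p. p \<circ> \<psi>' j) P" and \<rho> = \<rho>,
          OF \<phi>R_in \<phi>R_dist xER lip_R bd_R supp_R lipP_R \<rho>(1,2)]) (assumption+, blast)
    note G = G[folded K3_def] and Q = Q[folded K3_def]
    have G_K3: "\<bar>G z\<bar> \<le> K3" if "z \<in> mspace Z" for z
      using G(2)[OF that] K3 by simp
    define g where "g = G \<circ> \<phi>' j"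
    define q where "q = map (\<lambda>p. p \<circ> \<phi>' j) Q"
    have g: "g \<in> lip_b (E j)"
      unfolding g_def by (rule lip_b_pullback[OF G(1,2) \<phi>'_in \<phi>'_dist])
    have q: "q \<in> lip_tuples n (E j)"
      unfolding q_def by (rule lip_tuples_pullback[OF Q(1,2) \<phi>'_in \<phi>'_dist])

    have "TR (F \<circ> \<psi>' j) (map (\<lambda>p. p \<circ> \<psi>' j) P) = TR g q"
      unfolding TR_def
    proof (rule functional_cong[OF cur[OF R], folded ER_def])
      show "F \<circ> \<psi>' j \<in> lip_b (ER j)"
        using lip_R bd_R by (rule lip_bI)
      show "map (\<lambda>p. p \<circ> \<psi>' j) P \<in> lip_tuples n (ER j)"
        using lipP_R P(1) by (auto simp: lip_tuples_conv intro: lipschitz_le_imp_lip)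
      show "g \<in> lip_b (ER j)"
        unfolding g_def by (rule lip_b_pullback[OF G(1,2) \<phi>R_in \<phi>R_dist])
      show "q \<in> lip_tuples n (ER j)"
        unfolding q_def by (rule lip_tuples_pullback[OF Q(1,2) \<phi>R_in \<phi>R_dist])
      show "(F \<circ> \<psi>' j) a = g a" if "a \<in> mspace (ER j)" for a
        using G(4)[OF that] by (simp add: g_def)
      show "(map (\<lambda>p. p \<circ> \<psi>' j) P ! i) a = (q ! i) a" if "i < n" "a \<in> mspace (ER j)" for i a
        using Q(3)[OF that] that(1) Q(1) by (simp add: q_def)
    qed
    also have "TR g q = restrict_current n (E j) TM (V j) g q"
      using TR[of j] g q unfolding current_eq_def pushforward_def TR_def TM_def by (simp add: comp_def)
    also have "\<dots> = TM g q"
    proof -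
      have "integral_current n (E j) TM" and set: "current_set n (E j) TM = cs_set (M j)"
        using M[of j] by (auto simp: integral_current_space_def E_def TM_def)
      then obtain N0 where N0: "N0 \<in> null_sets (mass_measure n (E j) TM)" "mspace (E j) - cs_set (M j) \<subseteq> N0"
        using integral_current_concentrated by metis
      show ?thesis
      proof (rule restrict_current_eq[OF _ V g q N0(1)])
        show "metric_current n (E j) TM"
          unfolding E_def TM_def using M by (rule cur)
        fix a assume a: "a \<in> mspace (E j)" "g a \<noteq> 0" "a \<notin> V j"
        have "\<not> 5 * \<rho> \<le> mdist Z (\<phi>' j (x j)) (\<phi>' j a)"
          using G(3)[OF \<phi>'_in[OF a(1)]] a(2) by (auto simp: g_def)
        then have "mdist (E j) (x j) a \<le> \<delta>"
          using \<phi>'_dist[OF xE a(1)] \<rho>(4) by simp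
        then have "a \<notin> cs_set (M j)"
          using elim(4) a(3) by (auto simp: E_def)
        then show "a \<in> N0" using a(1) N0(2) by blast
      qed
    qed
    finally have same: "embedded_current (R j) W (\<psi> j) F P = embedded_current (M j) Z (\<phi> j) G Q"
      by (simp add: embedded_current_def pushforward_def TR_def TM_def g_def q_def \<psi>'_def \<phi>'_def)

    have value_M: "\<tau> / 2 \<le> \<bar>embedded_current M_inf Z \<phi>_inf G Q\<bar>"
    proof -
      have "\<bar>embedded_current (M j) Z (\<phi> j) G Q - embedded_current M_inf Z \<phi>_inf G Q\<bar> \<le> K3 ^ (n + 1) * e"
        using flat_dist_bound[OF elim(2) G(1) G_K3 Q(1,2)] .
      also have "\<dots> \<le> C * e" using C(1) e by (intro mult_right_mono) auto
      finally show ?thesis using value_R unfolding same Ce by linarith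
    qed

    define A where "A = {p \<in> mspace EM. mdist Z (\<phi> j (x j)) (\<phi>M p) \<le> \<epsilon>}"
    have zZ: "\<phi> j (x j) \<in> mspace Z" and z_eq: "\<phi>' j (x j) = \<phi> j (x j)"
      using \<phi>'_in[OF xE] \<phi>'_eq[OF xM] by simp_all
    have A: "A \<in> sets (metric_borel EM)"
      unfolding A_def using zZ \<phi>M_in \<phi>M_dist by (rule isometric_preimage_ball_borel)
    have "\<bar>cs_current M_inf (G \<circ> \<phi>M) (map (\<lambda>p. p \<circ> \<phi>M) Q)\<bar> \<le> K3 ^ n * (K3 * measure \<mu> A)"
    proof (rule current_estimate[where T = "cs_current M_inf" and f = "G \<circ> \<phi>M" and E = EM and \<mu> = \<mu>, OF _ _ _ A])
      show "mass_bound n EM (cs_current M_inf) \<mu>"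
        unfolding \<mu>_def EM_def using cur[OF M_inf] by (rule mass_bound_mass_measure)
      show "G \<circ> \<phi>M \<in> lip_b EM"
        by (rule lip_b_pullback[OF G(1,2) \<phi>M_in \<phi>M_dist])
      show "\<bar>(G \<circ> \<phi>M) p\<bar> \<le> K3" if "p \<in> mspace EM" for p
        using G_K3[OF \<phi>M_in[OF that]] by simp
      show "(G \<circ> \<phi>M) p = 0" if "p \<in> mspace EM" "p \<notin> A" for p
        using G(3)[OF \<phi>M_in[OF that(1)]] that \<rho>(3) by (simp add: A_def z_eq)
      show "lipschitz_le EM K3 (map (\<lambda>p. p \<circ> \<phi>M) Q ! i)" if "i < n" for i
        using lipschitz_le_pullback[OF Q(2)[OF that] \<phi>M_in \<phi>M_dist] that Q(1) by simp
    qed (use Q(1) K3_nonneg in auto)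
    then have "\<tau> / 2 \<le> K3 ^ (n + 1) * measure \<mu> A"
      using value_M by (simp add: embedded_current_def pushforward_def \<phi>M_def algebra_simps)
    also have "\<dots> \<le> C * measure \<mu> A"
      using C(1) by (intro mult_right_mono) auto
    finally have "\<tau> / 2 / C \<le> measure \<mu> A"
      using C(3) by (simp add: divide_le_eq mult_ac)
    moreover have "c \<le> \<tau> / 2 / C"
      unfolding c_def using \<tau> C(3) by (simp add: field_simps)
    ultimately show ?case by (simp add: A_def)
  qed
  then show ?thesis
    unfolding \<mu>_def EM_def \<phi>M_def using c by blast
qed

section \<open>Convergence of a subsequence\<close>

text \<open>Balls of radius \<open>\<epsilon>\<close> around points at mutual distance more than \<open>2 * \<epsilon>\<close> are disjoint, so the
  total mass bounds the size of a separated family, and a separated family of maximal size is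
  a net.\<close>

lemma definite_mass_imp_finite_net:
  fixes z :: "nat \<Rightarrow> 'z" and \<mu> :: "'b measure"
  assumes fin: "finite_measure \<mu>" and c: "0 < c" and \<epsilon>: "0 < \<epsilon>"
    and h: "\<And>p. p \<in> space \<mu> \<Longrightarrow> h p \<in> mspace Z" and z: "\<And>j. z j \<in> mspace Z"
    and B: "\<And>j. {p \<in> space \<mu>. mdist Z (z j) (h p) \<le> \<epsilon>} \<in> sets \<mu>"
    and lower: "\<And>j. J \<le> j \<Longrightarrow> c \<le> measure \<mu> {p \<in> space \<mu>. mdist Z (z j) (h p) \<le> \<epsilon>}"
  shows "\<exists>I. finite I \<and> (\<forall>j\<ge>J. \<exists>i\<in>I. mdist Z (z i) (z j) \<le> 2 * \<epsilon>)"
proof -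
  interpret finite_measure \<mu> by fact
  define sep where "sep I \<longleftrightarrow> finite I \<and> I \<subseteq> {J..} \<and> (\<forall>i\<in>I. \<forall>j\<in>I. i \<noteq> j \<longrightarrow> 2 * \<epsilon> < mdist Z (z i) (z j))" for I
  define b where "b j = {p \<in> space \<mu>. mdist Z (z j) (h p) \<le> \<epsilon>}" for j
  have disj: "b i \<inter> b j = {}" if "2 * \<epsilon> < mdist Z (z i) (z j)" for i j
  proof (rule ccontr)
    assume "b i \<inter> b j \<noteq> {}"
    then obtain p where p: "p \<in> space \<mu>" "mdist Z (z i) (h p) \<le> \<epsilon>" "mdist Z (z j) (h p) \<le> \<epsilon>"
      by (auto simp: b_def)
    then show False
      using that mdist_triangle[OF z h[OF p(1)] z, of i j] by (simp add: mdist_commute)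
  qed
  have card: "real (card I) * c \<le> measure \<mu> (space \<mu>)" if I: "sep I" for I
  proof -
    have "real (card I) * c \<le> (\<Sum>i\<in>I. measure \<mu> (b i))"
      using I lower by (intro sum_bounded_below) (auto simp: sep_def b_def)
    also have "\<dots> = measure \<mu> (\<Union>i\<in>I. b i)"
      using I B disj by (intro finite_measure_finite_Union[symmetric])
        (auto simp: sep_def b_def disjoint_family_on_def)
    also have "\<dots> \<le> measure \<mu> (space \<mu>)"
      by (rule bounded_measure)
    finally show ?thesis .
  qed
  define m where "m = nat \<lceil>measure \<mu> (space \<mu>) / c\<rceil> + 1"
  have "card I < m" if "sep I" for I
  proof -
    have "real (card I) \<le> measure \<mu> (space \<mu>) / c"
      using card[OF that] c by (simp add: le_divide_eq)
    then show ?thesis unfolding m_def by linarith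
  qed
  moreover have "sep {}" by (simp add: sep_def)
  ultimately obtain I where I: "sep I" "\<And>I'. sep I' \<Longrightarrow> card I' \<le> card I"
    using ex_has_greatest_nat[of sep "{}" card m] by auto
  have "\<exists>i\<in>I. mdist Z (z i) (z j) \<le> 2 * \<epsilon>" if j: "J \<le> j" "j \<notin> I" for j
  proof (rule ccontr)
    assume "\<not> ?thesis"
    then have "sep (insert j I)"
      using I(1) j by (auto simp: sep_def mdist_commute not_le)
    from I(2)[OF this] show False
      using I(1) j(2) by (simp add: sep_def)
  qed
  moreover have "mdist Z (z j) (z j) \<le> 2 * \<epsilon>" for j
    using mdist_refl[OF z] \<epsilon> by simp
  ultimately have "\<forall>j\<ge>J. \<exists>i\<in>I. mdist Z (z i) (z j) \<le> 2 * \<epsilon>"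
    by metis
  then show ?thesis
    using I(1) unfolding sep_def by blast
qed

theorem theorem2p9:
  fixes n :: nat
    and M :: "nat \<Rightarrow> 'a current_space" and M_inf :: "'b current_space"
    and V :: "nat \<Rightarrow> 'a set" and x :: "nat \<Rightarrow> 'a"
    and R :: "nat \<Rightarrow> 'a current_space"
    and N_inf :: "'c current_space" and x_inf :: 'c
    and W :: "'w metric" and \<psi> :: "nat \<Rightarrow> 'a \<Rightarrow> 'w" and \<psi>_inf :: "'c \<Rightarrow> 'w"
    and Z :: "'z metric" and \<phi> :: "nat \<Rightarrow> 'a \<Rightarrow> 'z" and \<phi>_inf :: "'b \<Rightarrow> 'z"
  assumes "\<And>j. integral_current_space n (M j)"
    and "integral_current_space n M_inf"
    and "\<And>j. V j \<subseteq> cs_set (M j)"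
    and "\<And>j. x j \<in> V j"
    and "\<And>j. is_restriction_space n (M j) (V j) (R j)"
    and "\<And>j. integral_current_space n (R j)"
    and "integral_current_space n N_inf"
    and "x_inf \<in> mspace (cs_completion N_inf)"
    and "separable_complete W"
    and "pointed_flat_converges n W R \<psi> x N_inf \<psi>_inf x_inf"
    and "\<exists>\<delta>>0. \<forall>\<^sub>F j in sequentially.
           {y \<in> cs_set (M j). mdist (cs_completion (M j)) (x j) y \<le> \<delta>} \<subseteq> V j"
    and "separable_complete Z"
    and "flat_converges n Z M \<phi> M_inf \<phi>_inf"
  shows "\<exists>(r :: nat \<Rightarrow> nat) x'. strict_mono r \<and> x' \<in> mspace (cs_completion M_inf) \<and>
           pointed_flat_converges n Z (M \<circ> r) (\<phi> \<circ> r) (x \<circ> r) M_inf \<phi>_inf x'"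
proof -
  define E where "E = cs_completion M_inf"
  define \<mu> where "\<mu> = mass_measure n E (cs_current M_inf)"
  define \<phi>M where "\<phi>M = completion_extension M_inf Z \<phi>_inf"
  define z where "z j = \<phi> j (x j)" for j
  have W: "mcomplete_of W" and Z: "mcomplete_of Z"
    using assms(9,12) by (auto simp: separable_complete_def)
  obtain \<delta> where \<delta>: "0 < \<delta>" "\<forall>\<^sub>F j in sequentially.
           {y \<in> cs_set (M j). mdist (cs_completion (M j)) (x j) y \<le> \<delta>} \<subseteq> V j"
    using assms(11) by blast
  have xM: "x j \<in> cs_set (M j)" for j
    using assms(3,4) by blast
  have emb: "metric_isometric_embedding (M j) Z (\<phi> j)" "metric_isometric_embedding M_inf Z \<phi>_inf" for j
    using assms(13) by (auto simp: flat_converges_def)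
  have zZ: "z j \<in> mspace Z" for j
    using emb(1)[of j] xM[of j] by (auto simp: z_def metric_isometric_embedding_def)
  have complete: "mcomplete_of E"
    using assms(2) by (simp add: integral_current_space_def E_def)
  have \<phi>M_in: "a \<in> mspace E \<Longrightarrow> \<phi>M a \<in> mspace Z"
    and \<phi>M_dist: "a \<in> mspace E \<Longrightarrow> b \<in> mspace E \<Longrightarrow> mdist Z (\<phi>M a) (\<phi>M b) = mdist E a b" for a b
    using completion_extension_isometry[OF assms(2) Z emb(2)] by (auto simp: \<phi>M_def E_def)
  have \<mu>: "sets \<mu> = sets (metric_borel E)" "finite_measure \<mu>"
    using mass_bound_mass_measure[of n E "cs_current M_inf"] assms(2)
    by (auto simp: mass_bound_def \<mu>_def E_def integral_current_space_def integral_current_def normal_current_def)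
  have space: "space \<mu> = mspace E"
    using \<mu>(1) by (metis sets_eq_imp_space_eq space_metric_borel)
  have near: "\<exists>c>0. \<forall>\<^sub>F j in sequentially. c \<le> measure \<mu> {p \<in> mspace E. mdist Z (z j) (\<phi>M p) \<le> \<epsilon>}"
    if \<epsilon>: "0 < \<epsilon>" for \<epsilon>
    unfolding z_def \<mu>_def E_def \<phi>M_def
    by (rule limit_mass_near_points[OF assms(1,2,5,6,7,8) W assms(10) \<delta> xM Z assms(13) \<epsilon>])
  have meas: "{p \<in> mspace E. mdist Z (z j) (\<phi>M p) \<le> \<epsilon>} \<in> sets \<mu>" for j \<epsilon>
    unfolding \<mu>(1) using zZ \<phi>M_in \<phi>M_dist by (rule isometric_preimage_ball_borel)

  interpret Z: Metric_space "mspace Z" "mdist Z" by simp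
  have "Z.mtotally_bounded (range z)"
    unfolding Z.mtotally_bounded_def
  proof (intro allI impI)
    fix \<epsilon> :: real assume \<epsilon>: "0 < \<epsilon>"
    obtain c J where c: "0 < c" "\<And>j. J \<le> j \<Longrightarrow> c \<le> measure \<mu> {p \<in> mspace E. mdist Z (z j) (\<phi>M p) \<le> \<epsilon> / 3}"
      using near[of "\<epsilon> / 3"] \<epsilon> unfolding eventually_sequentially by auto
    have "\<exists>I. finite I \<and> (\<forall>j\<ge>J. \<exists>i\<in>I. mdist Z (z i) (z j) \<le> 2 * (\<epsilon> / 3))"
    proof (rule definite_mass_imp_finite_net[where h = \<phi>M, OF \<mu>(2) c(1)], unfold space)
      show "0 < \<epsilon> / 3" using \<epsilon> by simp
    qed (fact \<phi>M_in zZ meas c(2))+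
    then obtain I where I: "finite I" "\<And>j. J \<le> j \<Longrightarrow> \<exists>i\<in>I. mdist Z (z i) (z j) \<le> 2 * (\<epsilon> / 3)"
      by blast
    have "\<exists>i\<in>{..<J} \<union> I. z j \<in> Z.mball (z i) \<epsilon>" for j
    proof (cases "J \<le> j")
      case True
      then obtain i where "i \<in> I" "mdist Z (z i) (z j) \<le> 2 * (\<epsilon> / 3)" using I(2) by blast
      then show ?thesis using zZ \<epsilon> by (intro bexI[of _ i]) (auto simp: Z.in_mball)
    next
      case False
      then show ?thesis using zZ \<epsilon> by (intro bexI[of _ j]) auto
    qed
    then have cover: "range z \<subseteq> (\<Union>y\<in>z ` ({..<J} \<union> I). Z.mball y \<epsilon>)"
      by blast
    show "\<exists>K. finite K \<and> K \<subseteq> range z \<and> range z \<subseteq> (\<Union>y\<in>K. Z.mball y \<epsilon>)"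
      using I(1) by (intro exI[of _ "z ` ({..<J} \<union> I)"] conjI cover) auto
  qed
  then obtain r where r: "strict_mono r" "Z.MCauchy (z \<circ> r)"
    unfolding Z.mtotally_bounded_sequentially by blast
  then obtain y where "limitin Z.mtopology (z \<circ> r) y sequentially"
    using Z unfolding mcomplete_of_def Z.mcomplete_def by blast
  then have y: "limitin (mtopology_of Z) (z \<circ> r) y sequentially"
    by (simp add: mtopology_of_def)
  then have yZ: "y \<in> mspace Z" and lim0: "(\<lambda>i. mdist Z (z (r i)) y) \<longlonglongrightarrow> 0"
    by (auto simp: limitin_mtopology_of)

  \<comment> \<open>A set of positive measure is not empty, so points of the completion of \<open>M_inf\<close> come
    arbitrarily close to \<open>y\<close>.\<close>
  have approx: "\<exists>p. p \<in> mspace E \<and> mdist Z (\<phi>M p) y < \<epsilon>" if \<epsilon>: "0 < \<epsilon>" for \<epsilon>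
  proof -
    obtain c where c: "0 < c" "\<forall>\<^sub>F j in sequentially. c \<le> measure \<mu> {p \<in> mspace E. mdist Z (z j) (\<phi>M p) \<le> \<epsilon> / 2}"
      using near[of "\<epsilon> / 2"] \<epsilon> by auto
    have "\<forall>\<^sub>F i in sequentially. c \<le> measure \<mu> {p \<in> mspace E. mdist Z (z (r i)) (\<phi>M p) \<le> \<epsilon> / 2}"
      using c(2) filterlim_subseq[OF r(1)] by (rule eventually_compose_filterlim)
    moreover have "\<forall>\<^sub>F i in sequentially. mdist Z (z (r i)) y < \<epsilon> / 2"
      using lim0 \<epsilon> by (intro order_tendstoD(2)[where y = 0]) auto
    ultimately have "\<forall>\<^sub>F i in sequentially. c \<le> measure \<mu> {p \<in> mspace E. mdist Z (z (r i)) (\<phi>M p) \<le> \<epsilon> / 2} \<and>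
        mdist Z (z (r i)) y < \<epsilon> / 2"
      by (rule eventually_conj)
    then obtain i where i: "c \<le> measure \<mu> {p \<in> mspace E. mdist Z (z (r i)) (\<phi>M p) \<le> \<epsilon> / 2}"
      "mdist Z (z (r i)) y < \<epsilon> / 2"
      using eventually_happens' sequentially_bot by blast
    have "{p \<in> mspace E. mdist Z (z (r i)) (\<phi>M p) \<le> \<epsilon> / 2} \<noteq> {}"
    proof
      assume "{p \<in> mspace E. mdist Z (z (r i)) (\<phi>M p) \<le> \<epsilon> / 2} = {}"
      then show False using i(1) c(1) by (simp only: measure_empty)
    qed
    then obtain p where p: "p \<in> mspace E" "mdist Z (z (r i)) (\<phi>M p) \<le> \<epsilon> / 2" by blast
    have "mdist Z (\<phi>M p) y \<le> mdist Z (\<phi>M p) (z (r i)) + mdist Z (z (r i)) y"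
      using \<phi>M_in[OF p(1)] zZ yZ by (rule mdist_triangle)
    then show ?thesis using p i(2) by (intro exI[of _ p]) (simp add: mdist_commute)
  qed
  have "\<forall>i. \<exists>p. p \<in> mspace E \<and> mdist Z (\<phi>M p) y < 1 / real (Suc i)"
    using approx by simp
  then obtain p where p: "\<And>i. p i \<in> mspace E" "\<And>i. mdist Z (\<phi>M (p i)) y < 1 / real (Suc i)"
    by metis
  have "(\<lambda>i. mdist Z (\<phi>M (p i)) y) \<longlonglongrightarrow> 0"
  proof (rule tendsto_sandwich[OF _ _ tendsto_const])
    show "\<forall>\<^sub>F i in sequentially. mdist Z (\<phi>M (p i)) y \<le> 1 / real (Suc i)"
      using p(2) by (intro always_eventually allI less_imp_le)
    show "(\<lambda>i. 1 / real (Suc i)) \<longlonglongrightarrow> 0" by (rule lim_1_over_n[THEN LIMSEQ_Suc])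
  qed auto
  then have lim_p: "limitin (mtopology_of Z) (\<lambda>i. \<phi>M (p i)) y sequentially"
    using yZ p(1) \<phi>M_in by (simp add: limitin_mtopology_of)
  interpret E: Metric_space "mspace E" "mdist E" by simp
  have "Z.MCauchy (\<lambda>i. \<phi>M (p i))"
    using lim_p p(1) \<phi>M_in by (intro Z.convergent_imp_MCauchy[of _ y]) (auto simp: mtopology_of_def)
  then have "E.MCauchy p"
    using p(1) by (auto simp: E.MCauchy_def Z.MCauchy_def \<phi>M_dist)
  then obtain x' where "limitin E.mtopology p x' sequentially"
    using complete unfolding mcomplete_of_def E.mcomplete_def by blast
  then have x': "x' \<in> mspace E" "(\<lambda>i. mdist E (p i) x') \<longlonglongrightarrow> 0"
    using limitin_mtopology_of[of E p x' sequentially] by (auto simp: mtopology_of_def)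
  then have "limitin (mtopology_of Z) (\<lambda>i. \<phi>M (p i)) (\<phi>M x') sequentially"
    using p(1) \<phi>M_in by (simp add: limitin_mtopology_of \<phi>M_dist)
  then have "y = \<phi>M x'"
    using lim_p limitin_mtopology_of_unique by metis
  then have "limitin (mtopology_of Z) (\<lambda>i. (\<phi> \<circ> r) i ((x \<circ> r) i)) (completion_extension M_inf Z \<phi>_inf x') sequentially"
    using y by (simp add: comp_def z_def \<phi>M_def)
  moreover have "flat_converges n Z (M \<circ> r) (\<phi> \<circ> r) M_inf \<phi>_inf"
    using assms(13) LIMSEQ_subseq_LIMSEQ[OF _ r(1), of
        "\<lambda>j. flat_dist n Z (embedded_current (M j) Z (\<phi> j)) (embedded_current M_inf Z \<phi>_inf)" 0]
    by (simp add: flat_converges_def comp_def)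
  ultimately have "pointed_flat_converges n Z (M \<circ> r) (\<phi> \<circ> r) (x \<circ> r) M_inf \<phi>_inf x'"
    using x'(1) xM by (simp add: pointed_flat_converges_def E_def)
  then show ?thesis
    using r(1) x'(1) unfolding E_def by blast
qed

end
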